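(* Let $p,\tilde p\in L_2(0,2\pi)$ and $q,\tilde q\in W_2^{-1}(0,2\pi)$ be complex-valued, and let $\{\mu_k\}_{k\in\mathbb Z\setminus\{0\}}$ and $\{\tilde\mu_k\}_{k\in\mathbb Z\setminus\{0\}}$ be the eigenvalues, counted with multiplicities, of the boundary value problems $$-y''+q(x)y+2\lambda p(x)y=\lambda^2y,\quad x\in(0,2\pi),\qquad y(0)=y(2\pi)=0,$$ and $$-y''+\tilde q(x)y+2\lambda\tilde p(x)y=\lambda^2y,\quad x\in(0,2\pi),\qquad y(0)=y(2\pi)=0,$$ respectively. If $q=\tilde q$ in $W_2^{-1}(\pi,2\pi)$, $p=\tilde p$ in $L_2(\pi,2\pi)$, and $\{\mu_k\}_{k\in\mathbb Z\setminus\{0\}}=\{\tilde\mu_k\}_{k\in\mathbb Z\setminus\{0\}}$ (counting multiplicities), then $q=\tilde q$ and $p=\tilde p$ on $(0,2\pi)$, i.e. $q=\tilde q$ in $W_2^{-1}(0,2\pi)$ and $p=\tilde p$ in $L_2(0,2\pi)$.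
   Context: $q\in W_2^{-1}(a,b)$ means $q=\sigma'$ in the sense of distributions on $(a,b)$ for some $\sigma\in L_2(a,b)$; such $\sigma$ is determined by $q$ up to an additive constant. For any such $\sigma\in L_2(0,2\pi)$, the equation $-y''+qy+2\lambda py=\lambda^2y$ on $(0,2\pi)$ is understood in the regularized form $$-(y^{[1]})'-\sigma y^{[1]}-\sigma^2y+2\lambda py=\lambda^2y,\qquad y^{[1]}:=y'-\sigma y,$$ where $y,y^{[1]}\in AC[0,2\pi]$ and $(y^{[1]})'+\sigma y^{[1]}+\sigma^2y\in L_2(0,2\pi)$. Let $S(x,\lambda)$ be the unique solution with $S(0,\lambda)=0$, $S^{[1]}(0,\lambda)=1$. The eigenvalues of the Dirichlet problem are the zeros of the entire function $\lambda\mapsto S(2\pi,\lambda)$, counted with their multiplicities as zeros; they do not depend on the choice of $\sigma$. They can be enumerated as $\{\mu_k\}_{k\in\mathbb Z\setminus\{0\}}$ so that $\mu_k=\frac k2+\frac1{2\pi}\int_0^{2\pi}p(t)\,dt+\varkappa_k$ with $\{\varkappa_k\}\in\ell_2$. *)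

theory Defs
  imports "HOL-Complex_Analysis.Complex_Analysis"
begin

text \<open>The space \<open>L\<^sub>2(a,b)\<close>, on representatives.\<close>

definition L2 :: "real \<Rightarrow> real \<Rightarrow> (real \<Rightarrow> complex) set" where
  "L2 a b = {f. f \<in> borel_measurable (lebesgue_on {a<..<b}) \<and>
                integrable (lebesgue_on {a<..<b}) (\<lambda>x. (cmod (f x))\<^sup>2)}"

definition L2_eq :: "real \<Rightarrow> real \<Rightarrow> (real \<Rightarrow> complex) \<Rightarrow> (real \<Rightarrow> complex) \<Rightarrow> bool" where
  "L2_eq a b f g \<longleftrightarrow> (AE x in lebesgue_on {a<..<b}. f x = g x)"

definition smooth :: "(real \<Rightarrow> complex) \<Rightarrow> bool" where
  "smooth \<phi> \<longleftrightarrow>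
     (\<forall>n x. ((\<lambda>g t. vector_derivative g (at t)) ^^ n) \<phi> differentiable (at x))"

text \<open>Test functions on \<open>(a,b)\<close>, extended by zero to the real line. The support is a closed
  subset of a bounded interval, hence compact.\<close>

definition test_functions :: "real \<Rightarrow> real \<Rightarrow> (real \<Rightarrow> complex) set" where
  "test_functions a b = {\<phi>. smooth \<phi> \<and> closure {x. \<phi> x \<noteq> 0} \<subseteq> {a<..<b}}"

text \<open>A distribution on \<open>(a,b)\<close> is a functional of which only the values on
  \<^term>\<open>test_functions a b\<close> matter; the restriction of a distribution to a smaller interval is
  then the same functional, looked at on fewer test functions. Linearity and continuity
  need not be required separately: they follow from being the derivative of an \<open>L\<^sub>2\<close> function.\<close>

type_synonym distribution = "(real \<Rightarrow> complex) \<Rightarrow> complex"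

definition distribution_eq :: "real \<Rightarrow> real \<Rightarrow> distribution \<Rightarrow> distribution \<Rightarrow> bool" where
  "distribution_eq a b q r \<longleftrightarrow> (\<forall>\<phi>\<in>test_functions a b. q \<phi> = r \<phi>)"

definition distribution_deriv :: "real \<Rightarrow> real \<Rightarrow> (real \<Rightarrow> complex) \<Rightarrow> distribution" where
  "distribution_deriv a b \<sigma> =
     (\<lambda>\<phi>. - (LINT x|lebesgue_on {a<..<b}. \<sigma> x * vector_derivative \<phi> (at x)))"

definition W2_neg1 :: "real \<Rightarrow> real \<Rightarrow> distribution set" where
  "W2_neg1 a b = {q. \<exists>\<sigma>\<in>L2 a b. distribution_eq a b q (distribution_deriv a b \<sigma>)}"

definition AC :: "real \<Rightarrow> real \<Rightarrow> (real \<Rightarrow> complex) set" where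
  "AC a b = {f. \<forall>\<epsilon>>0. \<exists>\<delta>>0. \<forall>D.
     finite D \<and> (\<forall>(s, t)\<in>D. a \<le> s \<and> s \<le> t \<and> t \<le> b) \<and>
     disjoint_family_on (\<lambda>(s, t). {s<..<t}) D \<and> (\<Sum>(s, t)\<in>D. t - s) < \<delta> \<longrightarrow>
     (\<Sum>(s, t)\<in>D. cmod (f t - f s)) < \<epsilon>}"

text \<open>\<open>y\<close> solves \<open>-y'' + \<sigma>' y + 2 l p y = l\<^sup>2 y\<close> on \<open>(0, 2\<pi>)\<close> in the regularized sense, and
  \<open>y1\<close> is the absolutely continuous representative of the quasi-derivative \<open>y' - \<sigma> y\<close>.\<close>

definition is_solution ::
  "(real \<Rightarrow> complex) \<Rightarrow> (real \<Rightarrow> complex) \<Rightarrow> complex \<Rightarrow> (real \<Rightarrow> complex) \<Rightarrow> (real \<Rightarrow> complex) \<Rightarrow> bool"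
where
  "is_solution \<sigma> p l y y1 \<longleftrightarrow>
     y \<in> AC 0 (2 * pi) \<and> y1 \<in> AC 0 (2 * pi) \<and>
     (\<lambda>x. vector_derivative y1 (at x) + \<sigma> x * y1 x + (\<sigma> x)\<^sup>2 * y x) \<in> L2 0 (2 * pi) \<and>
     (AE x in lebesgue_on {0<..<2 * pi}.
        y differentiable (at x) \<and> y1 x = vector_derivative y (at x) - \<sigma> x * y x) \<and>
     (AE x in lebesgue_on {0<..<2 * pi}.
        y1 differentiable (at x) \<and>
        - vector_derivative y1 (at x) - \<sigma> x * y1 x - (\<sigma> x)\<^sup>2 * y x + 2 * l * p x * y x
          = l\<^sup>2 * y x)"

text \<open>The solution \<open>S(x, l)\<close> with \<open>S(0, l) = 0\<close> and \<open>y1(0) = 1\<close>. Solutions are unique on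
  \<open>[0, 2\<pi>]\<close> only, so the description operator is applied to the value at \<open>x\<close>.\<close>

definition S_sol :: "(real \<Rightarrow> complex) \<Rightarrow> (real \<Rightarrow> complex) \<Rightarrow> real \<Rightarrow> complex \<Rightarrow> complex" where
  "S_sol \<sigma> p x l =
     (THE v. \<exists>y y1. is_solution \<sigma> p l y y1 \<and> y 0 = 0 \<and> y1 0 = 1 \<and> v = y x)"

text \<open>To be used for sequences that take every value only finitely often (\<^const>\<open>card\<close> is \<open>0\<close> on
  infinite sets).\<close>

definition same_multiset :: "(int \<Rightarrow> complex) \<Rightarrow> (int \<Rightarrow> complex) \<Rightarrow> bool" where
  "same_multiset \<mu> \<nu> \<longleftrightarrow>
     (\<forall>z. card {k. k \<noteq> 0 \<and> \<mu> k = z} = card {k. k \<noteq> 0 \<and> \<nu> k = z})"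

text \<open>\<open>\<mu>\<close>, restricted to the nonzero integers, enumerates the zeros of \<open>f\<close> with multiplicities.
  For an entire function \<open>f\<close> that is not identically zero, \<^term>\<open>zorder f z\<close> is the multiplicity
  of \<open>z\<close> as a zero of \<open>f\<close>; it is \<open>0\<close> if \<open>f z \<noteq> 0\<close>.\<close>

definition enumerates_zeros :: "(complex \<Rightarrow> complex) \<Rightarrow> (int \<Rightarrow> complex) \<Rightarrow> bool" where
  "enumerates_zeros f \<mu> \<longleftrightarrow>
     (\<forall>z. finite {k. k \<noteq> 0 \<and> \<mu> k = z} \<and> int (card {k. k \<noteq> 0 \<and> \<mu> k = z}) = zorder f z)"

text \<open>\<open>S(2\<pi>, l)\<close> does not depend on which \<open>\<sigma>\<close> with \<open>q = \<sigma>'\<close> is chosen, so it is immaterial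
  whether \<open>\<sigma>\<close> is quantified existentially or universally.\<close>

definition dirichlet_eigenvalues ::
  "distribution \<Rightarrow> (real \<Rightarrow> complex) \<Rightarrow> (int \<Rightarrow> complex) \<Rightarrow> bool"
where
  "dirichlet_eigenvalues q p \<mu> \<longleftrightarrow>
     (\<exists>\<sigma>\<in>L2 0 (2 * pi).
        distribution_eq 0 (2 * pi) q (distribution_deriv 0 (2 * pi) \<sigma>) \<and>
        enumerates_zeros (S_sol \<sigma> p (2 * pi)) \<mu>)"

end

theory Submission
  imports Defs
begin

text \<open>
  Let \<open>S\<close>, \<open>S'\<close> be the solutions of the two problems with Dirichlet data at \<open>0\<close>, and \<open>\<psi>\<close> the common
  solution on \<open>(\<pi>, 2\<pi>)\<close> with Dirichlet data at \<open>2\<pi>\<close>. The function \<open>\<Delta> = S(2\<pi>, \<cdot>)\<close> is the Wronskian of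
  \<open>S\<close> and \<open>\<psi>\<close> at \<open>\<pi>\<close>. All quotients below are handled by one principle: if \<open>F = G H\<close> with entire
  functions, \<open>F\<close> and \<open>H\<close> are \<open>O(exp(a\<bar>Im \<lambda>\<bar>))\<close>, and \<open>\<bar>H\<bar>\<close> is at least \<open>c exp(a\<bar>Im \<lambda>\<bar>)\<close> away from the
  real axis, then \<open>G\<close> is constant (in the remaining strip, apply Montel's theorem to the horizontal
  translates of \<open>H\<close>). Only crude bounds on solutions are needed, no asymptotics near the real axis.

  Equal zeros give \<open>\<Delta> = \<epsilon> \<Delta>'\<close> with a constant \<open>\<epsilon>\<close>. Then the Cauchy data at \<open>\<pi>\<close> satisfy
  \<open>S - \<epsilon> S' = k \<psi>\<close>, with a constant \<open>k\<close>; as \<open>\<lambda>\<close> tends to \<open>\<i>\<infinity>\<close>, solutions started on the left have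
  logarithmic derivative \<open>-\<i>\<lambda>\<close> and those started on the right \<open>\<i>\<lambda>\<close>, which forces \<open>k = 0\<close>. Finally
  consider the product of the transfer matrix from \<open>\<pi>\<close> to \<open>x\<close> of one problem with the inverse of the
  other: by the principle its upper right entry vanishes for all \<open>\<lambda>\<close>, and then its differential
  equation, read at \<open>\<lambda> = 0\<close> and \<open>\<lambda> = 1\<close>, gives the equality of the coefficients on \<open>(0, \<pi>)\<close>.
\<close>

section \<open>Absolutely continuous functions\<close>

text \<open>The coefficients are complex, so there is no self-adjointness to exploit and zeros of
  \<Delta> may be multiple or nonreal; everything rests on growth in the spectral parameter.
  Differential equations are available only as almost everywhere identities for absolutely
  continuous functions. The potential q itself never enters them: an antiderivative \<sigma> appears
  in a first-order system for y and its quasi-derivative y1, and since \<sigma> is known only up to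
  a constant, the two antiderivatives must be aligned on (\<pi>, 2\<pi>) before the problems can be
  compared there. Dirichlet solutions decay like 1/\<lambda> relative to the exponential, so the
  growth principle is applied to \<lambda> y in place of y. In its last application two such factors
  stand in the numerator and one in the denominator; the surplus factor yields \<lambda>
  e(\<lambda>) = const for the upper right entry e, and \<lambda> = 0 shows that the constant is
  zero. Solutions with data on the right are reflected into solutions with data at 0, so that one
  set of estimates serves both directions.\<close>

abbreviation nonoverlapping :: "real \<Rightarrow> real \<Rightarrow> real \<Rightarrow> (real \<times> real) set \<Rightarrow> bool" where
  "nonoverlapping a b \<delta> D \<equiv> finite D \<and> (\<forall>(s, t)\<in>D. a \<le> s \<and> s \<le> t \<and> t \<le> b) \<and>
     disjoint_family_on (\<lambda>(s, t). {s<..<t}) D \<and> (\<Sum>(s, t)\<in>D. t - s) < \<delta>"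

text \<open>Links the gauge integral to absolute continuity: the intervals of a tagged partial
  division inside U have disjoint interiors, so their total length is at most the measure of U and
  their endpoints form an admissible family. Two tags can share an interval only if it is
  degenerate, and then its increment is zero.\<close>

lemma AC_cover_sum:
  fixes F :: "real \<Rightarrow> complex"
  assumes ac: "\<And>D. nonoverlapping a b \<delta> D \<Longrightarrow> (\<Sum>(s, t)\<in>D. cmod (F t - F s)) < e"
    and p: "p tagged_partial_division_of {a..b}"
    and U: "U \<in> lmeasurable" "measure lebesgue U < \<delta>" "\<And>x K. (x, K) \<in> p \<Longrightarrow> K \<subseteq> U"
  shows "(\<Sum>(x, K)\<in>p. cmod (F (Sup K) - F (Inf K))) < e"
proof -
  define d where "d = snd ` p"
  have div: "d division_of \<Union>d"
    unfolding d_def by (rule partial_division_of_tagged_division[OF p])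
  have tag: "p tagged_division_of \<Union>d"
    using p unfolding d_def tagged_division_of_def tagged_partial_division_of_def by fastforce
  have "(\<Sum>(x, K)\<in>p. cmod (F (Sup K) - F (Inf K))) =
      (\<Sum>(x, K)\<in>p. (\<lambda>K. if K = {} then 0 else cmod (F (Sup K) - F (Inf K))) K)"
  proof (intro sum.cong refl, clarify)
    fix x K assume "(x, K) \<in> p"
    then have "x \<in> K" by (rule tagged_partial_division_ofD(2)[OF p])
    then show "cmod (F (Sup K) - F (Inf K)) = (if K = {} then 0 else cmod (F (Sup K) - F (Inf K)))"
      by auto
  qed
  also have "\<dots> = (\<Sum>K\<in>snd ` p. if K = {} then 0 else cmod (F (Sup K) - F (Inf K)))"
    by (rule sum.over_tagged_division_lemma[OF tag]) (auto simp: box_eq_empty)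
  also have "\<dots> = (\<Sum>K\<in>d. cmod (F (Sup K) - F (Inf K)))"
    unfolding d_def[symmetric]
    by (rule sum.cong) (use division_ofD(3)[OF div] in auto)
  also have "\<dots> < e"
  proof -
    have cb: "K \<noteq> {}" "a \<le> Inf K" "Inf K \<le> Sup K" "Sup K \<le> b" "K = {Inf K..Sup K}" if K: "K \<in> d" for K
    proof -
      obtain x where x: "(x, K) \<in> p" using K by (auto simp: d_def)
      obtain u v where uv: "K = {u..v}" "K \<subseteq> {a..b}" "x \<in> K"
        using p x unfolding tagged_partial_division_of_def by (metis box_real(2))
      then have "u \<le> v" by auto
      then show "K \<noteq> {}" "a \<le> Inf K" "Inf K \<le> Sup K" "Sup K \<le> b" "K = {Inf K..Sup K}"
        using uv by auto
    qed
    have inj: "inj_on (\<lambda>K. (Inf K, Sup K)) d"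
      by (rule inj_onI) (metis cb(5) prod.inject)
    define D where "D = (\<lambda>K. (Inf K, Sup K)) ` d"
    have disj: "{Inf K<..<Sup K} \<inter> {Inf L<..<Sup L} = {}" if "K \<in> d" "L \<in> d" "K \<noteq> L" for K L
    proof -
      have "interior K \<inter> interior L = {}"
        using division_ofD(5)[OF div] that by blast
      moreover have "interior K = {Inf K<..<Sup K}" "interior L = {Inf L<..<Sup L}"
        using cb(5)[OF that(1)] cb(5)[OF that(2)] interior_atLeastAtMost_real by metis+
      ultimately show ?thesis by simp
    qed
    have fd: "finite d" using div by auto
    have "(\<Sum>K\<in>d. Sup K - Inf K) = (\<Sum>K\<in>d. measure lebesgue {Inf K<..<Sup K})"
      by (rule sum.cong) (use cb in auto)
    also have "\<dots> = measure lebesgue (\<Union>K\<in>d. {Inf K<..<Sup K})"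
      by (rule measure_UNION_AE[symmetric])
        (use fd disj in \<open>fastforce simp: pairwise_def intro!: AE_I2\<close>)+
    also have "\<dots> \<le> measure lebesgue U"
    proof (rule measure_mono_fmeasurable)
      show "(\<Union>K\<in>d. {Inf K<..<Sup K}) \<subseteq> U"
      proof clarify
        fix x K assume K: "K \<in> d" "x \<in> {Inf K<..<Sup K}"
        obtain y where y: "(y, K) \<in> p" using K by (auto simp: d_def)
        have "x \<in> K" using cb(5)[OF K(1)] K(2) by (metis greaterThanLessThan_subseteq_atLeastAtMost_iff order_refl subsetD)
        then show "x \<in> U" using U(3)[OF y] by blast
      qed
    qed (use fd U in auto)
    also have "\<dots> < \<delta>" by (rule U)
    finally have len: "(\<Sum>K\<in>d. Sup K - Inf K) < \<delta>" .
    have "(\<Sum>(s, t)\<in>D. cmod (F t - F s)) < e"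
    proof (rule ac, intro conjI)
      show "finite D" using fd by (simp add: D_def)
      show "\<forall>(s, t)\<in>D. a \<le> s \<and> s \<le> t \<and> t \<le> b" using cb by (auto simp: D_def)
      show "disjoint_family_on (\<lambda>(s, t). {s<..<t}) D"
        unfolding D_def disjoint_family_on_def using disj by fastforce
      show "(\<Sum>(s, t)\<in>D. t - s) < \<delta>"
        unfolding D_def using len by (subst sum.reindex[OF inj]) simp
    qed
    then show ?thesis
      unfolding D_def by (subst (asm) sum.reindex[OF inj]) simp
  qed
  finally show ?thesis .
qed

lemma AC_D:
  assumes "F \<in> AC a b" and "e > 0"
  obtains \<delta> where "\<delta> > 0" "\<And>D. nonoverlapping a b \<delta> D \<Longrightarrow> (\<Sum>(s, t)\<in>D. cmod (F t - F s)) < e"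
  using assms(1)[unfolded AC_def mem_Collect_eq, rule_format, OF assms(2)] that by blast

text \<open>The derivative is two-sided and is required almost everywhere inside (a, b);
  integrability of f is a consequence, by the fundamental theorem below. All differential equations
  are stated in this form, and the closure rules for sums, products and exponentials act as a
  calculus on it.\<close>

definition has_AC_derivative ::
  "(real \<Rightarrow> complex) \<Rightarrow> (real \<Rightarrow> complex) \<Rightarrow> real \<Rightarrow> real \<Rightarrow> bool" where
  "has_AC_derivative F f a b \<longleftrightarrow>
     F \<in> AC a b \<and> (AE x in lebesgue_on {a<..<b}. (F has_vector_derivative f x) (at x))"

lemma AE_lebesgue_on_ivl:
  "(AE x in lebesgue_on {a<..<b::real}. P x) \<longleftrightarrow> (AE x in lebesgue. x \<in> {a<..<b} \<longrightarrow> P x)"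
  by (rule AE_restrict_space_iff) auto

lemma AE_lebesgue_on_negligible:
  "(AE x in lebesgue_on {a<..<b::real}. P x) \<longleftrightarrow> negligible {x\<in>{a<..<b}. \<not> P x}"
proof -
  have "{x \<in> space lebesgue. \<not> (x \<in> {a<..<b} \<longrightarrow> P x)} = {x\<in>{a<..<b}. \<not> P x}" by auto
  then show ?thesis
    unfolding AE_lebesgue_on_ivl negligible_iff_null_sets by (metis completion.AE_iff_null_sets)
qed

text \<open>A gauge argument: at points of differentiability use the straddle estimate; cover the
  exceptional null set by an open set so small that absolute continuity bounds its contribution.\<close>

theorem has_AC_derivative_has_integral:
  assumes F: "has_AC_derivative F f a b" and ab: "a \<le> b"
  shows "(f has_integral (F b - F a)) {a..b}"
proof -
  \<comment> \<open>The endpoints are exceptional too, since the derivative is known only inside the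
    interval.\<close>
  define N where "N = {x\<in>{a<..<b}. \<not> (F has_vector_derivative f x) (at x)} \<union> {a, b}"
  have negN: "negligible N"
    using F unfolding has_AC_derivative_def AE_lebesgue_on_negligible N_def by auto
  have dN: "(F has_vector_derivative f x) (at x)" if "x \<in> {a..b} - N" for x
    using that by (auto simp: N_def)
  \<comment> \<open>With this choice a tag in N contributes only an increment of F, which absolute
    continuity controls.\<close>
  define f' where "f' = (\<lambda>x. if x \<in> N then 0 else f x)"
  have "(f' has_integral (F b - F a)) {a..b}"
    unfolding has_integral_real
  proof (intro allI impI)
    fix e :: real assume e: "e > 0"
    \<comment> \<open>The summand 1 keeps the denominator positive when a = b.\<close>
    define e' where "e' = e / (2 * (b - a + 1))"
    have e': "e' > 0" "e' * (b - a) \<le> e / 2"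
      using e ab by (auto simp: e'_def field_simps)
    obtain \<delta> where \<delta>: "\<delta> > 0" and ac: "\<And>D. nonoverlapping a b \<delta> D \<Longrightarrow> (\<Sum>(s, t)\<in>D. cmod (F t - F s)) < e / 2"
    proof (rule AC_D)
      show "F \<in> AC a b" using F by (simp add: has_AC_derivative_def)
      show "e / 2 > 0" using e by simp
    qed (rule that)
    have Nl: "N \<in> null_sets lebesgue" using negN by (simp add: negligible_iff_null_sets)
    then obtain U where U: "open U" "N \<subseteq> U" "U - N \<in> lmeasurable" "emeasure lebesgue (U - N) < ennreal \<delta>"
      using sets_lebesgue_outer_open[of N \<delta>] \<delta> by (metis negN negligible_imp_sets)
    have UU: "U \<in> lmeasurable"
    proof -
      have "(U - N) \<union> N \<in> lmeasurable"
        using U(3) Nl by (intro fmeasurable.Un) (auto intro: fmeasurableI_null_sets)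
      moreover have "(U - N) \<union> N = U" using U(2) by auto
      ultimately show ?thesis by simp
    qed
    have Um: "measure lebesgue U < \<delta>"
    proof -
      have "measure lebesgue U = measure lebesgue (U - N)"
        using measure_Diff_null_set[of U lebesgue N] Nl UU by (simp add: fmeasurableD)
      then show ?thesis using U(3,4) \<delta>
        by (metis emeasure_eq_measure2 ennreal_less_iff measure_nonneg)
    qed
    have "\<exists>d>0. (x \<in> N \<longrightarrow> ball x d \<subseteq> U) \<and> (x \<in> {a..b} - N \<longrightarrow>
        (\<forall>y. norm (y-x) < d \<longrightarrow> norm (F y - F x - (y-x) *\<^sub>R f x) \<le> e' * norm (y-x)))" for x
    proof (cases "x \<in> N")
      case True
      then show ?thesis using U(1,2) by (meson DiffD2 openE subsetD)
    next
      case False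
      show ?thesis
      proof (cases "x \<in> {a..b}")
        case True
        then have "(F has_vector_derivative f x) (at x)" using dN False by auto
        then show ?thesis using e'(1) False
          unfolding has_vector_derivative_def has_derivative_within_alt by auto
      qed (use False in \<open>auto intro: exI[of _ 1]\<close>)
    qed
    then obtain d where d: "\<And>x. d x > 0" "\<And>x. x \<in> N \<Longrightarrow> ball x (d x) \<subseteq> U"
        "\<And>x y. x \<in> {a..b} - N \<Longrightarrow> norm (y-x) < d x \<Longrightarrow> norm (F y - F x - (y-x) *\<^sub>R f x) \<le> e' * norm (y-x)"
      by metis
    show "\<exists>\<gamma>. gauge \<gamma> \<and> (\<forall>p. p tagged_division_of {a..b} \<and> \<gamma> fine p \<longrightarrow>
        norm ((\<Sum>(x, k)\<in>p. measure lborel k *\<^sub>R f' x) - (F b - F a)) < e)"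
    proof (intro exI conjI allI impI)
      show "gauge (\<lambda>x. ball x (d x))" using d(1) gauge_ball_dependent by blast
      fix p assume p: "p tagged_division_of {a..b} \<and> (\<lambda>x. ball x (d x)) fine p"
      then have ptag: "p tagged_division_of {a..b}" and fine: "(\<lambda>x. ball x (d x)) fine p" by auto
      have part: "p tagged_partial_division_of {a..b}" using ptag by (simp add: tagged_division_of_def)
      have fin: "finite p" using ptag by auto
      have ba: "b - a = (\<Sum>(x,K)\<in>p. Sup K - Inf K)" "F b - F a = (\<Sum>(x,K)\<in>p. F(Sup K) - F(Inf K))"
        using additive_tagged_division_1[where f= "\<lambda>x. x"] additive_tagged_division_1[where f= F]
            ab ptag by auto
      define p1 where "p1 = {xk\<in>p. fst xk \<in> N}"
      define p2 where "p2 = {xk\<in>p. fst xk \<notin> N}"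
      have pp: "p = p1 \<union> p2" "p1 \<inter> p2 = {}" "finite p1" "finite p2" "p1 \<subseteq> p" "p2 \<subseteq> p"
        using fin by (auto simp: p1_def p2_def)
      have "(\<Sum>(x, K)\<in>p. measure lborel K *\<^sub>R f' x) - (F b - F a)
          = (\<Sum>(x, K)\<in>p. measure lborel K *\<^sub>R f' x - (F(Sup K) - F(Inf K)))"
        by (simp add: ba(2) split_def sum_subtractf)
      also have "\<dots> = (\<Sum>(x, K)\<in>p1. measure lborel K *\<^sub>R f' x - (F(Sup K) - F(Inf K)))
          + (\<Sum>(x, K)\<in>p2. measure lborel K *\<^sub>R f' x - (F(Sup K) - F(Inf K)))"
        by (subst pp(1)) (rule sum.union_disjoint[OF pp(3,4,2)])
      finally have eq: "norm ((\<Sum>(x, K)\<in>p. measure lborel K *\<^sub>R f' x) - (F b - F a)) \<le>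
          norm (\<Sum>(x, K)\<in>p1. measure lborel K *\<^sub>R f' x - (F(Sup K) - F(Inf K)))
          + norm (\<Sum>(x, K)\<in>p2. measure lborel K *\<^sub>R f' x - (F(Sup K) - F(Inf K)))"
        by (simp only: norm_triangle_ineq)
      have "norm (\<Sum>(x, K)\<in>p1. measure lborel K *\<^sub>R f' x - (F(Sup K) - F(Inf K))) \<le>
          (\<Sum>(x, K)\<in>p1. cmod (F(Sup K) - F(Inf K)))"
        by (rule sum_norm_le) (auto simp: p1_def f'_def norm_minus_commute)
      also have "\<dots> < e / 2"
      proof (rule AC_cover_sum[OF ac _ UU Um])
        show "p1 tagged_partial_division_of {a..b}"
          using tagged_partial_division_subset[OF part pp(5)] .
        show "K \<subseteq> U" if "(x, K) \<in> p1" for x K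
        proof -
          have "(x, K) \<in> p" "x \<in> N" using that by (auto simp: p1_def)
          then show ?thesis using fine d(2)[of x] unfolding fine_def by fastforce
        qed
      qed
      finally have 1: "norm (\<Sum>(x, K)\<in>p1. measure lborel K *\<^sub>R f' x - (F(Sup K) - F(Inf K))) < e / 2" .
      have "norm (\<Sum>(x, K)\<in>p2. measure lborel K *\<^sub>R f' x - (F(Sup K) - F(Inf K))) \<le>
          (\<Sum>(x, K)\<in>p2. e' * (Sup K - Inf K))"
      proof (rule sum_norm_le, clarify)
        fix x K assume xK: "(x, K) \<in> p2"
        then have xp: "(x, K) \<in> p" and xN: "x \<notin> N" by (auto simp: p2_def)
        obtain u v where k: "K = cbox u v" and "x \<in> K" and kab: "K \<subseteq> {a..b}"
          using part xp unfolding tagged_partial_division_of_def by metis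
        have uv: "u \<le> v" using \<open>x \<in> K\<close> unfolding k by auto
        have ball: "K \<subseteq> ball x (d x)" using fine xp by (auto simp: fine_def)
        have "u \<in> K" "v \<in> K" by (simp_all add: uv k)
        have x: "x \<in> {a..b} - N" using xN \<open>x \<in> K\<close> kab by auto
        have "norm ((v - u) *\<^sub>R f x - (F v - F u))
            = norm (F u - F x - (u - x) *\<^sub>R f x - (F v - F x - (v - x) *\<^sub>R f x))"
          by (simp add: algebra_simps)
        also have "\<dots> \<le> norm (F u - F x - (u - x) *\<^sub>R f x) + norm (F v - F x - (v - x) *\<^sub>R f x)"
          by (rule norm_triangle_ineq4)
        also have "\<dots> \<le> e' * norm (u - x) + e' * norm (v - x)"
          by (intro add_mono d(3)[OF x])
            (use ball \<open>u \<in> K\<close> \<open>v \<in> K\<close> in \<open>auto simp: dist_real_def subset_iff abs_minus_commute\<close>)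
        also have "\<dots> = e' * (v - u)"
          using \<open>x \<in> K\<close> uv by (auto simp: k field_simps)
        finally show "norm (measure lborel K *\<^sub>R f' x - (F (Sup K) - F (Inf K))) \<le> e' * (Sup K - Inf K)"
          using uv xN by (simp add: k f'_def)
      qed
      also have "\<dots> \<le> (\<Sum>(x, K)\<in>p. e' * (Sup K - Inf K))"
      proof (rule sum_mono2[OF fin pp(6)])
        fix xk assume "xk \<in> p - p2"
        then obtain x K where xk: "xk = (x, K)" "(x, K) \<in> p" by (cases xk) auto
        obtain u v where "K = cbox u v" "x \<in> K"
          using part xk unfolding tagged_partial_division_of_def by metis
        then show "0 \<le> (case xk of (x, K) \<Rightarrow> e' * (Sup K - Inf K))" using e' xk by auto
      qed
      also have "\<dots> = e' * (b - a)" by (simp add: ba(1) sum_distrib_left split_def)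
      finally have 2: "norm (\<Sum>(x, K)\<in>p2. measure lborel K *\<^sub>R f' x - (F(Sup K) - F(Inf K))) \<le> e / 2"
        using e'(2) by linarith
      show "norm ((\<Sum>(x, K)\<in>p. measure lborel K *\<^sub>R f' x) - (F b - F a)) < e"
        using eq 1 2 by linarith
    qed
  qed
  then show ?thesis
    by (rule has_integral_spike[OF negN, rotated]) (simp add: f'_def)
qed

text \<open>The nondegenerate intervals of D form a division of their union, over which the integral
  is additive; as h is nonnegative, the union may then be enlarged to [a, b].\<close>

lemma sum_disjoint_integrals_le:
  fixes h :: "real \<Rightarrow> real"
  assumes h: "h integrable_on {a..b}" "\<And>x. x \<in> {a..b} \<Longrightarrow> 0 \<le> h x"
    and D: "finite D" "\<forall>(s, t)\<in>D. a \<le> s \<and> s \<le> t \<and> t \<le> b"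
      "disjoint_family_on (\<lambda>(s, t). {s<..<t}) D"
  shows "(\<Sum>(s, t)\<in>D. integral {s..t} h) \<le> integral {a..b} h"
proof -
  define D' where "D' = {st\<in>D. fst st < snd st}"
  define d where "d = (\<lambda>(s, t). {s..t}) ` D'"
  have finD': "finite D'" using D by (simp add: D'_def)
  have inj: "inj_on (\<lambda>(s, t). {s..t}) D'"
    by (auto simp: inj_on_def D'_def Icc_eq_Icc)
  have int: "h integrable_on {s..t}" if "(s, t) \<in> D'" for s t
    using D(2) that by (intro integrable_on_subinterval[OF h(1)]) (auto simp: D'_def)
  have div: "d division_of \<Union>d"
  proof (rule division_ofI)
    show "finite d" by (simp add: d_def finD')
    fix K1 assume K1: "K1 \<in> d"
    then obtain s t where st: "(s, t) \<in> D'" "K1 = {s..t}" by (auto simp: d_def)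
    show "K1 \<subseteq> \<Union>d" using K1 by auto
    show "K1 \<noteq> {}" using st by (auto simp: D'_def)
    show "\<exists>a b. K1 = cbox a b" using st by auto
    fix K2 assume K2: "K2 \<in> d" "K1 \<noteq> K2"
    then obtain s' t' where st': "(s', t') \<in> D'" "K2 = {s'..t'}" by (auto simp: d_def)
    have "(s, t) \<noteq> (s', t')" using K2 st st' by auto
    then have "{s<..<t} \<inter> {s'<..<t'} = {}"
      using D(3) st st' unfolding disjoint_family_on_def D'_def by fastforce
    then show "interior K1 \<inter> interior K2 = {}"
      by (simp add: st st')
  qed auto
  have "(\<Sum>(s, t)\<in>D. integral {s..t} h) = (\<Sum>(s, t)\<in>D'. integral {s..t} h)"
  proof (rule sum.mono_neutral_right[OF D(1)])
    show "D' \<subseteq> D" by (auto simp: D'_def)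
    show "\<forall>st\<in>D - D'. (case st of (s, t) \<Rightarrow> integral {s..t} h) = 0"
      using D(2) by (auto simp: D'_def order.order_iff_strict)
  qed
  also have "\<dots> = (\<Sum>K\<in>d. integral K h)"
    unfolding d_def by (subst sum.reindex[OF inj]) (simp add: split_def)
  also have "\<dots> = integral (\<Union>d) h"
    by (rule integral_combine_division_bottomup[symmetric, OF div]) (use int in \<open>auto simp: d_def\<close>)
  also have "\<dots> \<le> integral {a..b} h"
  proof (rule integral_subset_le)
    show sub: "\<Union>d \<subseteq> {a..b}" using D(2) by (fastforce simp: d_def D'_def)
    show "h integrable_on \<Union>d"
      by (rule integrable_combine_division[OF div]) (use int in \<open>auto simp: d_def\<close>)
  qed (use h in auto)
  finally show ?thesis .
qed

text \<open>|f| is at most n plus its excess \<open>h n\<close> over the level n. By dominated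
  convergence the excess has integral below e/2 for some n, and the bounded part contributes at most
  n times the total length of the family; hence the choice e/(2(n + 1)) for \<delta>.\<close>

lemma indefinite_integral_in_AC:
  fixes f :: "real \<Rightarrow> complex"
  assumes f: "f absolutely_integrable_on {a..b}"
  shows "(\<lambda>x. integral {a..x} f) \<in> AC a b"
  unfolding AC_def mem_Collect_eq
proof (intro allI impI)
  fix e :: real assume e: "e > 0"
  define h where "h = (\<lambda>n x. max 0 (cmod (f x) - real n))"
  have nf: "(\<lambda>x. cmod (f x)) absolutely_integrable_on {a..b}"
    using f by (rule set_integrable_norm)
  have hint: "h n absolutely_integrable_on {a..b}" for n
    unfolding h_def
    by (intro absolutely_integrable_max_1 set_integral_diff nf)
      (auto intro: absolutely_integrable_on_const)
  have "(\<lambda>n. integral {a..b} (h n)) \<longlonglongrightarrow> integral {a..b} (\<lambda>x. 0)"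
  proof (rule dominated_convergence(2))
    show "h n integrable_on {a..b}" for n
      using hint[of n] by (simp add: absolutely_integrable_on_def)
    show "(\<lambda>x. cmod (f x)) integrable_on {a..b}"
      using nf by (simp add: absolutely_integrable_on_def)
    show "norm (h n x) \<le> cmod (f x)" for n x by (auto simp: h_def)
    show "(\<lambda>n. h n x) \<longlonglongrightarrow> 0" for x
    proof (rule tendsto_eventually)
      have "eventually (\<lambda>n. n \<ge> nat \<lceil>cmod (f x)\<rceil>) sequentially" by (rule eventually_ge_at_top)
      then show "eventually (\<lambda>n. h n x = 0) sequentially"
      proof eventually_elim
        case (elim n)
        then have "cmod (f x) \<le> real n" by linarith
        then show ?case by (simp add: h_def)
      qed
    qed
  qed
  then have "eventually (\<lambda>n. integral {a..b} (h n) < e / 2) sequentially"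
    using e by (intro order_tendstoD(2)) auto
  then obtain n where n: "integral {a..b} (h n) < e / 2"
    by (auto simp: eventually_sequentially)
  show "\<exists>\<delta>>0. \<forall>D. nonoverlapping a b \<delta> D \<longrightarrow>
      (\<Sum>(s, t)\<in>D. cmod (integral {a..t} f - integral {a..s} f)) < e"
  proof (intro exI[of _ "e / (2 * (real n + 1))"] conjI allI impI)
    show "e / (2 * (real n + 1)) > 0" using e by simp
    fix D assume "nonoverlapping a b (e / (2 * (real n + 1))) D"
    then have D: "finite D" "\<forall>(s, t)\<in>D. a \<le> s \<and> s \<le> t \<and> t \<le> b"
        "disjoint_family_on (\<lambda>(s, t). {s<..<t}) D" "(\<Sum>(s, t)\<in>D. t - s) < e / (2 * (real n + 1))"
      by auto
    have "(\<Sum>(s, t)\<in>D. cmod (integral {a..t} f - integral {a..s} f)) \<le>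
        (\<Sum>(s, t)\<in>D. real n * (t - s) + integral {s..t} (h n))"
    proof (rule sum_mono, clarify)
      fix s t assume "(s, t) \<in> D"
      then have st: "a \<le> s" "s \<le> t" "t \<le> b" using D(2) by auto
      have fi: "f integrable_on {a..b}" using f by (simp add: absolutely_integrable_on_def)
      have "integral {a..s} f + integral {s..t} f = integral {a..t} f"
        using st by (intro Henstock_Kurzweil_Integration.integral_combine
            integrable_on_subinterval[OF fi]) auto
      then have "cmod (integral {a..t} f - integral {a..s} f) = cmod (integral {s..t} f)"
        by (metis add_diff_cancel_left')
      also have "\<dots> \<le> integral {s..t} (\<lambda>x. real n + h n x)"
      proof (rule integral_norm_bound_integral)
        show "f integrable_on {s..t}" using st by (intro integrable_on_subinterval[OF fi]) auto
        have "(\<lambda>x. real n + h n x) integrable_on {a..b}"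
          using hint[of n] by (intro integrable_add) (auto simp: absolutely_integrable_on_def)
        then show "(\<lambda>x. real n + h n x) integrable_on {s..t}"
          by (rule integrable_on_subinterval) (use st in auto)
      qed (auto simp: h_def)
      also have "\<dots> = real n * (t - s) + integral {s..t} (h n)"
      proof -
        have hi: "h n integrable_on {a..b}"
          using hint[of n] by (simp add: absolutely_integrable_on_def)
        have "h n integrable_on {s..t}"
          by (rule integrable_on_subinterval[OF hi]) (use st in auto)
        then have "integral {s..t} (\<lambda>x. real n + h n x) = integral {s..t} (\<lambda>x. real n) + integral {s..t} (h n)"
          by (intro integral_add) auto
        then show ?thesis using st by simp
      qed
      finally show "cmod (integral {a..t} f - integral {a..s} f) \<le> real n * (t - s) + integral {s..t} (h n)" .
    qed
    also have "\<dots> = real n * (\<Sum>(s, t)\<in>D. t - s) + (\<Sum>(s, t)\<in>D. integral {s..t} (h n))"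
      by (simp add: sum.distrib sum_distrib_left split_def)
    also have "\<dots> < e"
    proof -
      have "(\<Sum>(s, t)\<in>D. integral {s..t} (h n)) \<le> integral {a..b} (h n)"
        by (rule sum_disjoint_integrals_le[OF _ _ D(1-3)])
          (use hint[of n] in \<open>auto simp: absolutely_integrable_on_def h_def\<close>)
      moreover have "real n * (\<Sum>(s, t)\<in>D. t - s) \<le> real n * (e / (2 * (real n + 1)))"
        using D(4) by (intro mult_left_mono) auto
      moreover have "real n * (e / (2 * (real n + 1))) \<le> e / 2"
        using e by (simp add: field_simps)
      ultimately show ?thesis using n by linarith
    qed
    finally show "(\<Sum>(s, t)\<in>D. cmod (integral {a..t} f - integral {a..s} f)) < e" .
  qed
qed

lemma negligible_reflect:
  fixes N :: "real set"
  assumes "negligible N"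
  shows "negligible ((\<lambda>x. k - x) ` N)"
  by (rule negligible_differentiable_image_negligible[OF order_refl assms])
    (auto simp: differentiable_on_def)

text \<open>Lebesgue differentiation: \<open>integrable_ccontinuous_explicit\<close> gives the
  derivative from the right off a null set N1. Applied to the reflected function
  \<open>g (- x)\<close>, it gives the derivative from the left off the mirror image of N2.\<close>

theorem indefinite_integral_has_AC_derivative:
  fixes f :: "real \<Rightarrow> complex"
  assumes f: "f absolutely_integrable_on {a..b}"
  shows "has_AC_derivative (\<lambda>x. integral {a..x} f) f a b"
  unfolding has_AC_derivative_def
proof
  show "(\<lambda>x. integral {a..x} f) \<in> AC a b" by (rule indefinite_integral_in_AC[OF f])
  define g where "g = (\<lambda>x. if x \<in> {a..b} then f x else 0)"
  have fi: "f integrable_on {a..b}" using f by (simp add: absolutely_integrable_on_def)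
  then have "g integrable_on UNIV" unfolding g_def by (simp only: Henstock_Kurzweil_Integration.integrable_restrict_UNIV)
  then have gi: "g integrable_on {c..d}" for c d
    by (rule integrable_on_subinterval[where b=d and a=c]) auto
  have gi2: "(\<lambda>x. g (- x)) integrable_on {c..d}" for c d
    using gi[of "- d" "- c"] Henstock_Kurzweil_Integration.integrable_reflect_real[where f=g and a="- d" and b="- c"] by simp
  obtain N1 where N1: "negligible N1" "\<And>x e. \<lbrakk>x \<notin> N1; 0 < e\<rbrakk> \<Longrightarrow>
      \<exists>d>0. \<forall>h. 0 < h \<and> h < d \<longrightarrow> norm (integral {x..x + h} g /\<^sub>R h - g x) < e"
    using integrable_ccontinuous_explicit[of g] gi by auto
  obtain N2 where N2: "negligible N2" "\<And>x e. \<lbrakk>x \<notin> N2; 0 < e\<rbrakk> \<Longrightarrow>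
      \<exists>d>0. \<forall>h. 0 < h \<and> h < d \<longrightarrow> norm (integral {x..x + h} (\<lambda>x. g (-x)) /\<^sub>R h - g (- x)) < e"
    using integrable_ccontinuous_explicit[of "\<lambda>x. g (-x)"] gi2 by auto
  have der: "((\<lambda>x. integral {a..x} f) has_vector_derivative f x) (at x)"
    if x: "a < x" "x < b" "x \<notin> N1" "- x \<notin> N2" for x
    unfolding has_vector_derivative_def has_derivative_within_alt
  proof (intro conjI allI impI)
    show "bounded_linear (\<lambda>xa. xa *\<^sub>R f x)" by (rule bounded_linear_scaleR_left)
    fix e :: real assume e: "e > 0"
    obtain d1 where d1: "d1 > 0" "\<And>h. 0 < h \<Longrightarrow> h < d1 \<Longrightarrow> norm (integral {x..x + h} g /\<^sub>R h - g x) < e"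
      using N1(2)[OF x(3) e] by auto
    obtain d2 where d2: "d2 > 0"
      "\<And>h. 0 < h \<Longrightarrow> h < d2 \<Longrightarrow> norm (integral {-x..-x + h} (\<lambda>x. g (-x)) /\<^sub>R h - g x) < e"
      using N2(2)[OF x(4) e] by auto
    define d where "d = Min {d1, d2, x - a, b - x}"
    have d: "d > 0" "d \<le> d1" "d \<le> d2" "d \<le> x - a" "d \<le> b - x"
      using x d1 d2 by (auto simp: d_def)
    have gf: "integral {s..t} g = integral {s..t} f" if "a \<le> s" "t \<le> b" for s t
      by (rule integral_cong) (use that in \<open>auto simp: g_def\<close>)
    have comb: "integral {a..t} f - integral {a..s} f = integral {s..t} g" if "a \<le> s" "s \<le> t" "t \<le> b" for s t
    proof -
      have "integral {a..s} f + integral {s..t} f = integral {a..t} f"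
        using that by (intro Henstock_Kurzweil_Integration.integral_combine
            integrable_on_subinterval[OF fi]) auto
      then show ?thesis using gf[of s t] that by (metis add_diff_cancel_left')
    qed
    have scale: "norm (I - h *\<^sub>R z) \<le> e * h" if "norm (I /\<^sub>R h - z) < e" "h > 0" for I z :: complex and h :: real
    proof -
      have "norm (I - h *\<^sub>R z) = norm (h *\<^sub>R (I /\<^sub>R h - z))"
        using that(2) by (simp add: scaleR_diff_right)
      also have "\<dots> \<le> e * h" using that by (simp add: mult.commute)
      finally show ?thesis .
    qed
    show "\<exists>d>0. \<forall>y\<in>UNIV. norm (y - x) < d \<longrightarrow>
        norm (integral {a..y} f - integral {a..x} f - (y - x) *\<^sub>R f x) \<le> e * norm (y - x)"
    proof (intro exI[of _ d] conjI ballI impI d(1))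
      fix y assume y: "norm (y - x) < d"
      have gx: "g x = f x" using x by (simp add: g_def)
      consider "y = x" | "y > x" | "y < x" by linarith
      then show "norm (integral {a..y} f - integral {a..x} f - (y - x) *\<^sub>R f x) \<le> e * norm (y - x)"
      proof cases
        case 2
        have "norm (integral {x..x + (y - x)} g - (y - x) *\<^sub>R g x) \<le> e * (y - x)"
          by (rule scale, rule d1(2)) (use 2 y d in auto)
        then show ?thesis using 2 comb[of x y] x y d gx by auto
      next
        case 3
        have "norm (integral {-x..-x + (x - y)} (\<lambda>x. g (-x)) - (x - y) *\<^sub>R g x) \<le> e * (x - y)"
          by (rule scale, rule d2(2)) (use 3 y d in auto)
        moreover have "integral {-x..-y} (\<lambda>x. g (-x)) = integral {y..x} g" by (rule Henstock_Kurzweil_Integration.integral_reflect_real)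
        ultimately have "norm (integral {y..x} g - (x - y) *\<^sub>R f x) \<le> e * (x - y)" using gx by simp
        moreover have "integral {a..y} f - integral {a..x} f - (y - x) *\<^sub>R f x
            = - (integral {y..x} g - (x - y) *\<^sub>R f x)"
          using comb[of y x] 3 x y d by (simp add: algebra_simps)
        ultimately show ?thesis using 3 by (simp only: norm_minus_cancel) simp
      qed simp
    qed
  qed
  have "negligible (N1 \<union> uminus ` N2)"
    using N1(1) negligible_reflect[OF N2(1), of 0] by (simp add: negligible_Un)
  then show "AE x in lebesgue_on {a<..<b}. ((\<lambda>x. integral {a..x} f) has_vector_derivative f x) (at x)"
    unfolding AE_lebesgue_on_negligible
  proof (rule negligible_subset, clarify)
    fix x assume x: "x \<in> {a<..<b}" "\<not> ((\<lambda>x. integral {a..x} f) has_vector_derivative f x) (at x)" "x \<notin> uminus ` N2"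
    have "- x \<notin> N2" using x(3) by (metis image_eqI minus_minus)
    then show "x \<in> N1" using der[of x] x by auto
  qed
qed

text \<open>Serves sums, products and exponentials alike: in each case the increments of the new
  function are bounded by those of at most two given ones.\<close>

lemma AC_dominated:
  assumes G: "G \<in> AC a b" and H: "H \<in> AC a b" and C: "C \<ge> 0"
    and dom: "\<And>s t. \<lbrakk>a \<le> s; s \<le> t; t \<le> b\<rbrakk> \<Longrightarrow>
      cmod (F t - F s) \<le> C * (cmod (G t - G s) + cmod (H t - H s))"
  shows "F \<in> AC a b"
  unfolding AC_def mem_Collect_eq
proof (intro allI impI)
  fix e :: real assume e: "e > 0"
  define e' where "e' = e / (2 * (C + 1))"
  have e': "e' > 0" using e C by (simp add: e'_def)
  obtain d1 where d1: "d1 > 0" "\<And>D. nonoverlapping a b d1 D \<Longrightarrow> (\<Sum>(s, t)\<in>D. cmod (G t - G s)) < e'"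
    by (rule AC_D[OF G e']) (rule that)
  obtain d2 where d2: "d2 > 0" "\<And>D. nonoverlapping a b d2 D \<Longrightarrow> (\<Sum>(s, t)\<in>D. cmod (H t - H s)) < e'"
    by (rule AC_D[OF H e']) (rule that)
  show "\<exists>\<delta>>0. \<forall>D. nonoverlapping a b \<delta> D \<longrightarrow>
      (\<Sum>(s, t)\<in>D. cmod (F t - F s)) < e"
  proof (intro exI[of _ "min d1 d2"] conjI allI impI)
    show "min d1 d2 > 0" using d1 d2 by simp
    fix D assume D: "nonoverlapping a b (min d1 d2) D"
    have "(\<Sum>(s, t)\<in>D. cmod (F t - F s)) \<le>
        (\<Sum>(s, t)\<in>D. C * (cmod (G t - G s) + cmod (H t - H s)))"
      by (rule sum_mono) (use D dom in auto)
    also have "\<dots> = C * ((\<Sum>(s, t)\<in>D. cmod (G t - G s)) + (\<Sum>(s, t)\<in>D. cmod (H t - H s)))"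
      by (simp add: sum_distrib_left sum.distrib split_def distrib_left)
    also have "\<dots> \<le> C * (e' + e')"
      using d1(2)[of D] d2(2)[of D] D C by (intro mult_left_mono add_mono) auto
    also have "\<dots> = C * e / (C + 1)" using C by (simp add: e'_def divide_simps) (simp add: algebra_simps)?
    also have "\<dots> < e" using e C by (simp add: field_simps)
    finally show "(\<Sum>(s, t)\<in>D. cmod (F t - F s)) < e" .
  qed
qed

section \<open>Continuity, restriction and reflection of absolutely continuous functions\<close>

lemma AC_diff_less:
  assumes "F \<in> AC a b" "e > 0"
  obtains \<delta> where "\<delta> > 0" "\<And>s t. \<lbrakk>s \<in> {a..b}; t \<in> {a..b}; \<bar>t - s\<bar> < \<delta>\<rbrakk> \<Longrightarrow> cmod (F t - F s) < e"
proof -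
  obtain \<delta> where \<delta>: "\<delta> > 0" "\<And>D. nonoverlapping a b \<delta> D \<Longrightarrow> (\<Sum>(s, t)\<in>D. cmod (F t - F s)) < e"
    by (rule AC_D[OF assms]) (rule that)
  have *: "cmod (F t - F s) < e" if "s \<in> {a..b}" "t \<in> {a..b}" "s \<le> t" "t - s < \<delta>" for s t
    using \<delta>(2)[of "{(s, t)}"] that by (simp add: disjoint_family_on_def)
  show thesis
  proof (rule that[OF \<delta>(1)])
    fix s t assume "s \<in> {a..b}" "t \<in> {a..b}" "\<bar>t - s\<bar> < \<delta>"
    then show "cmod (F t - F s) < e"
      using *[of s t] *[of t s] by (cases "s \<le> t") (auto simp: norm_minus_commute)
  qed
qed

lemma AC_continuous_on:
  assumes "F \<in> AC a b" shows "continuous_on {a..b} F"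
  unfolding continuous_on_iff
proof (intro ballI allI impI)
  fix x e :: real assume x: "x \<in> {a..b}" and e: "e > 0"
  obtain \<delta> where "\<delta> > 0" "\<And>s t. \<lbrakk>s \<in> {a..b}; t \<in> {a..b}; \<bar>t - s\<bar> < \<delta>\<rbrakk> \<Longrightarrow> cmod (F t - F s) < e"
    by (rule AC_diff_less[OF assms e]) (rule that)
  then show "\<exists>d>0. \<forall>x'\<in>{a..b}. dist x' x < d \<longrightarrow> dist (F x') (F x) < e"
    using x by (auto simp: dist_norm intro!: exI[of _ \<delta>])
qed

lemma AC_bounded:
  assumes "F \<in> AC a b"
  obtains B where "B \<ge> 0" "\<And>x. x \<in> {a..b} \<Longrightarrow> cmod (F x) \<le> B"
proof -
  have "bounded (F ` {a..b})"
    by (intro compact_imp_bounded compact_continuous_image AC_continuous_on[OF assms]) auto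
  then obtain B where "\<forall>x\<in>{a..b}. cmod (F x) \<le> B" by (auto simp: bounded_iff)
  then show thesis by (intro that[of "max 0 B"]) (auto simp: le_max_iff_disj)
qed

lemma AC_subinterval:
  assumes "F \<in> AC a b" "a \<le> c" "d \<le> b" shows "F \<in> AC c d"
  unfolding AC_def mem_Collect_eq
proof (intro allI impI)
  fix e :: real assume e: "e > 0"
  obtain \<delta> where \<delta>: "\<delta> > 0" "\<And>D. nonoverlapping a b \<delta> D \<Longrightarrow> (\<Sum>(s, t)\<in>D. cmod (F t - F s)) < e"
    by (rule AC_D[OF assms(1) e]) (rule that)
  show "\<exists>\<delta>>0. \<forall>D. nonoverlapping c d \<delta> D \<longrightarrow>
      (\<Sum>(s, t)\<in>D. cmod (F t - F s)) < e"
    using assms(2,3) by (intro exI[of _ \<delta>] conjI \<delta>(1) allI impI \<delta>(2)) auto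
qed

text \<open>Needed to turn data at the right endpoint into data at the left one. The map r carries
  an admissible family to an admissible family of the same total length.\<close>

lemma AC_reflect:
  assumes "F \<in> AC a b" shows "(\<lambda>x. F (k - x)) \<in> AC (k - b) (k - a)"
  unfolding AC_def mem_Collect_eq
proof (intro allI impI)
  fix e :: real assume e: "e > 0"
  obtain \<delta> where \<delta>: "\<delta> > 0" "\<And>D. nonoverlapping a b \<delta> D \<Longrightarrow> (\<Sum>(s, t)\<in>D. cmod (F t - F s)) < e"
    by (rule AC_D[OF assms(1) e]) (rule that)
  show "\<exists>\<delta>>0. \<forall>D. nonoverlapping (k - b) (k - a) \<delta> D \<longrightarrow>
      (\<Sum>(s, t)\<in>D. cmod (F (k - t) - F (k - s))) < e"
  proof (intro exI[of _ \<delta>] conjI \<delta>(1) allI impI, elim conjE)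
    fix D :: "(real \<times> real) set"
    assume D: "finite D" "\<forall>(s, t)\<in>D. k - b \<le> s \<and> s \<le> t \<and> t \<le> k - a"
      "disjoint_family_on (\<lambda>(s, t). {s<..<t}) D" "(\<Sum>(s, t)\<in>D. t - s) < \<delta>"
    define r where "r = (\<lambda>(s, t). (k - t, k - s :: real))"
    have inj: "inj_on r D" by (auto simp: inj_on_def r_def)
    have "(\<Sum>(s, t)\<in>r ` D. cmod (F t - F s)) < e"
    proof (rule \<delta>(2), intro conjI)
      show "disjoint_family_on (\<lambda>(s, t). {s<..<t}) (r ` D)"
        unfolding disjoint_family_on_def
      proof (intro ballI impI)
        fix m n assume mn: "m \<in> r ` D" "n \<in> r ` D" "m \<noteq> n"
        obtain s t s' t' where st: "(s, t) \<in> D" "(s', t') \<in> D" "m = r (s, t)" "n = r (s', t')"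
          using mn by auto
        have "{s<..<t} \<inter> {s'<..<t'} = {}"
          using D(3) st mn(3) unfolding disjoint_family_on_def by fastforce
        then have e: "{s<..<t} \<inter> {s'<..<t'} = {}" .
        show "(case m of (s, t) \<Rightarrow> {s<..<t}) \<inter> (case n of (s, t) \<Rightarrow> {s<..<t}) = {}"
        proof (rule equals0I)
          fix y assume "y \<in> (case m of (s, t) \<Rightarrow> {s<..<t}) \<inter> (case n of (s, t) \<Rightarrow> {s<..<t})"
          then have "k - y \<in> {s<..<t} \<inter> {s'<..<t'}" by (auto simp: st r_def)
          then show False using e by blast
        qed
      qed
      show "(\<Sum>(s, t)\<in>r ` D. t - s) < \<delta>"
        using D(4) by (subst sum.reindex[OF inj]) (simp add: r_def split_def)
    qed (use D in \<open>auto simp: r_def\<close>)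
    then show "(\<Sum>(s, t)\<in>D. cmod (F (k - t) - F (k - s))) < e"
      by (subst (asm) sum.reindex[OF inj]) (simp add: r_def split_def norm_minus_commute)
  qed
qed

lemma AC_lipschitz:
  assumes C: "C \<ge> 0" and "\<And>s t. \<lbrakk>a \<le> s; s \<le> t; t \<le> b\<rbrakk> \<Longrightarrow> cmod (F t - F s) \<le> C * (t - s)"
  shows "F \<in> AC a b"
  unfolding AC_def mem_Collect_eq
proof (intro allI impI)
  fix e :: real assume e: "e > 0"
  show "\<exists>\<delta>>0. \<forall>D. nonoverlapping a b \<delta> D \<longrightarrow>
      (\<Sum>(s, t)\<in>D. cmod (F t - F s)) < e"
  proof (intro exI[of _ "e / (C + 1)"] conjI allI impI, use e C in simp, elim conjE)
    fix D assume D: "finite D" "\<forall>(s, t)\<in>D. a \<le> s \<and> s \<le> t \<and> t \<le> b"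
      "(\<Sum>(s, t)\<in>D. t - s) < e / (C + 1)"
    have "(\<Sum>(s, t)\<in>D. cmod (F t - F s)) \<le> (\<Sum>(s, t)\<in>D. C * (t - s))"
      by (rule sum_mono) (use D(2) assms(2) in auto)
    also have "\<dots> = C * (\<Sum>(s, t)\<in>D. t - s)" by (simp add: sum_distrib_left split_def)
    also have "\<dots> \<le> C * (e / (C + 1))" using D(3) C by (intro mult_left_mono) auto
    also have "\<dots> < e" using e C by (simp add: field_simps)
    finally show "(\<Sum>(s, t)\<in>D. cmod (F t - F s)) < e" .
  qed
qed

section \<open>Calculus of almost everywhere derivatives\<close>

lemma has_AC_derivative_continuous_on:
  "has_AC_derivative F f a b \<Longrightarrow> continuous_on {a..b} F"
  unfolding has_AC_derivative_def by (auto intro: AC_continuous_on)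

lemma AE_lebesgue_on_subinterval:
  assumes "AE x in lebesgue_on {a<..<b::real}. P x" "a \<le> c" "d \<le> b"
  shows "AE x in lebesgue_on {c<..<d}. P x"
  using assms(1) unfolding AE_lebesgue_on_ivl by eventually_elim (use assms in auto)

lemma AE_lebesgue_on_reflect:
  assumes "AE x in lebesgue_on {a<..<b::real}. P x"
  shows "AE x in lebesgue_on {k - b<..<k - a}. P (k - x)"
proof -
  have "negligible ((\<lambda>x. k - x) ` {x\<in>{a<..<b}. \<not> P x})"
    using assms unfolding AE_lebesgue_on_negligible by (rule negligible_reflect)
  then show ?thesis
    unfolding AE_lebesgue_on_negligible
  proof (rule negligible_subset, clarify)
    fix x assume "x \<in> {k - b<..<k - a}" "\<not> P (k - x)"
    then show "x \<in> (\<lambda>x. k - x) ` {x\<in>{a<..<b}. \<not> P x}"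
      by (intro image_eqI[of _ _ "k - x"]) auto
  qed
qed

lemma has_AC_derivative_subinterval:
  assumes "has_AC_derivative F f a b" "a \<le> c" "d \<le> b"
  shows "has_AC_derivative F f c d"
  using assms unfolding has_AC_derivative_def
  by (auto intro: AC_subinterval AE_lebesgue_on_subinterval)

lemma has_AC_derivative_cong_AE:
  assumes F: "has_AC_derivative F f a b" and fg: "AE x in lebesgue_on {a<..<b}. f x = g x"
  shows "has_AC_derivative F g a b"
  using F fg unfolding has_AC_derivative_def by auto

text \<open>Agreement on [a, b] suffices although derivatives are two-sided, because only interior
  points matter. It is the rule that brings the output of the closure rules to the form wanted, and
  it absorbs all algebra in the verification of differential equations.\<close>

lemma has_AC_derivative_cong:
  assumes F: "has_AC_derivative F f a b" and "\<And>x. x \<in> {a..b} \<Longrightarrow> F x = G x"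
    and "\<And>x. x \<in> {a<..<b} \<Longrightarrow> f x = g x"
  shows "has_AC_derivative G g a b"
  unfolding has_AC_derivative_def
proof
  have "F \<in> AC a b" using F by (simp add: has_AC_derivative_def)
  from AC_dominated[OF this this, of 1 G] show "G \<in> AC a b" using assms(2) by simp
  have "AE x in lebesgue_on {a<..<b}. (F has_vector_derivative f x) (at x)"
    using F by (simp add: has_AC_derivative_def)
  with AE_space show "AE x in lebesgue_on {a<..<b}. (G has_vector_derivative g x) (at x)"
  proof eventually_elim
    case (elim x)
    then have x: "x \<in> {a<..<b}" by simp
    show ?case
      by (rule has_vector_derivative_transform_within_open[of F _ x "{a<..<b}"])
        (use elim x assms in auto)
  qed
qed

lemma has_AC_derivative_const: "has_AC_derivative (\<lambda>x. c) (\<lambda>x. 0) a b"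
  unfolding has_AC_derivative_def by (auto intro: AC_lipschitz[of 0])

lemma has_AC_derivative_id: "has_AC_derivative (\<lambda>x. of_real x) (\<lambda>x. 1) a b"
  unfolding has_AC_derivative_def
  by (auto intro!: AC_lipschitz[of 1] has_vector_derivative_of_real derivative_eq_intros
      simp: of_real_diff[symmetric] simp del: of_real_diff)

lemma has_AC_derivative_add:
  assumes "has_AC_derivative F f a b" "has_AC_derivative G g a b"
  shows "has_AC_derivative (\<lambda>x. F x + G x) (\<lambda>x. f x + g x) a b"
  unfolding has_AC_derivative_def
proof
  have FG: "F \<in> AC a b" "G \<in> AC a b" using assms by (auto simp: has_AC_derivative_def)
  show "(\<lambda>x. F x + G x) \<in> AC a b"
    by (rule AC_dominated[OF FG, of 1]) (auto, smt (verit) add_diff_add norm_triangle_ineq)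
  show "AE x in lebesgue_on {a<..<b}. ((\<lambda>x. F x + G x) has_vector_derivative f x + g x) (at x)"
    using assms unfolding has_AC_derivative_def by (auto elim!: eventually_elim2 intro: has_vector_derivative_add)
qed

lemma has_AC_derivative_mult:
  assumes "has_AC_derivative F f a b" "has_AC_derivative G g a b"
  shows "has_AC_derivative (\<lambda>x. F x * G x) (\<lambda>x. F x * g x + f x * G x) a b"
  unfolding has_AC_derivative_def
proof
  have FG: "F \<in> AC a b" "G \<in> AC a b" using assms by (auto simp: has_AC_derivative_def)
  obtain A where A: "A \<ge> 0" "\<And>x. x \<in> {a..b} \<Longrightarrow> cmod (F x) \<le> A" by (rule AC_bounded[OF FG(1)]) (rule that)
  obtain B where B: "B \<ge> 0" "\<And>x. x \<in> {a..b} \<Longrightarrow> cmod (G x) \<le> B" by (rule AC_bounded[OF FG(2)]) (rule that)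
  show "(\<lambda>x. F x * G x) \<in> AC a b"
  proof (rule AC_dominated[OF FG, of "A + B"])
    fix s t assume st: "a \<le> s" "s \<le> t" "t \<le> b"
    have "F t * G t - F s * G s = (F t - F s) * G t + F s * (G t - G s)" by (simp add: algebra_simps)
    then have "cmod (F t * G t - F s * G s) \<le> cmod (F t - F s) * cmod (G t) + cmod (F s) * cmod (G t - G s)"
      by (metis norm_triangle_ineq norm_mult)
    also have "\<dots> \<le> cmod (F t - F s) * (A + B) + (A + B) * cmod (G t - G s)"
    proof (intro add_mono mult_left_mono mult_right_mono norm_ge_zero)
      show "cmod (G t) \<le> A + B" using B(2)[of t] A(1) st by auto
      show "cmod (F s) \<le> A + B" using A(2)[of s] B(1) st by auto
    qed
    finally show "cmod (F t * G t - F s * G s) \<le> (A + B) * (cmod (F t - F s) + cmod (G t - G s))"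
      by (simp add: algebra_simps)
  qed (use A B in simp)
  show "AE x in lebesgue_on {a<..<b}. ((\<lambda>x. F x * G x) has_vector_derivative F x * g x + f x * G x) (at x)"
    using assms unfolding has_AC_derivative_def by (auto elim!: eventually_elim2 intro: has_vector_derivative_mult)
qed

lemma has_AC_derivative_cmult:
  "has_AC_derivative F f a b \<Longrightarrow> has_AC_derivative (\<lambda>x. c * F x) (\<lambda>x. c * f x) a b"
  using has_AC_derivative_mult[OF has_AC_derivative_const[of c a b], of F f] by simp

lemma has_AC_derivative_minus:
  "has_AC_derivative F f a b \<Longrightarrow> has_AC_derivative (\<lambda>x. - F x) (\<lambda>x. - f x) a b"
  using has_AC_derivative_cmult[of F f a b "-1"] by simp

lemma has_AC_derivative_diff:
  "has_AC_derivative F f a b \<Longrightarrow> has_AC_derivative G g a b \<Longrightarrow>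
    has_AC_derivative (\<lambda>x. F x - G x) (\<lambda>x. f x - g x) a b"
  using has_AC_derivative_add[OF _ has_AC_derivative_minus, of F f a b G g] by simp

text \<open>Mean value inequality on the disc of radius R, where the derivative of exp is bounded by
  exp R.\<close>

lemma cmod_exp_diff_le:
  assumes "cmod z \<le> R" "cmod w \<le> R"
  shows "cmod (exp z - exp w) \<le> exp R * cmod (z - w)"
proof (rule field_differentiable_bound[of "cball 0 R" exp exp])
  show "norm (exp z) \<le> exp R" if "z \<in> cball 0 R" for z :: complex
  proof -
    have "Re z \<le> R" using that complex_Re_le_cmod[of z] by auto
    then show ?thesis by simp
  qed
  show "(exp has_field_derivative exp z) (at z within cball 0 R)" for z :: complex
    by (intro DERIV_exp has_field_derivative_at_within)
qed (use assms in auto)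

lemma has_AC_derivative_exp:
  assumes "has_AC_derivative F f a b"
  shows "has_AC_derivative (\<lambda>x. exp (F x)) (\<lambda>x. f x * exp (F x)) a b"
  unfolding has_AC_derivative_def
proof
  have F: "F \<in> AC a b" using assms by (auto simp: has_AC_derivative_def)
  obtain A where A: "A \<ge> 0" "\<And>x. x \<in> {a..b} \<Longrightarrow> cmod (F x) \<le> A" by (rule AC_bounded[OF F]) (rule that)
  show "(\<lambda>x. exp (F x)) \<in> AC a b"
  proof (rule AC_dominated[OF F F, of "exp A"])
    fix s t assume st: "a \<le> s" "s \<le> t" "t \<le> b"
    have "cmod (exp (F t) - exp (F s)) \<le> exp A * cmod (F t - F s)"
      using A st by (intro cmod_exp_diff_le) auto
    also have "\<dots> \<le> exp A * (cmod (F t - F s) + cmod (F t - F s))"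
      by (intro mult_left_mono) auto
    finally show "cmod (exp (F t) - exp (F s)) \<le> exp A * (cmod (F t - F s) + cmod (F t - F s))" .
  qed simp
  have "AE x in lebesgue_on {a<..<b}. (F has_vector_derivative f x) (at x)"
    using assms unfolding has_AC_derivative_def by simp
  then show "AE x in lebesgue_on {a<..<b}. ((\<lambda>x. exp (F x)) has_vector_derivative f x * exp (F x)) (at x)"
  proof eventually_elim
    case (elim x)
    show ?case using field_vector_diff_chain_at[OF elim DERIV_exp[of "F x"]] by (simp add: o_def)
  qed
qed

lemma has_AC_derivative_reflect:
  assumes "has_AC_derivative F f a b"
  shows "has_AC_derivative (\<lambda>x. F (k - x)) (\<lambda>x. - f (k - x)) (k - b) (k - a)"
  unfolding has_AC_derivative_def
proof
  show "(\<lambda>x. F (k - x)) \<in> AC (k - b) (k - a)"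
    using assms by (auto simp: has_AC_derivative_def intro: AC_reflect)
  have "AE x in lebesgue_on {a<..<b}. (F has_vector_derivative f x) (at x)"
    using assms by (simp add: has_AC_derivative_def)
  from AE_lebesgue_on_reflect[OF this, of k]
  show "AE x in lebesgue_on {k - b<..<k - a}. ((\<lambda>x. F (k - x)) has_vector_derivative - f (k - x)) (at x)"
  proof eventually_elim
    case (elim x)
    have "((\<lambda>x. k - x) has_vector_derivative -1) (at x)"
      by (auto intro!: derivative_eq_intros)
    from vector_diff_chain_at[OF this elim] show ?case by (simp add: o_def)
  qed
qed

lemma has_AC_derivative_unique_AE:
  assumes "has_AC_derivative F f a b" "has_AC_derivative F g a b"
  shows "AE x in lebesgue_on {a<..<b}. f x = g x"
  using assms unfolding has_AC_derivative_def
  by (auto elim!: eventually_elim2 intro: vector_derivative_unique_at)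

lemma has_AC_derivative_eq_integral:
  assumes "has_AC_derivative F f a b" "x \<in> {a..b}"
  shows "(f has_integral F x - F a) {a..x}" "F x = F a + integral {a..x} f"
proof -
  show *: "(f has_integral F x - F a) {a..x}"
    using assms by (intro has_AC_derivative_has_integral has_AC_derivative_subinterval[OF assms(1)]) auto
  show "F x = F a + integral {a..x} f" using integral_unique[OF *] by simp
qed

text \<open>Absolute continuity excludes functions of Cantor type: every increment is the integral
  of an almost everywhere vanishing function.\<close>

lemma has_AC_derivative_zero_const:
  assumes "has_AC_derivative F f a b" "AE x in lebesgue_on {a<..<b}. f x = 0" "x \<in> {a..b}" "y \<in> {a..b}"
  shows "F x = F y"
proof -
  have "has_AC_derivative F (\<lambda>x. 0) a b" using assms(1,2) by (rule has_AC_derivative_cong_AE)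
  from has_AC_derivative_eq_integral(2)[OF this assms(3)] has_AC_derivative_eq_integral(2)[OF this assms(4)]
  show ?thesis by simp
qed

text \<open>If F and G differed at x, continuity would make them differ on a whole interval near x,
  which is not negligible. Identities obtained by differentiating hold almost everywhere only; this
  extends them to every point, endpoints included.\<close>

lemma continuous_AE_eq:
  fixes F G :: "real \<Rightarrow> 'a::real_normed_vector"
  assumes F: "continuous_on {a..b} F" "continuous_on {a..b} G"
    and ae: "AE x in lebesgue_on {a<..<b}. F x = G x" and x: "x \<in> {a..b}" and ab: "a < b"
  shows "F x = G x"
proof (rule ccontr)
  assume ne: "F x \<noteq> G x"
  have "continuous_on {a..b} (\<lambda>x. norm (F x - G x))" by (intro continuous_intros F)
  then obtain d where d: "d > 0" "\<And>y. y \<in> {a..b} \<Longrightarrow> \<bar>y - x\<bar> < d \<Longrightarrow>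
      \<bar>norm (F y - G y) - norm (F x - G x)\<bar> < norm (F x - G x)"
    unfolding continuous_on_iff dist_real_def using x ne by (metis right_minus_eq zero_less_norm_iff)
  define u where "u = max a (x - d)"
  define v where "v = min b (x + d)"
  have uv: "u < v" using x d ab by (auto simp: u_def v_def)
  have "{u<..<v} \<subseteq> {x\<in>{a<..<b}. F x \<noteq> G x}"
  proof
    fix y assume "y \<in> {u<..<v}"
    then have y: "y \<in> {a<..<b}" "\<bar>y - x\<bar> < d" by (auto simp: u_def v_def)
    then have "F y \<noteq> G y" using d(2)[of y] by fastforce
    then show "y \<in> {x\<in>{a<..<b}. F x \<noteq> G x}" using y by simp
  qed
  then have "negligible {u<..<v}"
    using ae negligible_subset unfolding AE_lebesgue_on_negligible by blast
  then show False using open_not_negligible[of "{u<..<v}"] uv by auto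
qed

section \<open>Integrable products and square integrable functions on an interval\<close>

lemma absolutely_integrable_mult_continuous:
  fixes f g :: "real \<Rightarrow> 'a::{real_normed_field,euclidean_space}"
  assumes "f absolutely_integrable_on {a..b}" "continuous_on {a..b} g"
  shows "(\<lambda>x. f x * g x) absolutely_integrable_on {a..b}"
proof -
  have "(\<lambda>x. g x * f x) absolutely_integrable_on {a..b}"
  proof (rule absolutely_integrable_bounded_measurable_product[where h="(*)"])
    show "bilinear ((*) :: 'a \<Rightarrow> 'a \<Rightarrow> 'a)"
      by (rule bilinear_times)
    show "g \<in> borel_measurable (lebesgue_on {a..b})"
      using assms(2) by (intro continuous_imp_measurable_on_sets_lebesgue) auto
    show "bounded (g ` {a..b})"
      using assms(2) by (intro compact_imp_bounded compact_continuous_image) auto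
  qed (use assms in auto)
  then show ?thesis by (simp add: mult.commute)
qed

lemma absolutely_integrable_on_open_ivl:
  fixes f :: "real \<Rightarrow> 'a::euclidean_space"
  shows "f absolutely_integrable_on {a<..<b} \<longleftrightarrow> f absolutely_integrable_on {a..b}"
  by (rule absolutely_integrable_spike_set_eq)
    (rule negligible_subset[of "{a, b}"]; auto)+

text \<open>On a bounded interval the bound |f| \<le> 1 + |f|^2 makes square integrable functions
  integrable. The passage to the closed interval matches the form in which the gauge integral and
  the fundamental theorem are used.\<close>

lemma L2_iff:
  "f \<in> L2 a b \<longleftrightarrow> f absolutely_integrable_on {a..b} \<and>
    (\<lambda>x. (cmod (f x))\<^sup>2) absolutely_integrable_on {a..b}"
proof
  assume f: "f \<in> L2 a b"
  then have m: "f \<in> borel_measurable (lebesgue_on {a<..<b})"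
    and i: "integrable (lebesgue_on {a<..<b}) (\<lambda>x. (cmod (f x))\<^sup>2)" by (auto simp: L2_def)
  have 2: "(\<lambda>x. (cmod (f x))\<^sup>2) absolutely_integrable_on {a<..<b}"
    using i by (subst absolutely_integrable_measurable) (auto simp: o_def)
  have 1: "f absolutely_integrable_on {a<..<b}"
  proof (rule measurable_bounded_by_integrable_imp_absolutely_integrable[OF m])
    have "(\<lambda>x. 1 :: real) absolutely_integrable_on {a<..<b}"
      unfolding absolutely_integrable_on_open_ivl by (rule absolutely_integrable_continuous_real) simp
    then have "(\<lambda>x. 1 + (cmod (f x))\<^sup>2) absolutely_integrable_on {a<..<b}"
      using 2 by (rule set_integral_add)
    then show "(\<lambda>x. 1 + (cmod (f x))\<^sup>2) integrable_on {a<..<b}" by (simp add: absolutely_integrable_on_def)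
    show "cmod (f x) \<le> 1 + (cmod (f x))\<^sup>2" for x
      using sum_power2_ge_zero[of "cmod (f x) - 1/2" 0] by (simp add: power2_eq_square algebra_simps)
  qed auto
  show "f absolutely_integrable_on {a..b} \<and> (\<lambda>x. (cmod (f x))\<^sup>2) absolutely_integrable_on {a..b}"
    using 1 2 by (simp add: absolutely_integrable_on_open_ivl)
next
  assume "f absolutely_integrable_on {a..b} \<and> (\<lambda>x. (cmod (f x))\<^sup>2) absolutely_integrable_on {a..b}"
  then have "f absolutely_integrable_on {a<..<b}" "(\<lambda>x. (cmod (f x))\<^sup>2) absolutely_integrable_on {a<..<b}"
    by (simp_all add: absolutely_integrable_on_open_ivl)
  then show "f \<in> L2 a b"
    unfolding L2_def
    by (auto intro: absolutely_integrable_imp_borel_measurable absolutely_integrable_imp_integrable)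
qed

lemma absolutely_integrable_reflect_ivl:
  fixes f :: "real \<Rightarrow> 'a::euclidean_space"
  assumes "f absolutely_integrable_on {a..b}"
  shows "(\<lambda>x. f (k - x)) absolutely_integrable_on {k - b..k - a}"
proof -
  have *: "(\<lambda>x. g (k - x)) integrable_on {k - b..k - a}" if "g integrable_on {a..b}"
    for g :: "real \<Rightarrow> 'b::euclidean_space"
  proof -
    have "(\<lambda>x. k - x) ` {a..b} = {k - b..k - a}"
    proof (intro equalityI subsetI)
      fix x assume "x \<in> {k - b..k - a}"
      then show "x \<in> (\<lambda>x. k - x) ` {a..b}" by (intro image_eqI[of _ _ "k - x"]) auto
    qed auto
    then show ?thesis using integrable_affinity[of g a b "-1" k] that by simp
  qed
  show ?thesis
    using assms *[of f] *[of "\<lambda>x. norm (f x)"] unfolding absolutely_integrable_on_def by simp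
qed

lemma L2_reflect: "f \<in> L2 a b \<Longrightarrow> (\<lambda>x. f (k - x)) \<in> L2 (k - b) (k - a)"
  unfolding L2_iff
  using absolutely_integrable_reflect_ivl[where f=f and a=a and b=b and k=k]
    absolutely_integrable_reflect_ivl[where f="\<lambda>x. (cmod (f x))\<^sup>2" and a=a and b=b and k=k] by simp

lemma L2_minus: "f \<in> L2 a b \<Longrightarrow> (\<lambda>x. - f x) \<in> L2 a b"
  unfolding L2_def by simp

lemma L2_subinterval:
  assumes "f \<in> L2 a b" "a \<le> c" "d \<le> b" shows "f \<in> L2 c d"
proof -
  have sub: "{c..d} \<subseteq> {a..b}" using assms by auto
  show ?thesis
    using assms(1) unfolding L2_iff
    by (auto intro: set_integrable_subset[OF _ _ sub])
qed

lemma L2_square: "f \<in> L2 a b \<Longrightarrow> (\<lambda>x. (f x)\<^sup>2) absolutely_integrable_on {a..b}"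
proof -
  assume f: "f \<in> L2 a b"
  have "f \<in> borel_measurable (lebesgue_on {a..b})"
    using f unfolding L2_iff by (auto intro: absolutely_integrable_imp_borel_measurable)
  then show ?thesis
    using f unfolding L2_iff
    by (intro measurable_bounded_by_integrable_imp_absolutely_integrable[where g="\<lambda>x. (cmod (f x))\<^sup>2"])
      (auto simp: absolutely_integrable_on_def norm_power)
qed

lemma L2_add_const: 
  assumes f: "f \<in> L2 a b" shows "(\<lambda>x. f x + c) \<in> L2 a b"
proof -
  have c: "(\<lambda>x. c) absolutely_integrable_on {a..b}"
    by (rule absolutely_integrable_continuous_real) simp
  have 1: "(\<lambda>x. f x + c) absolutely_integrable_on {a..b}"
    using f c unfolding L2_iff by (auto intro: set_integral_add)
  have m: "(\<lambda>x. f x + c) \<in> borel_measurable (lebesgue_on {a..b})"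
    using 1 by (auto intro: absolutely_integrable_imp_borel_measurable)
  have "(\<lambda>x. (cmod (f x + c))\<^sup>2) absolutely_integrable_on {a..b}"
  proof (rule measurable_bounded_by_integrable_imp_absolutely_integrable)
    show "(\<lambda>x. (cmod (f x + c))\<^sup>2) \<in> borel_measurable (lebesgue_on {a..b})" using m by measurable
    have "(\<lambda>x. 2 * (cmod c)\<^sup>2) integrable_on {a..b}" by (rule integrable_continuous_interval) simp
    moreover have "(\<lambda>x. (cmod (f x))\<^sup>2) integrable_on {a..b}"
      using f unfolding L2_iff by (simp add: absolutely_integrable_on_def)
    ultimately show "(\<lambda>x. 2 * (cmod (f x))\<^sup>2 + 2 * (cmod c)\<^sup>2) integrable_on {a..b}"
      by (intro integrable_add integrable_on_mult_right) auto
    fix x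
    have "(cmod (f x + c))\<^sup>2 \<le> (cmod (f x) + cmod c)\<^sup>2"
      by (intro power_mono norm_triangle_ineq) auto
    also have "\<dots> \<le> 2 * (cmod (f x))\<^sup>2 + 2 * (cmod c)\<^sup>2"
      using sum_power2_ge_zero[of "cmod (f x) - cmod c" 0] by (simp add: power2_eq_square algebra_simps)
    finally show "norm ((cmod (f x + c))\<^sup>2) \<le> 2 * (cmod (f x))\<^sup>2 + 2 * (cmod c)\<^sup>2" by simp
  qed auto
  with 1 show ?thesis by (simp add: L2_iff)
qed

section \<open>The regularized equation\<close>

lemma absolutely_integrable_subinterval:
  fixes g :: "real \<Rightarrow> 'a::euclidean_space"
  assumes "g absolutely_integrable_on {a..b}" "x \<in> {a..b}"
  shows "g absolutely_integrable_on {a..x}" "g integrable_on {a..x}"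
proof -
  have "{a..x} \<subseteq> {a..b}" using assms(2) by auto
  then show "g absolutely_integrable_on {a..x}"
    by (rule set_integrable_subset[OF assms(1), rotated]) auto
  then show "g integrable_on {a..x}" by (simp add: absolutely_integrable_on_def)
qed

text \<open>The antiderivative exp(2 G)/2, with G the integral of g, is merely absolutely continuous
  because g need not be continuous. The chain rule is therefore taken from the complex calculus of
  \<open>has_AC_derivative\<close>, and real parts are taken at the end.\<close>

lemma exp_weight_has_integral:
  fixes g :: "real \<Rightarrow> real"
  assumes g: "g absolutely_integrable_on {a..b}" and x: "x \<in> {a..b}"
  shows "((\<lambda>t. g t * exp (2 * integral {a..t} g)) has_integral (exp (2 * integral {a..x} g) - 1) / 2) {a..x}"
proof -
  have gc: "(\<lambda>t. complex_of_real (g t)) absolutely_integrable_on {a..b}"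
    using absolutely_integrable_linear[OF g bounded_linear_of_real] by (simp add: o_def)
  have G: "has_AC_derivative (\<lambda>t. integral {a..t} (\<lambda>t. complex_of_real (g t))) (\<lambda>t. of_real (g t)) a b"
    by (rule indefinite_integral_has_AC_derivative[OF gc])
  have eq: "integral {a..t} (\<lambda>t. complex_of_real (g t)) = of_real (integral {a..t} g)" if "t \<in> {a..b}" for t
  proof -
    have "g integrable_on {a..t}"
      by (rule absolutely_integrable_subinterval(2)[OF g that])
    then show ?thesis
      using integral_linear[of g "{a..t}" complex_of_real] by (simp add: o_def bounded_linear_of_real)
  qed
  have "has_AC_derivative (\<lambda>t. complex_of_real (exp (2 * integral {a..t} g)))
      (\<lambda>t. complex_of_real (2 * (g t * exp (2 * integral {a..t} g)))) a b"
    by (rule has_AC_derivative_cong[OF has_AC_derivative_exp[OF has_AC_derivative_cmult[OF G, of 2]]])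
      (auto simp: eq exp_of_real[symmetric])
  from has_AC_derivative_eq_integral(1)[OF this x]
  have "((\<lambda>t. complex_of_real (2 * (g t * exp (2 * integral {a..t} g)))) has_integral
      complex_of_real (exp (2 * integral {a..x} g) - 1)) {a..x}" by simp
  from has_integral_linear[OF this bounded_linear_Re]
  have "((\<lambda>t. 2 * (g t * exp (2 * integral {a..t} g))) has_integral exp (2 * integral {a..x} g) - 1) {a..x}"
    by (simp add: o_def)
  from has_integral_mult_right[OF this, of "1/2"] show ?thesis by simp
qed

lemma continuous_on_indefinite_integral:
  fixes g :: "real \<Rightarrow> 'a::euclidean_space"
  assumes "g absolutely_integrable_on {a..b}"
  shows "continuous_on {a..b} (\<lambda>x. integral {a..x} g)"
  using assms by (intro indefinite_integral_continuous_1) (auto simp: absolutely_integrable_on_def)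

text \<open>Let M be the maximum of u exp(-2 G), attained at x0. The exponent 2 makes the integral
  at x0 absorb only half of M: it is at most M (exp(2 G x0) - 1)/2. What remains is M exp(2 G x0) +
  M \<le> 2 c, hence M \<le> 2 c.\<close>

lemma gronwall:
  fixes g u :: "real \<Rightarrow> real"
  assumes g: "g absolutely_integrable_on {a..b}" "\<And>t. t \<in> {a..b} \<Longrightarrow> g t \<ge> 0"
    and u: "continuous_on {a..b} u"
    and le: "\<And>x. x \<in> {a..b} \<Longrightarrow> u x \<le> c + integral {a..x} (\<lambda>t. g t * u t)"
    and c: "c \<ge> 0" and x: "x \<in> {a..b}"
  shows "u x \<le> 2 * c * exp (2 * integral {a..x} g)"
proof -
  define G where "G = (\<lambda>x. integral {a..x} g)"
  have contG: "continuous_on {a..b} G"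
    unfolding G_def by (rule continuous_on_indefinite_integral[OF g(1)])
  have "\<exists>x0\<in>{a..b}. \<forall>y\<in>{a..b}. u y * exp (- 2 * G y) \<le> u x0 * exp (- 2 * G x0)"
    by (rule continuous_attains_sup) (use x in \<open>auto intro!: continuous_intros u contG\<close>)
  then obtain x0 where x0: "x0 \<in> {a..b}" "\<And>y. y \<in> {a..b} \<Longrightarrow> u y * exp (- 2 * G y) \<le> u x0 * exp (- 2 * G x0)"
    by auto
  define M where "M = u x0 * exp (- 2 * G x0)"
  have uM: "u y \<le> M * exp (2 * G y)" if "y \<in> {a..b}" for y
  proof -
    have "u y * exp (- 2 * G y) * exp (2 * G y) \<le> M * exp (2 * G y)"
      using x0(2)[OF that] by (intro mult_right_mono) (auto simp: M_def)
    then show ?thesis by (simp add: mult.assoc exp_add[symmetric])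
  qed
  have "u x0 \<le> c + integral {a..x0} (\<lambda>t. g t * u t)" by (rule le[OF x0(1)])
  also have "integral {a..x0} (\<lambda>t. g t * u t) \<le> M * ((exp (2 * G x0) - 1) / 2)"
  proof (rule has_integral_le)
    have "(\<lambda>t. g t * u t) integrable_on {a..x0}"
      by (rule absolutely_integrable_subinterval(2)[OF absolutely_integrable_mult_continuous[OF g(1) u] x0(1)])
    then show "((\<lambda>t. g t * u t) has_integral integral {a..x0} (\<lambda>t. g t * u t)) {a..x0}"
      by (rule integrable_integral)
    show "((\<lambda>t. M * (g t * exp (2 * G t))) has_integral M * ((exp (2 * G x0) - 1) / 2)) {a..x0}"
      using exp_weight_has_integral[OF g(1) x0(1)] unfolding G_def by (rule has_integral_mult_right)
    fix t assume t: "t \<in> {a..x0}"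
    then have "g t * u t \<le> g t * (M * exp (2 * G t))"
      using x0(1) by (intro mult_left_mono uM g) auto
    then show "g t * u t \<le> M * (g t * exp (2 * G t))" by (simp add: mult_ac)
  qed
  finally have "u x0 \<le> c + M * ((exp (2 * G x0) - 1) / 2)" by simp
  moreover have "u x0 = M * exp (2 * G x0)" by (simp add: M_def mult.assoc exp_add[symmetric])
  ultimately have 1: "M * exp (2 * G x0) + M \<le> 2 * c" by (simp add: field_simps)
  have "M \<le> 2 * c"
  proof (cases "M \<ge> 0")
    case True
    then have "M * exp (2 * G x0) \<ge> 0" by simp
    then show ?thesis using 1 by linarith
  qed (use c in simp)
  then have "M * exp (2 * G x) \<le> 2 * c * exp (2 * G x)" by (intro mult_right_mono) auto
  with uM[OF x] show ?thesis unfolding G_def by (rule order_trans)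
qed

text \<open>The regularized equation as a first-order system for y and its quasi-derivative, with
  matrix rows (\<sigma>, 1) and (-\<sigma>^2 + 2 l p - l^2, -\<sigma>). The interval is a parameter
  because solutions are also considered on halves of (0, 2\<pi>) and on reflected intervals.\<close>

definition solves ::
  "(real \<Rightarrow> complex) \<Rightarrow> (real \<Rightarrow> complex) \<Rightarrow> complex \<Rightarrow> real \<Rightarrow> real
    \<Rightarrow> (real \<Rightarrow> complex) \<Rightarrow> (real \<Rightarrow> complex) \<Rightarrow> bool" where
  "solves \<sigma> p l a b y y1 \<longleftrightarrow>
     has_AC_derivative y (\<lambda>x. \<sigma> x * y x + y1 x) a b \<and>
     has_AC_derivative y1 (\<lambda>x. - \<sigma> x * y1 x - (\<sigma> x)\<^sup>2 * y x + (2 * l * p x - l\<^sup>2) * y x) a b"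

definition dirichlet_solution ::
  "(real \<Rightarrow> complex) \<Rightarrow> (real \<Rightarrow> complex) \<Rightarrow> real \<Rightarrow> complex
    \<Rightarrow> (real \<Rightarrow> complex) \<Rightarrow> (real \<Rightarrow> complex) \<Rightarrow> bool" where
  "dirichlet_solution \<sigma> p L l y y1 \<longleftrightarrow> solves \<sigma> p l 0 L y y1 \<and> y 0 = 0 \<and> y1 0 = 1"

lemma dirichlet_solutionD:
  assumes "dirichlet_solution \<sigma> p L l y y1"
  shows "solves \<sigma> p l 0 L y y1" "y 0 = 0" "y1 0 = 1"
  using assms by (auto simp: dirichlet_solution_def)

section \<open>Wronskians and symmetries of the first-order system\<close>

lemma solvesD:
  assumes "solves \<sigma> p l a b y y1"
  shows "has_AC_derivative y (\<lambda>x. \<sigma> x * y x + y1 x) a b"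
    and "has_AC_derivative y1 (\<lambda>x. - \<sigma> x * y1 x - (\<sigma> x)\<^sup>2 * y x + (2 * l * p x - l\<^sup>2) * y x) a b"
  using assms by (auto simp: solves_def)

text \<open>The coefficient matrix of the system has trace zero.\<close>

lemma solves_wronskian_const:
  assumes Y: "solves \<sigma> p l a b y y1" and Z: "solves \<sigma> p l a b z z1" and "x \<in> {a..b}" "t \<in> {a..b}"
  shows "y x * z1 x - y1 x * z x = y t * z1 t - y1 t * z t"
proof (rule has_AC_derivative_zero_const)
  show "has_AC_derivative (\<lambda>x. y x * z1 x - y1 x * z x) (\<lambda>x. 0) a b"
    by (rule has_AC_derivative_cong[OF has_AC_derivative_diff[OF
          has_AC_derivative_mult[OF solvesD(1)[OF Y] solvesD(2)[OF Z]]
          has_AC_derivative_mult[OF solvesD(2)[OF Y] solvesD(1)[OF Z]]]])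
      (auto simp: algebra_simps power2_eq_square)
qed (use assms in auto)

lemma solves_combination:
  assumes Y: "solves \<sigma> p l a b y y1" and Z: "solves \<sigma> p l a b z z1"
  shows "solves \<sigma> p l a b (\<lambda>x. c * y x + d * z x) (\<lambda>x. c * y1 x + d * z1 x)"
  unfolding solves_def
  by (intro conjI has_AC_derivative_cong[OF has_AC_derivative_add[OF
          has_AC_derivative_cmult[OF solvesD(1)[OF Y], of c] has_AC_derivative_cmult[OF solvesD(1)[OF Z], of d]]]
        has_AC_derivative_cong[OF has_AC_derivative_add[OF
          has_AC_derivative_cmult[OF solvesD(2)[OF Y], of c] has_AC_derivative_cmult[OF solvesD(2)[OF Z], of d]]])
    (auto simp: algebra_simps)

lemma solves_subinterval:
  assumes "solves \<sigma> p l a b y y1" "a \<le> c" "d \<le> b"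
  shows "solves \<sigma> p l c d y y1"
  using assms unfolding solves_def by (auto intro: has_AC_derivative_subinterval)

text \<open>Reversing the direction of x changes the sign of the first derivative, hence of \<sigma>
  and of the quasi-derivative, but leaves p and the second-order part alone.\<close>

lemma solves_reflect:
  assumes "solves \<sigma> p l a b y y1"
  shows "solves (\<lambda>x. - \<sigma> (k - x)) (\<lambda>x. p (k - x)) l (k - b) (k - a) (\<lambda>x. y (k - x)) (\<lambda>x. - y1 (k - x))"
  unfolding solves_def
proof
  show "has_AC_derivative (\<lambda>x. y (k - x)) (\<lambda>x. - \<sigma> (k - x) * y (k - x) + - y1 (k - x)) (k - b) (k - a)"
    by (rule has_AC_derivative_cong[OF has_AC_derivative_reflect[OF solvesD(1)[OF assms]]]) auto
  show "has_AC_derivative (\<lambda>x. - y1 (k - x)) (\<lambda>x. - (- \<sigma> (k - x)) * - y1 (k - x) -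
      (- \<sigma> (k - x))\<^sup>2 * y (k - x) + (2 * l * p (k - x) - l\<^sup>2) * y (k - x)) (k - b) (k - a)"
    by (rule has_AC_derivative_cong[OF has_AC_derivative_minus[OF has_AC_derivative_reflect[OF solvesD(2)[OF assms]]]])
      (auto simp: algebra_simps)
qed

lemma solves_cong_AE:
  assumes "solves \<sigma> p l a b y y1"
    and "AE x in lebesgue_on {a<..<b}. \<sigma> x = \<sigma>' x" "AE x in lebesgue_on {a<..<b}. p x = p' x"
  shows "solves \<sigma>' p' l a b y y1"
  using assms unfolding solves_def
  by (auto elim!: has_AC_derivative_cong_AE eventually_elim2)

lemma solves_uminus: "solves \<sigma> p l a b y y1 \<Longrightarrow> solves \<sigma> (\<lambda>x. - p x) (- l) a b y y1"
  unfolding solves_def by simp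

lemma dirichlet_solution_uminus:
  "dirichlet_solution \<sigma> p L l y y1 \<Longrightarrow> dirichlet_solution \<sigma> (\<lambda>x. - p x) L (- l) y y1"
  unfolding dirichlet_solution_def by (simp add: solves_uminus)

text \<open>Another antiderivative of the same q leaves y unchanged and only moves the
  quasi-derivative, from y1 to y1 - k y. Where y vanishes, the Cauchy data do not change either,
  which is why the Dirichlet solution depends on q alone.\<close>

lemma solves_add_const:
  assumes "solves \<sigma> p l a b y y1"
  shows "solves (\<lambda>x. \<sigma> x + k) p l a b y (\<lambda>x. y1 x - k * y x)"
  unfolding solves_def
proof
  show "has_AC_derivative y (\<lambda>x. (\<sigma> x + k) * y x + (y1 x - k * y x)) a b"
    by (rule has_AC_derivative_cong[OF solvesD(1)[OF assms]]) (auto simp: algebra_simps)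
  show "has_AC_derivative (\<lambda>x. y1 x - k * y x) (\<lambda>x. - (\<sigma> x + k) * (y1 x - k * y x) -
      (\<sigma> x + k)\<^sup>2 * y x + (2 * l * p x - l\<^sup>2) * y x) a b"
    by (rule has_AC_derivative_cong[OF has_AC_derivative_diff[OF solvesD(2)[OF assms]
            has_AC_derivative_cmult[OF solvesD(1)[OF assms], of k]]])
      (auto simp: algebra_simps power2_eq_square)
qed

text \<open>Polynomials in the spectral parameter with continuous coefficients: closed under the
  integrations of the Picard iteration, which makes every iterate holomorphic in the parameter.\<close>

inductive lambda_poly :: "real \<Rightarrow> real \<Rightarrow> (complex \<Rightarrow> real \<Rightarrow> complex) \<Rightarrow> bool" for a b where
  monom: "continuous_on {a..b} k \<Longrightarrow> (\<And>l x. x \<in> {a..b} \<Longrightarrow> f l x = l ^ i * k x) \<Longrightarrow> lambda_poly a b f"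
| add: "lambda_poly a b f \<Longrightarrow> lambda_poly a b g \<Longrightarrow>
    (\<And>l x. x \<in> {a..b} \<Longrightarrow> h l x = f l x + g l x) \<Longrightarrow> lambda_poly a b h"

lemma lambda_poly_continuous_on: "lambda_poly a b f \<Longrightarrow> continuous_on {a..b} (f l)"
proof (induction rule: lambda_poly.induct)
  case (monom k f i)
  have "continuous_on {a..b} (\<lambda>x. l ^ i * k x)" by (intro continuous_intros monom)
  then show ?case by (rule continuous_on_eq) (simp add: monom)
next
  case (add f g h)
  have "continuous_on {a..b} (\<lambda>x. f l x + g l x)" by (intro continuous_intros add)
  then show ?case by (rule continuous_on_eq) (simp add: add.hyps)
qed

lemma lambda_poly_holomorphic:
  "lambda_poly a b f \<Longrightarrow> x \<in> {a..b} \<Longrightarrow> (\<lambda>l. f l x) holomorphic_on A"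
proof (induction rule: lambda_poly.induct)
  case (monom k f i)
  have "(\<lambda>l. l ^ i * k x) holomorphic_on A" by (intro holomorphic_intros)
  then show ?case using monom by simp
next
  case (add f g h)
  have "(\<lambda>l. f l x + g l x) holomorphic_on A" by (intro holomorphic_intros add)
  then show ?case using add.hyps add.prems by simp
qed

lemma lambda_poly_mult: "lambda_poly a b f \<Longrightarrow> lambda_poly a b (\<lambda>l x. c * l ^ j * f l x)"
proof (induction rule: lambda_poly.induct)
  case (monom k f i)
  show ?case by (rule lambda_poly.monom[of _ _ "\<lambda>x. c * k x" _ "j + i"])
      (use monom in \<open>auto intro!: continuous_intros simp: power_add\<close>)
next
  case (add f g h)
  show ?case by (rule lambda_poly.add[OF add.IH]) (simp add: add.hyps algebra_simps)
qed

lemma lambda_poly_integral: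
  assumes h: "h absolutely_integrable_on {a..b}"
  shows "lambda_poly a b f \<Longrightarrow> lambda_poly a b (\<lambda>l x. integral {a..x} (\<lambda>t. h t * f l t))"
proof (induction rule: lambda_poly.induct)
  case (monom k f i)
  show ?case
  proof (rule lambda_poly.monom[of _ _ "\<lambda>x. integral {a..x} (\<lambda>t. h t * k t)" _ i])
    show "continuous_on {a..b} (\<lambda>x. integral {a..x} (\<lambda>t. h t * k t))"
      by (intro continuous_on_indefinite_integral absolutely_integrable_mult_continuous h monom)
    fix l x assume x: "x \<in> {a..b}"
    have "integral {a..x} (\<lambda>t. h t * f l t) = integral {a..x} (\<lambda>t. l ^ i * (h t * k t))"
      by (rule integral_cong) (use monom(2) x in auto)
    then show "integral {a..x} (\<lambda>t. h t * f l t) = l ^ i * integral {a..x} (\<lambda>t. h t * k t)" by simp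
  qed
next
  case (add f g w)
  show ?case
  proof (rule lambda_poly.add[OF add.IH])
    fix l x assume x: "x \<in> {a..b}"
    have "integral {a..x} (\<lambda>t. h t * w l t) = integral {a..x} (\<lambda>t. h t * f l t + h t * g l t)"
      by (rule integral_cong) (use add.hyps x in \<open>auto simp: algebra_simps\<close>)
    also have "\<dots> = integral {a..x} (\<lambda>t. h t * f l t) + integral {a..x} (\<lambda>t. h t * g l t)"
      by (intro integral_add absolutely_integrable_subinterval(2)[OF _ x]
          absolutely_integrable_mult_continuous h lambda_poly_continuous_on[OF add.hyps(1)]
          lambda_poly_continuous_on[OF add.hyps(2)])
    finally show "integral {a..x} (\<lambda>t. h t * w l t) =
        integral {a..x} (\<lambda>t. h t * f l t) + integral {a..x} (\<lambda>t. h t * g l t)" .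
  qed
qed

section \<open>Picard iteration: existence, holomorphy and uniqueness\<close>

lemma geometric_increments_limit:
  fixes w :: "nat \<Rightarrow> complex"
  assumes "\<And>n. cmod (w (Suc n) - w n) \<le> B / 2 ^ n"
  shows "\<exists>W. \<forall>n. cmod (W - w n) \<le> 2 * B / 2 ^ n"
proof -
  define d where "d = (\<lambda>n. w (Suc n) - w n)"
  have dn: "norm (d n) \<le> B * (1/2) ^ n" for n
    using assms[of n] by (simp add: d_def power_divide)
  have geo: "summable (\<lambda>n. B * (1/2::real) ^ n)" by (intro summable_mult summable_geometric) auto
  have sd: "summable d" by (rule summable_comparison_test'[OF geo dn])
  have wn: "w n = w 0 + (\<Sum>i<n. d i)" for n by (induction n) (auto simp: d_def)
  show ?thesis
  proof (intro exI[of _ "w 0 + suminf d"] allI)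
    fix n
    have "w 0 + suminf d - w n = (\<Sum>i. d (i + n))"
      using suminf_split_initial_segment[OF sd, of n] wn[of n] by simp
    also have "norm \<dots> \<le> (\<Sum>i. B * (1/2) ^ (i + n))"
      by (rule norm_suminf_le[OF dn summable_ignore_initial_segment[OF geo]])
    also have "\<dots> = (\<Sum>i. (B * (1/2) ^ n) * (1/2) ^ i)" by (simp add: power_add mult_ac)
    also have "\<dots> = (B * (1/2) ^ n) * (\<Sum>i. (1/2) ^ i)" by (rule suminf_mult) (auto intro: summable_geometric)
    also have "\<dots> = 2 * B / 2 ^ n" by (subst suminf_geometric) (auto simp: power_divide)
    finally show "cmod (w 0 + suminf d - w n) \<le> 2 * B / 2 ^ n" .
  qed
qed

lemma geometric_increments_lim:
  fixes w :: "nat \<Rightarrow> complex"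
  assumes "\<And>n. cmod (w (Suc n) - w n) \<le> B / 2 ^ n"
  shows "cmod (lim w - w n) \<le> 2 * B / 2 ^ n"
proof -
  obtain W where W: "\<And>n. cmod (W - w n) \<le> 2 * B / 2 ^ n"
    using geometric_increments_limit[of w B, OF assms] by auto
  have "(\<lambda>n. 2 * B * (1/2) ^ n) \<longlonglongrightarrow> 2 * B * 0"
    by (intro tendsto_mult_left LIMSEQ_realpow_zero) auto
  then have z: "(\<lambda>n. 2 * B / 2 ^ n) \<longlonglongrightarrow> 0" by (simp add: power_divide)
  have "w \<longlonglongrightarrow> W"
    by (rule LIM_zero_cancel, rule Lim_null_comparison[OF always_eventually z])
      (use W in \<open>simp add: norm_minus_commute\<close>)
  then have "lim w = W" by (rule limI)
  then show ?thesis using W by simp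
qed

text \<open>One term of a Picard step in a weighted norm: the difference of w and w' is measured
  against the weight e, the coefficient h is dominated by g, and I is the integral of g e.\<close>

lemma norm_integral_diff_le:
  fixes h w w' :: "real \<Rightarrow> complex"
  assumes h: "h absolutely_integrable_on {a..b}" and x: "x \<in> {a..b}"
    and w: "continuous_on {a..b} w" "continuous_on {a..b} w'"
    and bd: "\<And>t. t \<in> {a..b} \<Longrightarrow> cmod (h t) \<le> g t" "\<And>t. t \<in> {a..b} \<Longrightarrow> cmod (w t - w' t) \<le> D * e t"
    and I: "((\<lambda>t. g t * e t) has_integral I) {a..x}"
  shows "cmod (integral {a..x} (\<lambda>t. h t * w t) - integral {a..x} (\<lambda>t. h t * w' t)) \<le> D * I"
proof -
  have i: "(\<lambda>t. h t * w t) integrable_on {a..x}" "(\<lambda>t. h t * w' t) integrable_on {a..x}"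
    by (intro absolutely_integrable_subinterval(2)[OF _ x] absolutely_integrable_mult_continuous h w)+
  have "integral {a..x} (\<lambda>t. h t * w t) - integral {a..x} (\<lambda>t. h t * w' t)
      = integral {a..x} (\<lambda>t. h t * w t - h t * w' t)"
    by (rule integral_diff[OF i, symmetric])
  also have "cmod \<dots> \<le> integral {a..x} (\<lambda>t. D * (g t * e t))"
  proof (rule integral_norm_bound_integral)
    show "(\<lambda>t. h t * w t - h t * w' t) integrable_on {a..x}" by (rule integrable_diff[OF i])
    show "(\<lambda>t. D * (g t * e t)) integrable_on {a..x}"
      using has_integral_mult_right[OF I, of D] by (auto simp: integrable_on_def)
    fix t assume "t \<in> {a..x}"
    then have t: "t \<in> {a..b}" using x by auto
    have "cmod (h t * w t - h t * w' t) = cmod (h t) * cmod (w t - w' t)"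
      by (simp add: norm_mult[symmetric] right_diff_distrib)
    also have "\<dots> \<le> g t * (D * e t)"
      using bd[OF t] by (intro mult_mono) (auto intro: order_trans[OF norm_ge_zero])
    finally show "cmod (h t * w t - h t * w' t) \<le> D * (g t * e t)" by (simp add: mult_ac)
  qed
  also have "\<dots> = D * I" using has_integral_mult_right[OF I, of D] by (rule integral_unique)
  finally show ?thesis .
qed

text \<open>Picard iteration, started at \<open>0\<close>; in the norm weighted with \<open>exp(2 \<integral>g)\<close>, where \<open>g\<close> dominates the
  coefficient matrix, every step halves the increments.\<close>

theorem solves_exists:
  assumes \<sigma>: "\<sigma> \<in> L2 a b" and p: "p \<in> L2 a b" and ab: "a \<le> b"
  obtains Y Y1 where "\<And>l. solves \<sigma> p l a b (Y l) (Y1 l)" "\<And>l. Y l a = c" "\<And>l. Y1 l a = c1"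
    "\<And>x. x \<in> {a..b} \<Longrightarrow> (\<lambda>l. Y l x) holomorphic_on UNIV"
    "\<And>x. x \<in> {a..b} \<Longrightarrow> (\<lambda>l. Y1 l x) holomorphic_on UNIV"
proof -
  have h1: "\<sigma> absolutely_integrable_on {a..b}" using \<sigma> by (simp add: L2_iff)
  have h2: "(\<lambda>t. (\<sigma> t)\<^sup>2) absolutely_integrable_on {a..b}" by (rule L2_square[OF \<sigma>])
  have h3: "p absolutely_integrable_on {a..b}" using p by (simp add: L2_iff)
  have h4: "(\<lambda>t. 1 :: complex) absolutely_integrable_on {a..b}"
    by (rule absolutely_integrable_continuous_real) simp
  \<comment> \<open>The integral form of the system. Each coefficient stands under an integral of
    its own, and powers of l stay outside, so that \<open>lambda_poly\<close> is preserved term by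
    term.\<close>
  define T where "T = (\<lambda>(u :: complex \<Rightarrow> real \<Rightarrow> complex, v :: complex \<Rightarrow> real \<Rightarrow> complex).
    (\<lambda>l x. c + integral {a..x} (\<lambda>t. \<sigma> t * u l t) + integral {a..x} (\<lambda>t. 1 * v l t),
     \<lambda>l x. c1 - integral {a..x} (\<lambda>t. \<sigma> t * v l t) - integral {a..x} (\<lambda>t. (\<sigma> t)\<^sup>2 * u l t)
       + 2 * l * integral {a..x} (\<lambda>t. p t * u l t) - l\<^sup>2 * integral {a..x} (\<lambda>t. 1 * u l t)))"
  define u where "u = (\<lambda>n. fst ((T ^^ n) (\<lambda>l x. 0, \<lambda>l x. 0)))"
  define v where "v = (\<lambda>n. snd ((T ^^ n) (\<lambda>l x. 0, \<lambda>l x. 0)))"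
  have u0: "u 0 = (\<lambda>l x. 0)" and v0: "v 0 = (\<lambda>l x. 0)" by (auto simp: u_def v_def)
  have uS: "u (Suc n) = (\<lambda>l x. c + integral {a..x} (\<lambda>t. \<sigma> t * u n l t) + integral {a..x} (\<lambda>t. 1 * v n l t))"
    and vS: "v (Suc n) = (\<lambda>l x. c1 - integral {a..x} (\<lambda>t. \<sigma> t * v n l t) - integral {a..x} (\<lambda>t. (\<sigma> t)\<^sup>2 * u n l t)
       + 2 * l * integral {a..x} (\<lambda>t. p t * u n l t) - l\<^sup>2 * integral {a..x} (\<lambda>t. 1 * u n l t))" for n
    by (simp_all add: u_def v_def T_def split_def)
  have const: "lambda_poly a b (\<lambda>l x. k)" for k
    by (rule lambda_poly.monom[of _ _ "\<lambda>x. k" _ 0]) auto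
  have lp: "lambda_poly a b (u n) \<and> lambda_poly a b (v n)" for n
  proof (induction n)
    case 0
    then show ?case by (simp add: u0 v0 const)
  next
    case (Suc n)
    then have un: "lambda_poly a b (u n)" and vn: "lambda_poly a b (v n)" by auto
    have scale: "lambda_poly a b (\<lambda>l x. k * l ^ j * integral {a..x} (\<lambda>t. h t * f l t))"
      if "h absolutely_integrable_on {a..b}" "lambda_poly a b f" for h f j k
      by (intro lambda_poly_mult lambda_poly_integral that)
    have "lambda_poly a b (u (Suc n))"
      unfolding uS
      by (rule lambda_poly.add[OF lambda_poly.add[OF const[of c] scale[OF h1 un, of 1 0] refl]
            scale[OF h4 vn, of 1 0]]) simp
    moreover have "lambda_poly a b (v (Suc n))"
      unfolding vS
      by (rule lambda_poly.add[OF lambda_poly.add[OF lambda_poly.add[OF lambda_poly.add[OF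
              const[of c1] scale[OF h1 vn, of "-1" 0] refl] scale[OF h2 un, of "-1" 0] refl]
              scale[OF h3 un, of 2 1] refl] scale[OF h4 un, of "-1" 2]]) simp
    ultimately show ?case ..
  qed
  have cu: "continuous_on {a..b} (u n l)" and cv: "continuous_on {a..b} (v n l)" for n l
    using lp by (auto intro: lambda_poly_continuous_on)
  have hu: "(\<lambda>l. u n l x) holomorphic_on A" and hv: "(\<lambda>l. v n l x) holomorphic_on A"
    if "x \<in> {a..b}" for n x A
    using lambda_poly_holomorphic[of a b "u n" x A] lambda_poly_holomorphic[of a b "v n" x A] lp[of n] that
    by blast+
  \<comment> \<open>A single integrable function that dominates the coefficients 1, \<sigma>,
    \<sigma>^2 and p.\<close>
  define \<gamma> where "\<gamma> = (\<lambda>t. 1 + cmod (\<sigma> t) + (cmod (\<sigma> t))\<^sup>2 + cmod (p t))"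
  have \<gamma>: "\<gamma> absolutely_integrable_on {a..b}"
  proof -
    have "(\<lambda>t. 1 :: real) absolutely_integrable_on {a..b}"
      by (rule absolutely_integrable_continuous_real) simp
    then show ?thesis
      unfolding \<gamma>_def using \<sigma> p by (intro set_integral_add set_integrable_norm) (auto simp: L2_iff)
  qed
  have \<gamma>0: "\<gamma> t \<ge> 0" for t by (simp add: \<gamma>_def add_nonneg_nonneg)
  have \<gamma>le: "cmod (\<sigma> t) \<le> \<gamma> t" "cmod ((\<sigma> t)\<^sup>2) \<le> \<gamma> t" "cmod (p t) \<le> \<gamma> t" "cmod 1 \<le> \<gamma> t" for t
    by (auto simp: \<gamma>_def norm_power add_nonneg_nonneg)
  define C where "C = cmod c + cmod c1"
  \<comment> \<open>Uniformity for |l| \<le> R is what later gives locally uniform convergence in l,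
    and with it holomorphy.\<close>
  have "\<exists>B\<ge>0. \<forall>l x n. cmod l \<le> R \<longrightarrow> x \<in> {a..b} \<longrightarrow>
      cmod (u (Suc n) l x - u n l x) \<le> B / 2 ^ n \<and> cmod (v (Suc n) l x - v n l x) \<le> B / 2 ^ n" for R
  proof (cases "R \<ge> 0")
    case R: True
    \<comment> \<open>The number of integrals in one step, each bounded by J: two in the first
      component, and 1 + 1 + 2R + R^2 in the second.\<close>
    define k where "k = 4 + 2 * R + R\<^sup>2"
    have k: "k > 0" using R by (simp add: k_def add_pos_nonneg)
    define g where "g = (\<lambda>t. k * \<gamma> t)"
    have g: "g absolutely_integrable_on {a..b}" unfolding g_def using \<gamma> by (rule set_integrable_mult_right)
    define G where "G = (\<lambda>x. integral {a..x} g)"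
    have gi: "g integrable_on {a..x}" if "x \<in> {a..b}" for x
      by (rule absolutely_integrable_subinterval(2)[OF g that])
    have g0: "g t \<ge> 0" for t using k \<gamma>0 by (simp add: g_def)
    have G0: "G x \<ge> 0" if "x \<in> {a..b}" for x
      unfolding G_def by (rule integral_nonneg[OF gi[OF that] g0])
    have Gb: "G x \<le> G b" if "x \<in> {a..b}" for x
      unfolding G_def by (rule integral_subset_le) (use that gi g0 ab in auto)
    \<comment> \<open>The 1/2 is the gain of one step; the division by k offsets the number of
      terms.\<close>
    have I: "((\<lambda>t. \<gamma> t * exp (2 * G t)) has_integral (exp (2 * G x) - 1) / 2 / k) {a..x}" if "x \<in> {a..b}" for x
      using has_integral_divide[OF exp_weight_has_integral[OF g that], of k] k by (simp add: g_def G_def)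
    have main: "cmod (u (Suc n) l x - u n l x) + cmod (v (Suc n) l x - v n l x) \<le> C / 2 ^ n * exp (2 * G x)"
      if l: "cmod l \<le> R" and x: "x \<in> {a..b}" for l x n
      using x
    proof (induction n arbitrary: x)
      case 0
      have "C * 1 \<le> C * exp (2 * G x)" using G0[OF 0] by (intro mult_left_mono) (auto simp: C_def)
      then show ?case by (simp add: uS vS u0 v0 C_def)
    next
      case (Suc n)
      note x = Suc.prems
      define J where "J = C / 2 ^ n * ((exp (2 * G x) - 1) / 2 / k)"
      have bu: "cmod (u (Suc n) l t - u n l t) \<le> C / 2 ^ n * exp (2 * G t)"
        and bv: "cmod (v (Suc n) l t - v n l t) \<le> C / 2 ^ n * exp (2 * G t)" if "t \<in> {a..b}" for t
        using Suc.IH[OF that] norm_ge_zero[of "u (Suc n) l t - u n l t"]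
          norm_ge_zero[of "v (Suc n) l t - v n l t"] by linarith+
      have U: "cmod (integral {a..x} (\<lambda>t. h t * u (Suc n) l t) - integral {a..x} (\<lambda>t. h t * u n l t)) \<le> J"
        if "h absolutely_integrable_on {a..b}" "\<And>t. cmod (h t) \<le> \<gamma> t" for h
        unfolding J_def
        by (rule norm_integral_diff_le[OF that(1) x cu cu _ _ I[OF x]]) (use that(2) bu in auto)
      have V: "cmod (integral {a..x} (\<lambda>t. h t * v (Suc n) l t) - integral {a..x} (\<lambda>t. h t * v n l t)) \<le> J"
        if "h absolutely_integrable_on {a..b}" "\<And>t. cmod (h t) \<le> \<gamma> t" for h
        unfolding J_def
        by (rule norm_integral_diff_le[OF that(1) x cv cv _ _ I[OF x]]) (use that(2) bv in auto)
      have J0: "J \<ge> 0" using U[OF h1 \<gamma>le(1)] norm_ge_zero order_trans by blast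
      have "u (Suc (Suc n)) l x - u (Suc n) l x =
          (integral {a..x} (\<lambda>t. \<sigma> t * u (Suc n) l t) - integral {a..x} (\<lambda>t. \<sigma> t * u n l t)) +
          (integral {a..x} (\<lambda>t. 1 * v (Suc n) l t) - integral {a..x} (\<lambda>t. 1 * v n l t))"
        unfolding uS[of "Suc n"] uS[of n] by (simp add: algebra_simps)
      also have "cmod \<dots> \<le> J + J"
        by (intro norm_triangle_mono U V h1 h4 \<gamma>le)
      finally have du: "cmod (u (Suc (Suc n)) l x - u (Suc n) l x) \<le> J + J" .
      have "v (Suc (Suc n)) l x - v (Suc n) l x =
          - (integral {a..x} (\<lambda>t. \<sigma> t * v (Suc n) l t) - integral {a..x} (\<lambda>t. \<sigma> t * v n l t))
          + - (integral {a..x} (\<lambda>t. (\<sigma> t)\<^sup>2 * u (Suc n) l t) - integral {a..x} (\<lambda>t. (\<sigma> t)\<^sup>2 * u n l t))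
          + 2 * l * (integral {a..x} (\<lambda>t. p t * u (Suc n) l t) - integral {a..x} (\<lambda>t. p t * u n l t))
          + - (l\<^sup>2 * (integral {a..x} (\<lambda>t. 1 * u (Suc n) l t) - integral {a..x} (\<lambda>t. 1 * u n l t)))"
        unfolding vS[of "Suc n"] vS[of n] by (simp add: algebra_simps)
      also have "cmod \<dots> \<le> J + J + 2 * R * J + R\<^sup>2 * J"
      proof (intro norm_triangle_mono)
        show "cmod (- (integral {a..x} (\<lambda>t. \<sigma> t * v (Suc n) l t) - integral {a..x} (\<lambda>t. \<sigma> t * v n l t))) \<le> J"
          unfolding norm_minus_cancel by (intro V h1 \<gamma>le)
        show "cmod (- (integral {a..x} (\<lambda>t. (\<sigma> t)\<^sup>2 * u (Suc n) l t) - integral {a..x} (\<lambda>t. (\<sigma> t)\<^sup>2 * u n l t))) \<le> J"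
          unfolding norm_minus_cancel by (intro U h2 \<gamma>le)
        show "cmod (2 * l * (integral {a..x} (\<lambda>t. p t * u (Suc n) l t) - integral {a..x} (\<lambda>t. p t * u n l t))) \<le> 2 * R * J"
          unfolding norm_mult using R l J0 by (intro mult_mono U h3 \<gamma>le) auto
        show "cmod (- (l\<^sup>2 * (integral {a..x} (\<lambda>t. 1 * u (Suc n) l t) - integral {a..x} (\<lambda>t. 1 * u n l t)))) \<le> R\<^sup>2 * J"
          unfolding norm_minus_cancel norm_mult norm_power
          using R l J0 by (intro mult_mono power_mono U h4 \<gamma>le) auto
      qed
      finally have dv: "cmod (v (Suc (Suc n)) l x - v (Suc n) l x) \<le> J + J + 2 * R * J + R\<^sup>2 * J" .
      have "cmod (u (Suc (Suc n)) l x - u (Suc n) l x) + cmod (v (Suc (Suc n)) l x - v (Suc n) l x) \<le> k * J"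
        using du dv by (simp add: k_def algebra_simps)
      also have "\<dots> = C / 2 ^ n * ((exp (2 * G x) - 1) / 2)"
        using k by (simp add: J_def)
      also have "\<dots> \<le> C / 2 ^ n * (exp (2 * G x) / 2)"
        by (intro mult_left_mono) (auto simp: C_def)
      also have "\<dots> = C / 2 ^ Suc n * exp (2 * G x)" by simp
      finally show ?case .
    qed
    show ?thesis
    proof (intro exI[of _ "C * exp (2 * G b)"] conjI allI impI)
      show "0 \<le> C * exp (2 * G b)" by (simp add: C_def)
      fix l x n assume lx: "cmod l \<le> R" "x \<in> {a..b}"
      have "C / 2 ^ n * exp (2 * G x) \<le> C / 2 ^ n * exp (2 * G b)"
        using Gb[OF lx(2)] by (intro mult_left_mono) (auto simp: C_def)
      also have "\<dots> = C * exp (2 * G b) / 2 ^ n" by simp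
      finally have "cmod (u (Suc n) l x - u n l x) + cmod (v (Suc n) l x - v n l x) \<le> C * exp (2 * G b) / 2 ^ n"
        using main[OF lx, of n] by linarith
      then show "cmod (u (Suc n) l x - u n l x) \<le> C * exp (2 * G b) / 2 ^ n"
        "cmod (v (Suc n) l x - v n l x) \<le> C * exp (2 * G b) / 2 ^ n"
        using norm_ge_zero[of "u (Suc n) l x - u n l x"] norm_ge_zero[of "v (Suc n) l x - v n l x"] by linarith+
    qed
  next
    case False
    have "\<not> cmod l \<le> R" for l using False norm_ge_zero[of l] by linarith
    then show ?thesis by (intro exI[of _ 0]) auto
  qed
  then obtain B where B: "\<And>R. B R \<ge> 0"
    "\<And>R l x n. cmod l \<le> R \<Longrightarrow> x \<in> {a..b} \<Longrightarrow> cmod (u (Suc n) l x - u n l x) \<le> B R / 2 ^ n"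
    "\<And>R l x n. cmod l \<le> R \<Longrightarrow> x \<in> {a..b} \<Longrightarrow> cmod (v (Suc n) l x - v n l x) \<le> B R / 2 ^ n"
    by metis
  \<comment> \<open>Limits taken pointwise, so that the bounds for different R all concern the same
    functions.\<close>
  define U where "U = (\<lambda>l x. lim (\<lambda>n. u n l x))"
  define V where "V = (\<lambda>l x. lim (\<lambda>n. v n l x))"
  have UB: "cmod (U l x - u n l x) \<le> 2 * B R / 2 ^ n" and VB: "cmod (V l x - v n l x) \<le> 2 * B R / 2 ^ n"
    if "cmod l \<le> R" "x \<in> {a..b}" for R l x n
    unfolding U_def V_def using that by (auto intro!: geometric_increments_lim B)
  have z: "(\<lambda>n. k / 2 ^ n) \<longlonglongrightarrow> 0" for k :: real
  proof -
    have "(\<lambda>n. k * (1/2) ^ n) \<longlonglongrightarrow> k * 0"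
      by (intro tendsto_mult_left LIMSEQ_realpow_zero) auto
    then show ?thesis by (simp add: power_divide)
  qed
  have unif: "uniform_limit X f F sequentially"
    if "\<And>n y. y \<in> X \<Longrightarrow> cmod (F y - f n y) \<le> k / 2 ^ n" for X and f :: "nat \<Rightarrow> 'x \<Rightarrow> complex" and F k
    unfolding uniform_limit_iff
  proof (intro allI impI)
    fix e :: real assume "e > 0"
    then have "eventually (\<lambda>n. k / 2 ^ n < e) sequentially" by (rule order_tendstoD(2)[OF z])
    then show "\<forall>\<^sub>F n in sequentially. \<forall>x\<in>X. dist (f n x) (F x) < e"
      by eventually_elim (use that in \<open>auto simp: dist_norm norm_minus_commute intro: le_less_trans\<close>)
  qed
  have uu: "uniform_limit {a..b} (\<lambda>n. u n l) (U l) sequentially"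
    and uv: "uniform_limit {a..b} (\<lambda>n. v n l) (V l) sequentially" for l
    by (rule unif[OF UB[of l "cmod l"]] unif[OF VB[of l "cmod l"]]; simp)+
  have cU: "continuous_on {a..b} (U l)" for l
    by (rule uniform_limit_theorem[OF _ uu]) (auto simp: cu)
  have cV: "continuous_on {a..b} (V l)" for l
    by (rule uniform_limit_theorem[OF _ uv]) (auto simp: cv)
  have hol: "(\<lambda>l. U l x) holomorphic_on UNIV" "(\<lambda>l. V l x) holomorphic_on UNIV" if x: "x \<in> {a..b}" for x
  proof -
    show "(\<lambda>l. U l x) holomorphic_on UNIV"
    proof (rule holomorphic_uniform_sequence[OF open_UNIV hu[OF x]])
      fix l0 :: complex
      have "cmod l \<le> cmod l0 + 1" if "l \<in> cball l0 1" for l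
        using that norm_triangle_ineq2[of l l0] by (simp add: dist_norm norm_minus_commute)
      then show "\<exists>d>0. cball l0 d \<subseteq> UNIV \<and> uniform_limit (cball l0 d) (\<lambda>n l. u n l x) (\<lambda>l. U l x) sequentially"
        by (intro exI[of _ 1] conjI unif[OF UB[OF _ x, of _ "cmod l0 + 1"]]) auto
    qed
    show "(\<lambda>l. V l x) holomorphic_on UNIV"
    proof (rule holomorphic_uniform_sequence[OF open_UNIV hv[OF x]])
      fix l0 :: complex
      have "cmod l \<le> cmod l0 + 1" if "l \<in> cball l0 1" for l
        using that norm_triangle_ineq2[of l l0] by (simp add: dist_norm norm_minus_commute)
      then show "\<exists>d>0. cball l0 d \<subseteq> UNIV \<and> uniform_limit (cball l0 d) (\<lambda>n l. v n l x) (\<lambda>l. V l x) sequentially"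
        by (intro exI[of _ 1] conjI unif[OF VB[OF _ x, of _ "cmod l0 + 1"]]) auto
    qed
  qed
  have lim: "(\<lambda>n. integral {a..x} (\<lambda>t. h t * w n t)) \<longlonglongrightarrow> integral {a..x} (\<lambda>t. h t * W t)"
    if h: "h absolutely_integrable_on {a..b}" "\<And>t. cmod (h t) \<le> \<gamma> t"
      and W: "\<And>n. continuous_on {a..b} (w n)" "continuous_on {a..b} W" "\<And>n t. t \<in> {a..b} \<Longrightarrow> cmod (W t - w n t) \<le> k / 2 ^ n"
      and x: "x \<in> {a..b}" for h w W k x
  proof (rule LIM_zero_cancel, rule Lim_null_comparison[OF always_eventually z], rule allI)
    fix n
    have "\<gamma> integrable_on {a..x}" by (rule absolutely_integrable_subinterval(2)[OF \<gamma> x])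
    then have I: "((\<lambda>t. \<gamma> t * 1) has_integral integral {a..x} \<gamma>) {a..x}"
      by (simp add: integrable_integral)
    have "cmod (integral {a..x} (\<lambda>t. h t * W t) - integral {a..x} (\<lambda>t. h t * w n t)) \<le> k / 2 ^ n * integral {a..x} \<gamma>"
      by (rule norm_integral_diff_le[OF h(1) x W(2,1) h(2) _ I]) (use W in auto)
    then show "cmod (integral {a..x} (\<lambda>t. h t * w n t) - integral {a..x} (\<lambda>t. h t * W t)) \<le> (k * integral {a..x} \<gamma>) / 2 ^ n"
      by (simp add: norm_minus_commute)
  qed
  have limU: "(\<lambda>n. integral {a..x} (\<lambda>t. h t * u n l t)) \<longlonglongrightarrow> integral {a..x} (\<lambda>t. h t * U l t)"
    and limV: "(\<lambda>n. integral {a..x} (\<lambda>t. h t * v n l t)) \<longlonglongrightarrow> integral {a..x} (\<lambda>t. h t * V l t)"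
    if h: "h absolutely_integrable_on {a..b}" "\<And>t. cmod (h t) \<le> \<gamma> t" and x: "x \<in> {a..b}" for h x l
    by (rule lim[OF h cu cU UB[of l "cmod l"] x] lim[OF h cv cV VB[of l "cmod l"] x]; simp)+
  have pU: "(\<lambda>n. u n l x) \<longlonglongrightarrow> U l x" and pV: "(\<lambda>n. v n l x) \<longlonglongrightarrow> V l x" if "x \<in> {a..b}" for l x
    using tendsto_uniform_limitI[OF uu that] tendsto_uniform_limitI[OF uv that] by auto
  have eqU: "U l x = c + integral {a..x} (\<lambda>t. \<sigma> t * U l t) + integral {a..x} (\<lambda>t. 1 * V l t)"
    if x: "x \<in> {a..b}" for l x
  proof (rule LIMSEQ_unique)
    show "(\<lambda>n. u (Suc n) l x) \<longlonglongrightarrow> U l x" using pU[OF x] by (rule LIMSEQ_Suc)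
    show "(\<lambda>n. u (Suc n) l x) \<longlonglongrightarrow> c + integral {a..x} (\<lambda>t. \<sigma> t * U l t) + integral {a..x} (\<lambda>t. 1 * V l t)"
      unfolding uS by (intro tendsto_intros limU limV h1 h4 \<gamma>le x)
  qed
  have eqV: "V l x = c1 - integral {a..x} (\<lambda>t. \<sigma> t * V l t) - integral {a..x} (\<lambda>t. (\<sigma> t)\<^sup>2 * U l t)
       + 2 * l * integral {a..x} (\<lambda>t. p t * U l t) - l\<^sup>2 * integral {a..x} (\<lambda>t. 1 * U l t)"
    if x: "x \<in> {a..b}" for l x
  proof (rule LIMSEQ_unique)
    show "(\<lambda>n. v (Suc n) l x) \<longlonglongrightarrow> V l x" using pV[OF x] by (rule LIMSEQ_Suc)
    show "(\<lambda>n. v (Suc n) l x) \<longlonglongrightarrow> c1 - integral {a..x} (\<lambda>t. \<sigma> t * V l t) - integral {a..x} (\<lambda>t. (\<sigma> t)\<^sup>2 * U l t)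
       + 2 * l * integral {a..x} (\<lambda>t. p t * U l t) - l\<^sup>2 * integral {a..x} (\<lambda>t. 1 * U l t)"
      unfolding vS by (intro tendsto_intros limU limV h1 h2 h3 h4 \<gamma>le x)
  qed
  have dU: "has_AC_derivative (\<lambda>x. integral {a..x} (\<lambda>t. h t * U l t)) (\<lambda>t. h t * U l t) a b"
    and dV: "has_AC_derivative (\<lambda>x. integral {a..x} (\<lambda>t. h t * V l t)) (\<lambda>t. h t * V l t) a b"
    if "h absolutely_integrable_on {a..b}" for h l
    by (intro indefinite_integral_has_AC_derivative absolutely_integrable_mult_continuous that cU cV)+
  show thesis
  proof (rule that[of U V])
    fix l
    show "solves \<sigma> p l a b (U l) (V l)"
      unfolding solves_def
    proof
      show "has_AC_derivative (U l) (\<lambda>x. \<sigma> x * U l x + V l x) a b"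
        by (rule has_AC_derivative_cong[OF has_AC_derivative_add[OF has_AC_derivative_add[OF
                has_AC_derivative_const[of c] dU[OF h1, of l]] dV[OF h4, of l]]])
          (auto simp: eqU)
      show "has_AC_derivative (V l) (\<lambda>x. - \<sigma> x * V l x - (\<sigma> x)\<^sup>2 * U l x + (2 * l * p x - l\<^sup>2) * U l x) a b"
        by (rule has_AC_derivative_cong[OF has_AC_derivative_diff[OF has_AC_derivative_add[OF
                has_AC_derivative_diff[OF has_AC_derivative_diff[OF has_AC_derivative_const[of c1]
                  dV[OF h1, of l]] dU[OF h2, of l]] has_AC_derivative_cmult[OF dU[OF h3, of l], of "2 * l"]]
                has_AC_derivative_cmult[OF dU[OF h4, of l], of "l\<^sup>2"]]])
          (auto simp: eqV algebra_simps)
    qed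
    show "U l a = c" "V l a = c1" using eqU[of a l] eqV[of a l] ab by simp_all
  qed (use hol in auto)
qed

corollary dirichlet_solution_exists:
  assumes "\<sigma> \<in> L2 0 L" "p \<in> L2 0 L" "0 \<le> L"
  obtains Y Y1 where "\<And>l. dirichlet_solution \<sigma> p L l (Y l) (Y1 l)"
    "\<And>x. x \<in> {0..L} \<Longrightarrow> (\<lambda>l. Y l x) holomorphic_on UNIV"
    "\<And>x. x \<in> {0..L} \<Longrightarrow> (\<lambda>l. Y1 l x) holomorphic_on UNIV"
proof -
  obtain Y Y1 where "\<And>l. solves \<sigma> p l 0 L (Y l) (Y1 l)" "\<And>l. Y l 0 = 0" "\<And>l. Y1 l 0 = 1"
    and hol: "\<And>x. x \<in> {0..L} \<Longrightarrow> (\<lambda>l. Y l x) holomorphic_on UNIV"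
      "\<And>x. x \<in> {0..L} \<Longrightarrow> (\<lambda>l. Y1 l x) holomorphic_on UNIV"
    by (rule solves_exists[OF assms, of 0 1]) (rule that)
  then show thesis by (intro that[of Y Y1] hol) (simp_all add: dirichlet_solution_def)
qed

text \<open>The difference of the solutions has zero data at a, so at x its Wronskian with both
  members of a fundamental system is zero. These members have Wronskian 1, hence the difference and
  its quasi-derivative vanish.\<close>

lemma solves_unique:
  assumes \<sigma>: "\<sigma> \<in> L2 a b" and p: "p \<in> L2 a b" and Y: "solves \<sigma> p l a b y y1" and Z: "solves \<sigma> p l a b z z1"
    and "y a = z a" "y1 a = z1 a" and x: "x \<in> {a..b}"
  shows "y x = z x" "y1 x = z1 x"
proof -
  have ab: "a \<le> b" and a: "a \<in> {a..b}" using x by auto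
  obtain C C1 where C: "\<And>l. solves \<sigma> p l a b (C l) (C1 l)" "\<And>l. C l a = 1" "\<And>l. C1 l a = 0"
    using solves_exists[OF \<sigma> p ab, of 1 0] by metis
  obtain S S1 where S: "\<And>l. solves \<sigma> p l a b (S l) (S1 l)" "\<And>l. S l a = 0" "\<And>l. S1 l a = 1"
    using solves_exists[OF \<sigma> p ab, of 0 1] by metis
  define d where "d = y x - z x"
  define d1 where "d1 = y1 x - z1 x"
  have W: "solves \<sigma> p l a b (\<lambda>x. 1 * y x + (-1) * z x) (\<lambda>x. 1 * y1 x + (-1) * z1 x)"
    by (rule solves_combination[OF Y Z])
  have 1: "d * C1 l x = d1 * C l x" "d * S1 l x = d1 * S l x"
    using solves_wronskian_const[OF W C(1)[of l] x a] solves_wronskian_const[OF W S(1)[of l] x a] assms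
    by (auto simp: d_def d1_def)
  have 2: "C l x * S1 l x - C1 l x * S l x = 1"
    using solves_wronskian_const[OF C(1)[of l] S(1)[of l] x a] C S by simp
  have "d * (C l x * S1 l x - C1 l x * S l x) = C l x * (d * S1 l x) - (d * C1 l x) * S l x"
    by (simp add: algebra_simps)
  also have "\<dots> = 0" using 1 by simp
  finally have "d = 0" using 2 by simp
  have "d1 * (C l x * S1 l x - C1 l x * S l x) = (d1 * C l x) * S1 l x - C1 l x * (d1 * S l x)"
    by (simp add: algebra_simps)
  also have "\<dots> = 0" unfolding 1[symmetric] by simp
  finally have "d1 = 0" using 2 by simp
  show "y x = z x" "y1 x = z1 x" using \<open>d = 0\<close> \<open>d1 = 0\<close> by (auto simp: d_def d1_def)
qed

section \<open>Agreement of the first-order system with the regularized equation\<close>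

lemma L2_mult_continuous:
  assumes "f \<in> L2 a b" "continuous_on {a..b} g" shows "(\<lambda>x. f x * g x) \<in> L2 a b"
proof -
  have "(\<lambda>x. (cmod (f x))\<^sup>2 * (cmod (g x))\<^sup>2) absolutely_integrable_on {a..b}"
    using assms by (intro absolutely_integrable_mult_continuous continuous_intros) (auto simp: L2_iff)
  then show ?thesis
    using assms absolutely_integrable_mult_continuous[where f=f and g=g and a=a and b=b]
    by (simp add: L2_iff norm_mult power_mult_distrib)
qed

lemma L2_cong_AE:
  assumes f: "f \<in> L2 a b" and fg: "AE x in lebesgue_on {a<..<b}. f x = g x"
  shows "g \<in> L2 a b"
proof -
  define N where "N = {x\<in>{a<..<b}. \<not> f x = g x} \<union> {a, b}"
  have N: "negligible N" using fg unfolding N_def AE_lebesgue_on_negligible by auto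
  have eq: "g x = f x" if "x \<in> {a..b} - N" for x using that by (auto simp: N_def)
  show ?thesis
    using f unfolding L2_iff
    using absolutely_integrable_spike[OF _ N, where f=f and T="{a..b}" and g=g]
      absolutely_integrable_spike[OF _ N, where f="\<lambda>x. (cmod (f x))\<^sup>2" and T="{a..b}" and g="\<lambda>x. (cmod (g x))\<^sup>2"] eq
    by simp
qed

text \<open>In passing from the system to \<open>is_solution\<close>, the point to derive is square
  integrability: by the equation the function in question equals (2 l p - l^2) y, with p in
  \<open>L2\<close> and y continuous.\<close>

lemma is_solution_iff_solves:
  assumes p: "p \<in> L2 0 (2 * pi)"
  shows "is_solution \<sigma> p l y y1 \<longleftrightarrow> solves \<sigma> p l 0 (2 * pi) y y1"
proof
  assume *: "is_solution \<sigma> p l y y1"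
  then have "y \<in> AC 0 (2 * pi)" "y1 \<in> AC 0 (2 * pi)"
    and 1: "AE x in lebesgue_on {0<..<2 * pi}.
        y differentiable (at x) \<and> y1 x = vector_derivative y (at x) - \<sigma> x * y x"
    and 2: "AE x in lebesgue_on {0<..<2 * pi}. y1 differentiable (at x) \<and>
        - vector_derivative y1 (at x) - \<sigma> x * y1 x - (\<sigma> x)\<^sup>2 * y x + 2 * l * p x * y x = l\<^sup>2 * y x"
    by (simp_all add: is_solution_def)
  moreover have "AE x in lebesgue_on {0<..<2 * pi}. (y has_vector_derivative \<sigma> x * y x + y1 x) (at x)"
    using 1
  proof eventually_elim
    case (elim x)
    then have "vector_derivative y (at x) = \<sigma> x * y x + y1 x" by simp
    then show ?case using elim vector_derivative_works by metis
  qed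
  moreover have "AE x in lebesgue_on {0<..<2 * pi}.
      (y1 has_vector_derivative - \<sigma> x * y1 x - (\<sigma> x)\<^sup>2 * y x + (2 * l * p x - l\<^sup>2) * y x) (at x)"
    using 2
  proof eventually_elim
    case (elim x)
    have "vector_derivative y1 (at x) = vector_derivative y1 (at x) +
        (- vector_derivative y1 (at x) - \<sigma> x * y1 x - (\<sigma> x)\<^sup>2 * y x + 2 * l * p x * y x - l\<^sup>2 * y x)"
      using elim by simp
    also have "\<dots> = - \<sigma> x * y1 x - (\<sigma> x)\<^sup>2 * y x + (2 * l * p x - l\<^sup>2) * y x"
      by (simp add: algebra_simps)
    finally have "vector_derivative y1 (at x) = - \<sigma> x * y1 x - (\<sigma> x)\<^sup>2 * y x + (2 * l * p x - l\<^sup>2) * y x" .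
    then show ?case using elim vector_derivative_works by metis
  qed
  ultimately show "solves \<sigma> p l 0 (2 * pi) y y1"
    unfolding solves_def has_AC_derivative_def by blast
next
  assume *: "solves \<sigma> p l 0 (2 * pi) y y1"
  note d = solvesD[OF *, unfolded has_AC_derivative_def]
  have 1: "AE x in lebesgue_on {0<..<2 * pi}.
        y differentiable (at x) \<and> y1 x = vector_derivative y (at x) - \<sigma> x * y x"
    using d(1)[THEN conjunct2]
    by eventually_elim (auto simp: vector_derivative_at intro: differentiableI_vector)
  have 2: "AE x in lebesgue_on {0<..<2 * pi}. y1 differentiable (at x) \<and> vector_derivative y1 (at x) =
        - \<sigma> x * y1 x - (\<sigma> x)\<^sup>2 * y x + (2 * l * p x - l\<^sup>2) * y x"
    using d(2)[THEN conjunct2]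
    by eventually_elim (auto simp: vector_derivative_at intro: differentiableI_vector)
  have 3: "AE x in lebesgue_on {0<..<2 * pi}. y1 differentiable (at x) \<and>
        - vector_derivative y1 (at x) - \<sigma> x * y1 x - (\<sigma> x)\<^sup>2 * y x + 2 * l * p x * y x = l\<^sup>2 * y x"
    using 2 by eventually_elim (auto simp: algebra_simps)
  have "(\<lambda>x. (p x * (2 * l) + - l\<^sup>2) * y x) \<in> L2 0 (2 * pi)"
    by (intro L2_mult_continuous L2_add_const p has_AC_derivative_continuous_on[OF solvesD(1)[OF *]]) auto
  moreover have "AE x in lebesgue_on {0<..<2 * pi}. (p x * (2 * l) + - l\<^sup>2) * y x
      = vector_derivative y1 (at x) + \<sigma> x * y1 x + (\<sigma> x)\<^sup>2 * y x"
    using 2 by eventually_elim (auto simp: algebra_simps)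
  ultimately have "(\<lambda>x. vector_derivative y1 (at x) + \<sigma> x * y1 x + (\<sigma> x)\<^sup>2 * y x) \<in> L2 0 (2 * pi)"
    by (rule L2_cong_AE)
  then show "is_solution \<sigma> p l y y1"
    unfolding is_solution_def using d 1 3 by blast
qed

lemma S_sol_eq:
  assumes "\<sigma> \<in> L2 0 (2 * pi)" "p \<in> L2 0 (2 * pi)" "solves \<sigma> p l 0 (2 * pi) y y1" "y 0 = 0" "y1 0 = 1"
    and "x \<in> {0..2 * pi}"
  shows "S_sol \<sigma> p x l = y x"
  unfolding S_sol_def is_solution_iff_solves[OF assms(2)]
proof (rule the_equality)
  show "\<exists>z z1. solves \<sigma> p l 0 (2 * pi) z z1 \<and> z 0 = 0 \<and> z1 0 = 1 \<and> y x = z x"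
    using assms by blast
  fix v assume "\<exists>z z1. solves \<sigma> p l 0 (2 * pi) z z1 \<and> z 0 = 0 \<and> z1 0 = 1 \<and> v = z x"
  then obtain z z1 where "solves \<sigma> p l 0 (2 * pi) z z1" "z 0 = 0" "z1 0 = 1" "v = z x" by blast
  then show "v = y x" using solves_unique(1)[OF assms(1,2) _ assms(3)] assms by metis
qed

lemma norm_integral_mult_le:
  fixes h w :: "real \<Rightarrow> complex"
  assumes h: "h absolutely_integrable_on {a..b}" and x: "x \<in> {a..b}" and w: "continuous_on {a..b} w"
    and k: "k integrable_on {a..x}" "\<And>t. t \<in> {a..x} \<Longrightarrow> cmod (h t) * cmod (w t) \<le> k t"
  shows "cmod (integral {a..x} (\<lambda>t. h t * w t)) \<le> integral {a..x} k"
proof (rule integral_norm_bound_integral)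
  show "(\<lambda>t. h t * w t) integrable_on {a..x}"
    by (intro absolutely_integrable_subinterval(2)[OF _ x] absolutely_integrable_mult_continuous h w)
qed (use k in \<open>auto simp: norm_mult\<close>)

text \<open>Both orientations occur: decay in x - t comes from propagating a perturbation from t to
  x, decay in t from the initial value of the amplitude a.\<close>

lemma integral_exp_decay_le:
  fixes \<tau> x :: real
  assumes "\<tau> > 0" "x \<ge> 0"
  shows "(\<lambda>t. exp (- (\<tau> * (x - t)))) integrable_on {0..x}" "integral {0..x} (\<lambda>t. exp (- (\<tau> * (x - t)))) \<le> 1 / \<tau>"
    "(\<lambda>t. exp (- (\<tau> * t))) integrable_on {0..x}" "integral {0..x} (\<lambda>t. exp (- (\<tau> * t))) \<le> 1 / \<tau>"
proof -
  have "((\<lambda>t. exp (- (\<tau> * (x - t)))) has_integral (exp (- (\<tau> * (x - x))) / \<tau> - exp (- (\<tau> * (x - 0))) / \<tau>)) {0..x}"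
    using assms by (intro fundamental_theorem_of_calculus)
      (auto intro!: derivative_eq_intros simp flip: has_real_derivative_iff_has_vector_derivative)
  then have 1: "((\<lambda>t. exp (- (\<tau> * (x - t)))) has_integral (1 / \<tau> - exp (- (\<tau> * x)) / \<tau>)) {0..x}" by simp
  then show "(\<lambda>t. exp (- (\<tau> * (x - t)))) integrable_on {0..x}" by blast
  show "integral {0..x} (\<lambda>t. exp (- (\<tau> * (x - t)))) \<le> 1 / \<tau>"
    unfolding integral_unique[OF 1] using assms by simp
  have "((\<lambda>t. exp (- (\<tau> * t))) has_integral (- (exp (- (\<tau> * x)) / \<tau>) - - (exp (- (\<tau> * 0)) / \<tau>))) {0..x}"
    using assms by (intro fundamental_theorem_of_calculus)
      (auto intro!: derivative_eq_intros simp flip: has_real_derivative_iff_has_vector_derivative)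
  then have 2: "((\<lambda>t. exp (- (\<tau> * t))) has_integral (1 / \<tau> - exp (- (\<tau> * x)) / \<tau>)) {0..x}" by simp
  then show "(\<lambda>t. exp (- (\<tau> * t))) integrable_on {0..x}" by blast
  show "integral {0..x} (\<lambda>t. exp (- (\<tau> * t))) \<le> 1 / \<tau>"
    unfolding integral_unique[OF 2] using assms by simp
qed

text \<open>Young's inequality with weight sqrt \<tau>, in the role of Cauchy-Schwarz under the
  integral. Here s = |\<sigma>|, w = |p|, q stems from \<sigma>^2/(2 l), and e is an exponential
  whose square integrates to at most 1/(4 \<tau>); after integration both terms on the right are
  O(1/sqrt \<tau>).\<close>

lemma decay_kernel_le:
  fixes s w \<tau> q :: real
  assumes "\<tau> \<ge> 1" "0 \<le> e" "e \<le> 1" "0 \<le> s" "0 \<le> w" "0 \<le> q" "q \<le> s\<^sup>2 / (2 * \<tau>)"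
  shows "e * (s + w + q) \<le> sqrt \<tau> / 2 * e\<^sup>2 + 2 * (s\<^sup>2 + w\<^sup>2) / sqrt \<tau>"
proof -
  define r where "r = sqrt \<tau>"
  have r: "r \<ge> 1" "r\<^sup>2 = \<tau>" using assms by (auto simp: r_def)
  have "0 \<le> (r * e - (s + w))\<^sup>2" by simp
  then have "2 * r * (e * (s + w)) \<le> r\<^sup>2 * e\<^sup>2 + (s + w)\<^sup>2"
    by (simp add: power2_eq_square algebra_simps)
  moreover have "(s + w)\<^sup>2 \<le> 2 * (s\<^sup>2 + w\<^sup>2)"
    using sum_power2_ge_zero[of "s - w" 0] by (simp add: power2_eq_square algebra_simps)
  ultimately have "2 * r * (e * (s + w)) \<le> r\<^sup>2 * e\<^sup>2 + 2 * (s\<^sup>2 + w\<^sup>2)" by linarith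
  then have 1: "e * (s + w) \<le> r / 2 * e\<^sup>2 + (s\<^sup>2 + w\<^sup>2) / r"
    using r by (simp add: field_simps power2_eq_square)
  have "e * q \<le> 1 * (s\<^sup>2 / (2 * \<tau>))" using assms by (intro mult_mono) auto
  also have "\<dots> \<le> s\<^sup>2 / r"
  proof -
    have "r \<le> r * r" using r by simp
    then have "r \<le> 2 * \<tau>" using r(1) unfolding r(2)[symmetric] power2_eq_square by linarith
    then show ?thesis using r by (simp add: frac_le)
  qed
  also have "\<dots> \<le> (s\<^sup>2 + w\<^sup>2) / r" using r by (intro divide_right_mono) auto
  finally have "e * q \<le> (s\<^sup>2 + w\<^sup>2) / r" .
  moreover have "2 * (s\<^sup>2 + w\<^sup>2) / r = (s\<^sup>2 + w\<^sup>2) / r + (s\<^sup>2 + w\<^sup>2) / r" by simp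
  moreover have "e * (s + w + q) = e * (s + w) + e * q" by (simp add: distrib_left)
  ultimately show ?thesis using 1 unfolding r_def[symmetric] by linarith
qed

section \<open>Bounds for large spectral parameter\<close>

text \<open>With \<open>r = - \<i>p + \<i>\<sigma>\<^sup>2/(2\<lambda>)\<close>, the amplitudes \<open>a, b = y1 \<plusminus> \<i>\<lambda>y\<close> satisfy
  \<open>a' = \<i>\<lambda>a - \<sigma>b + r(a - b)\<close> and \<open>b' = - \<i>\<lambda>b - \<sigma>a + r(a - b)\<close>. For \<open>Im \<lambda> > 0\<close> the amplitude \<open>b\<close> grows, and
  \<open>a\<close> is only driven by \<open>b\<close> through the kernel \<open>exp(- 2 Im \<lambda> (x - t))\<close>, which is small in \<open>L\<^sub>2\<close>.\<close>

lemma amplitude_estimates: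
  assumes \<sigma>: "\<sigma> \<in> L2 0 L" and p: "p \<in> L2 0 L" and L: "L \<ge> 0"
  obtains M K where "M > 0" "K \<ge> 0"
    "\<And>l y y1 x. \<lbrakk>dirichlet_solution \<sigma> p L l y y1; 1 \<le> cmod l; 0 \<le> Im l; x \<in> {0..L}\<rbrakk> \<Longrightarrow>
      cmod (y1 x + \<i> * l * y x) \<le> M * exp (Im l * x) \<and> cmod (y1 x - \<i> * l * y x) \<le> M * exp (Im l * x)"
    "\<And>l y y1 x. \<lbrakk>dirichlet_solution \<sigma> p L l y y1; 1 \<le> Im l; x \<in> {0..L}\<rbrakk> \<Longrightarrow>
      cmod (y1 x + \<i> * l * y x) \<le> (M * exp (- (2 * Im l * x)) + K / sqrt (Im l)) * exp (Im l * x) \<and>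
      (1 - K / sqrt (Im l)) * exp (Im l * x) \<le> M * cmod (y1 x - \<i> * l * y x)"
proof -
  define g where "g = (\<lambda>t. cmod (\<sigma> t) + cmod (p t) + (cmod (\<sigma> t))\<^sup>2)"
  define g2 where "g2 = (\<lambda>t. (cmod (\<sigma> t))\<^sup>2 + (cmod (p t))\<^sup>2)"
  have g: "g absolutely_integrable_on {0..L}"
    unfolding g_def using \<sigma> p by (intro set_integral_add set_integrable_norm) (auto simp: L2_iff)
  have g2: "g2 absolutely_integrable_on {0..L}"
    unfolding g2_def using \<sigma> p by (intro set_integral_add) (auto simp: L2_iff)
  have g0: "g t \<ge> 0" and g20: "g2 t \<ge> 0" for t by (auto simp: g_def g2_def)
  have gi: "g integrable_on {0..x}" and g2i: "g2 integrable_on {0..x}" if "x \<in> {0..L}" for x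
    by (rule absolutely_integrable_subinterval(2)[OF g that] absolutely_integrable_subinterval(2)[OF g2 that])+
  define G where "G = integral {0..L} g"
  define H where "H = integral {0..L} g2"
  have Gx: "integral {0..x} g \<le> G" if "x \<in> {0..L}" for x
    unfolding G_def by (rule integral_subset_le) (use that gi[of x] gi[of L] g0 L in auto)
  have Hx: "integral {0..x} g2 \<le> H" if "x \<in> {0..L}" for x
    unfolding H_def by (rule integral_subset_le) (use that g2i[of x] g2i[of L] g20 L in auto)
  have G0: "G \<ge> 0" unfolding G_def by (rule integral_nonneg[OF gi g0]) (use L in auto)
  have H0: "H \<ge> 0" unfolding H_def by (rule integral_nonneg[OF g2i g20]) (use L in auto)
  \<comment> \<open>The kernel exp(2 \<Phi> x - 2 \<Phi> t) below contains 2 R x - 2 R t, of modulus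
    at most 4 G.\<close>
  define M0 where "M0 = exp (4 * G)"
  have M0: "M0 \<ge> 1" "exp (2 * G) \<le> M0" "exp G \<le> M0" "M0 \<ge> 0" using G0 by (auto simp: M0_def)
  \<comment> \<open>The bound that \<open>gronwall\<close> returns for the constant 2 M0 and the
    weight M0 g.\<close>
  define B where "B = 2 * (2 * M0) * exp (2 * (M0 * G))"
  have B0: "B \<ge> 0" using M0 by (simp add: B_def)
  \<comment> \<open>Exceeds 1/8 + 2 H, which is sqrt \<tau> times the bound for the integrated
    right-hand side of \<open>decay_kernel_le\<close>.\<close>
  define \<kappa> where "\<kappa> = 1 + 2 * H"
  have \<kappa>0: "\<kappa> \<ge> 1" using H0 by (simp add: \<kappa>_def)
  define K1 where "K1 = M0 * B * \<kappa>"
  have K10: "K1 \<ge> 0" using M0 B0 \<kappa>0 by (simp add: K1_def)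
  define K2 where "K2 = M0 * \<kappa> + G * K1"
  have K20: "K2 \<ge> 0" using M0 \<kappa>0 G0 K10 by (simp add: K2_def)
  \<comment> \<open>E is exp(-\<Phi>), of size exp(Im l x) up to the factor M0, and \<alpha>,
    \<beta> are the amplitudes divided by it. The estimate B holds on the closed upper half plane
    away from 0; the last line sharpens it for Im l \<ge> 1.\<close>
  have core: "\<exists>\<alpha> \<beta> E. y1 x + \<i> * l * y x = E * \<alpha> \<and> y1 x - \<i> * l * y x = E * \<beta> \<and>
      cmod E \<le> M0 * exp (Im l * x) \<and> exp (Im l * x) \<le> M0 * cmod E \<and> cmod \<alpha> \<le> B \<and> cmod \<beta> \<le> B \<and>
      (1 \<le> Im l \<longrightarrow> cmod \<alpha> \<le> M0 * exp (- (2 * Im l * x)) + K1 / sqrt (Im l) \<and> cmod (\<beta> - 1) \<le> K2 / sqrt (Im l))"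
    if Y: "solves \<sigma> p l 0 L y y1" and y0: "y 0 = 0" "y1 0 = 1" and l: "1 \<le> cmod l" "0 \<le> Im l" and x: "x \<in> {0..L}"
    for l y y1 x
  proof -
    have l0: "l \<noteq> 0" using l by auto
    define \<tau> where "\<tau> = Im l"
    have \<tau>: "\<tau> \<ge> 0" using l by (simp add: \<tau>_def)
    define r where "r = (\<lambda>t. - \<i> * p t + \<i> / (2 * l) * (\<sigma> t)\<^sup>2)"
    have rl: "r t * (2 * \<i> * l) = 2 * l * p t - (\<sigma> t)\<^sup>2" for t
    proof -
      have "r t * (2 * \<i> * l) = - (\<i> * \<i>) * (2 * l * p t) + (\<i> * \<i>) * (\<sigma> t)\<^sup>2"
        using l0 unfolding r_def by (simp add: field_simps)
      then show ?thesis by simp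
    qed
    have ri: "r absolutely_integrable_on {0..L}"
      unfolding r_def using p \<sigma> L2_square[OF \<sigma>]
      by (intro set_integral_add set_integrable_mult_right) (auto simp: L2_iff)
    have \<sigma>i: "\<sigma> absolutely_integrable_on {0..L}" using \<sigma> by (simp add: L2_iff)
    have nr: "cmod (r t) \<le> cmod (p t) + (cmod (\<sigma> t))\<^sup>2 / (2 * cmod l)" for t
    proof -
      have "cmod (r t) \<le> cmod (- \<i> * p t) + cmod (\<i> / (2 * l) * (\<sigma> t)\<^sup>2)"
        unfolding r_def by (rule norm_triangle_ineq)
      then show ?thesis by (simp add: norm_mult norm_divide norm_power)
    qed
    have "(cmod (\<sigma> t))\<^sup>2 / (2 * cmod l) \<le> (cmod (\<sigma> t))\<^sup>2 / 1" for t
      by (rule divide_left_mono) (use l in auto)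
    then have nrg: "cmod (\<sigma> t) + cmod (r t) \<le> g t" for t
      using nr[of t] by (simp add: g_def) (smt (verit))
    have nrg1: "cmod (\<sigma> t + r t) \<le> g t" "cmod (r t - \<sigma> t) \<le> g t" "cmod (r t) \<le> g t" for t
      using nrg[of t] norm_triangle_ineq[of "\<sigma> t" "r t"] norm_triangle_ineq4[of "r t" "\<sigma> t"] norm_ge_zero[of "\<sigma> t"]
      by linarith+
    define R where "R = (\<lambda>x. integral {0..x} r)"
    have R: "cmod (R x) \<le> G" if x: "x \<in> {0..L}" for x
    proof -
      have "cmod (R x) \<le> integral {0..x} g"
        unfolding R_def
        by (rule integral_norm_bound_integral) (use x gi nrg1 absolutely_integrable_subinterval(2)[OF ri x] in auto)
      then show ?thesis using Gx[OF x] by linarith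
    qed
    \<comment> \<open>Chosen so that multiplying b by exp \<Phi> removes b from its own equation,
      and multiplying a by exp(-\<Phi>) removes a from its own.\<close>
    define \<Phi> where "\<Phi> = (\<lambda>x. \<i> * l * of_real x + R x)"
    have d\<Phi>: "has_AC_derivative \<Phi> (\<lambda>x. \<i> * l + r x) 0 L"
      unfolding \<Phi>_def R_def
      by (rule has_AC_derivative_cong[OF has_AC_derivative_add[OF has_AC_derivative_cmult[OF has_AC_derivative_id, of "\<i> * l"]
              indefinite_integral_has_AC_derivative[OF ri]]]) auto
    have Re\<Phi>: "- \<tau> * x - G \<le> Re (\<Phi> x)" "Re (\<Phi> x) \<le> - \<tau> * x + G" if "x \<in> {0..L}" for x
      using R[OF that] abs_Re_le_cmod[of "R x"] by (auto simp: \<Phi>_def \<tau>_def)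
    define a where "a = (\<lambda>x. y1 x + \<i> * l * y x)"
    define b where "b = (\<lambda>x. y1 x - \<i> * l * y x)"
    have ab: "a t - b t = 2 * \<i> * l * y t" for t by (simp add: a_def b_def)
    have r2: "r t * (a t - b t) = 2 * l * p t * y t - (\<sigma> t)\<^sup>2 * y t" for t
    proof -
      have "r t * (a t - b t) = (r t * (2 * \<i> * l)) * y t" unfolding ab by (simp add: mult_ac)
      then show ?thesis unfolding rl by (simp add: algebra_simps)
    qed
    have da: "has_AC_derivative a (\<lambda>t. \<i> * l * a t - \<sigma> t * b t + r t * (a t - b t)) 0 L"
      unfolding r2
      by (rule has_AC_derivative_cong[OF has_AC_derivative_add[OF solvesD(2)[OF Y] has_AC_derivative_cmult[OF solvesD(1)[OF Y], of "\<i> * l"]]])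
        (auto simp: a_def b_def algebra_simps power2_eq_square)
    have db: "has_AC_derivative b (\<lambda>t. - (\<i> * l) * b t - \<sigma> t * a t + r t * (a t - b t)) 0 L"
      unfolding r2
      by (rule has_AC_derivative_cong[OF has_AC_derivative_diff[OF solvesD(2)[OF Y] has_AC_derivative_cmult[OF solvesD(1)[OF Y], of "\<i> * l"]]])
        (auto simp: a_def b_def algebra_simps power2_eq_square)
    define \<alpha> where "\<alpha> = (\<lambda>x. exp (\<Phi> x) * a x)"
    define \<beta> where "\<beta> = (\<lambda>x. exp (\<Phi> x) * b x)"
    have d\<beta>: "has_AC_derivative \<beta> (\<lambda>t. (r t - \<sigma> t) * \<alpha> t) 0 L"
      unfolding \<beta>_def \<alpha>_def
      by (rule has_AC_derivative_cong[OF has_AC_derivative_mult[OF has_AC_derivative_exp[OF d\<Phi>] db]])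
        (auto simp: algebra_simps)
    have dA: "has_AC_derivative (\<lambda>x. exp (- \<Phi> x) * a x) (\<lambda>t. (\<sigma> t + r t) * (- (exp (- 2 * \<Phi> t) * \<beta> t))) 0 L"
    proof (rule has_AC_derivative_cong[OF has_AC_derivative_mult[OF has_AC_derivative_exp[OF has_AC_derivative_minus[OF d\<Phi>]] da]])
      fix t
      have "exp (- 2 * \<Phi> t) * \<beta> t = exp (- \<Phi> t) * b t"
        by (simp add: \<beta>_def mult.assoc[symmetric] exp_add[symmetric])
      then show "exp (- \<Phi> t) * (\<i> * l * a t - \<sigma> t * b t + r t * (a t - b t)) + - (\<i> * l + r t) * exp (- \<Phi> t) * a t
          = (\<sigma> t + r t) * (- (exp (- 2 * \<Phi> t) * \<beta> t))"
        by (simp add: algebra_simps)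
    qed auto
    have \<Phi>0: "\<Phi> 0 = 0" by (simp add: \<Phi>_def R_def)
    have c\<Phi>: "continuous_on {0..L} \<Phi>" and c\<beta>: "continuous_on {0..L} \<beta>"
      using d\<Phi> d\<beta> by (auto intro: has_AC_derivative_continuous_on)
    have c\<alpha>: "continuous_on {0..L} \<alpha>"
      unfolding \<alpha>_def by (intro continuous_intros c\<Phi> has_AC_derivative_continuous_on[OF da])
    have \<beta>x: "\<beta> x - 1 = integral {0..x} (\<lambda>t. (r t - \<sigma> t) * \<alpha> t)" if "x \<in> {0..L}" for x
      using has_AC_derivative_eq_integral(2)[OF d\<beta> that] by (simp add: \<beta>_def \<Phi>0 b_def y0)
    \<comment> \<open>Variation of constants. For Im l \<ge> 0 the kernel exp(2 \<Phi> x - 2 \<Phi>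
      t) is bounded by M0 exp(-2 \<tau> (x - t)).\<close>
    have \<alpha>x: "\<alpha> x = exp (2 * \<Phi> x) + integral {0..x} (\<lambda>t. (\<sigma> t + r t) * (- (exp (2 * \<Phi> x - 2 * \<Phi> t) * \<beta> t)))"
      if "x \<in> {0..L}" for x
    proof -
      have "exp (- \<Phi> x) * a x = 1 + integral {0..x} (\<lambda>t. (\<sigma> t + r t) * (- (exp (- 2 * \<Phi> t) * \<beta> t)))"
        using has_AC_derivative_eq_integral(2)[OF dA that] by (simp add: \<Phi>0 a_def y0)
      then have "exp (2 * \<Phi> x) * (exp (- \<Phi> x) * a x) = exp (2 * \<Phi> x) +
          exp (2 * \<Phi> x) * integral {0..x} (\<lambda>t. (\<sigma> t + r t) * (- (exp (- 2 * \<Phi> t) * \<beta> t)))"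
        by (simp add: algebra_simps)
      also have "exp (2 * \<Phi> x) * integral {0..x} (\<lambda>t. (\<sigma> t + r t) * (- (exp (- 2 * \<Phi> t) * \<beta> t)))
          = integral {0..x} (\<lambda>t. exp (2 * \<Phi> x) * ((\<sigma> t + r t) * (- (exp (- 2 * \<Phi> t) * \<beta> t))))"
        by simp
      also have "\<dots> = integral {0..x} (\<lambda>t. (\<sigma> t + r t) * (- (exp (2 * \<Phi> x - 2 * \<Phi> t) * \<beta> t)))"
        by (rule integral_cong) (simp add: exp_diff exp_minus field_simps)
      also have "exp (2 * \<Phi> x) * (exp (- \<Phi> x) * a x) = \<alpha> x"
        by (simp add: \<alpha>_def mult.assoc[symmetric] exp_add[symmetric])
      finally show ?thesis .
    qed
    have e2: "cmod (exp (2 * \<Phi> x)) \<le> M0 * exp (- (2 * \<tau> * x))" if "x \<in> {0..L}" for x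
    proof -
      have "cmod (exp (2 * \<Phi> x)) \<le> exp (2 * G + - (2 * \<tau> * x))"
        using Re\<Phi>(2)[OF that] by (simp add: algebra_simps)
      also have "\<dots> = exp (2 * G) * exp (- (2 * \<tau> * x))" by (rule exp_add)
      also have "\<dots> \<le> M0 * exp (- (2 * \<tau> * x))" by (intro mult_right_mono M0) auto
      finally show ?thesis .
    qed
    have e3: "cmod (exp (2 * \<Phi> x - 2 * \<Phi> t)) \<le> M0 * exp (- (2 * \<tau> * (x - t)))" if "x \<in> {0..L}" "t \<in> {0..L}" for x t
    proof -
      have "cmod (exp (2 * \<Phi> x - 2 * \<Phi> t)) \<le> exp (4 * G + - (2 * \<tau> * (x - t)))"
        using Re\<Phi>(2)[OF that(1)] Re\<Phi>(1)[OF that(2)] by (simp add: algebra_simps)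
      also have "\<dots> = M0 * exp (- (2 * \<tau> * (x - t)))" unfolding M0_def by (rule exp_add)
      finally show ?thesis .
    qed
    have exple: "exp (- (2 * \<tau> * s)) \<le> 1" if "s \<ge> 0" for s using that \<tau> by simp
    have i1: "(\<lambda>t. \<sigma> t + r t) absolutely_integrable_on {0..L}" "(\<lambda>t. r t - \<sigma> t) absolutely_integrable_on {0..L}"
      using \<sigma>i ri by (auto intro: set_integral_add set_integral_diff)
    have ck: "continuous_on {0..L} (\<lambda>t. - (exp (2 * \<Phi> x - 2 * \<Phi> t) * \<beta> t))" for x
      by (intro continuous_intros c\<Phi> c\<beta>)
    have cn: "continuous_on {0..L} (\<lambda>t. cmod (\<alpha> t))" "continuous_on {0..L} (\<lambda>t. cmod (\<beta> t))"
      by (intro continuous_intros c\<alpha> c\<beta>)+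
    have gw: "(\<lambda>t. g t * w t) integrable_on {0..x}" if "continuous_on {0..L} w" "x \<in> {0..L}" for w x
      by (rule absolutely_integrable_subinterval(2)[OF absolutely_integrable_mult_continuous[OF g that(1)] that(2)])
    \<comment> \<open>Boundedness of the kernel is enough here, so Im l = 0 is included. The crude
      bound B then enters the refined estimate of \<alpha>, and that one the estimate of \<beta> -
      1.\<close>
    have u: "cmod (\<alpha> x) + cmod (\<beta> x) \<le> B" if x: "x \<in> {0..L}" for x
    proof -
      have Mg: "(\<lambda>t. M0 * g t) absolutely_integrable_on {0..L}" using g by (rule set_integrable_mult_right)
      have "cmod (\<alpha> x) + cmod (\<beta> x) \<le> 2 * (2 * M0) * exp (2 * integral {0..x} (\<lambda>t. M0 * g t))"
      proof (rule gronwall[OF Mg _ _ _ _ x])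
        show "0 \<le> M0 * g t" for t using M0 g0[of t] by simp
        show "continuous_on {0..L} (\<lambda>x. cmod (\<alpha> x) + cmod (\<beta> x))" by (intro continuous_intros c\<alpha> c\<beta>)
        show "0 \<le> 2 * M0" using M0 by simp
        fix x assume x: "x \<in> {0..L}"
        have "cmod (integral {0..x} (\<lambda>t. (\<sigma> t + r t) * (- (exp (2 * \<Phi> x - 2 * \<Phi> t) * \<beta> t))))
            \<le> integral {0..x} (\<lambda>t. M0 * (g t * cmod (\<beta> t)))"
        proof (rule norm_integral_mult_le[OF i1(1) x ck])
          show "(\<lambda>t. M0 * (g t * cmod (\<beta> t))) integrable_on {0..x}" by (intro integrable_on_mult_right gw cn x)
          fix t assume t: "t \<in> {0..x}"
          have "cmod (exp (2 * \<Phi> x - 2 * \<Phi> t)) \<le> M0 * exp (- (2 * \<tau> * (x - t)))" by (rule e3) (use t x in auto)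
          also have "\<dots> \<le> M0 * 1" using exple[of "x - t"] t M0 by (intro mult_left_mono) auto
          finally have "cmod (exp (2 * \<Phi> x - 2 * \<Phi> t)) \<le> M0" by simp
          then have "cmod (\<sigma> t + r t) * (cmod (exp (2 * \<Phi> x - 2 * \<Phi> t)) * cmod (\<beta> t)) \<le> g t * (M0 * cmod (\<beta> t))"
            by (intro mult_mono nrg1 order_refl) (use M0 g0[of t] in auto)
          then show "cmod (\<sigma> t + r t) * cmod (- (exp (2 * \<Phi> x - 2 * \<Phi> t) * \<beta> t)) \<le> M0 * (g t * cmod (\<beta> t))"
            by (simp add: norm_mult mult_ac del: norm_exp_eq_Re)
        qed
        moreover have "cmod (exp (2 * \<Phi> x)) \<le> M0"
        proof -
          have "M0 * exp (- (2 * \<tau> * x)) \<le> M0 * 1" using exple[of x] x M0 by (intro mult_left_mono) auto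
          then show ?thesis using e2[OF x] by linarith
        qed
        ultimately have A: "cmod (\<alpha> x) \<le> M0 + integral {0..x} (\<lambda>t. M0 * (g t * cmod (\<beta> t)))"
          unfolding \<alpha>x[OF x] by (intro norm_triangle_mono)
        have "cmod (\<beta> x - 1) \<le> integral {0..x} (\<lambda>t. M0 * (g t * cmod (\<alpha> t)))"
          unfolding \<beta>x[OF x]
        proof (rule norm_integral_mult_le[OF i1(2) x c\<alpha>])
          show "(\<lambda>t. M0 * (g t * cmod (\<alpha> t))) integrable_on {0..x}" by (intro integrable_on_mult_right gw cn x)
          fix t assume t: "t \<in> {0..x}"
          have "cmod (r t - \<sigma> t) * cmod (\<alpha> t) \<le> g t * cmod (\<alpha> t)" by (intro mult_right_mono nrg1) auto
          also have "\<dots> \<le> M0 * (g t * cmod (\<alpha> t))" using mult_right_mono[OF M0(1), of "g t * cmod (\<alpha> t)"] g0[of t] by simp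
          finally show "cmod (r t - \<sigma> t) * cmod (\<alpha> t) \<le> M0 * (g t * cmod (\<alpha> t))" .
        qed
        then have Bx: "cmod (\<beta> x) \<le> M0 + integral {0..x} (\<lambda>t. M0 * (g t * cmod (\<alpha> t)))"
          using norm_triangle_ineq2[of "\<beta> x" 1] M0(1) by simp
        have "integral {0..x} (\<lambda>t. M0 * g t * (cmod (\<alpha> t) + cmod (\<beta> t))) =
            integral {0..x} (\<lambda>t. M0 * (g t * cmod (\<alpha> t)) + M0 * (g t * cmod (\<beta> t)))"
          by (rule integral_cong) (simp add: algebra_simps)
        also have "\<dots> = integral {0..x} (\<lambda>t. M0 * (g t * cmod (\<alpha> t))) + integral {0..x} (\<lambda>t. M0 * (g t * cmod (\<beta> t)))"
          by (intro integral_add integrable_on_mult_right gw cn x)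
        finally show "cmod (\<alpha> x) + cmod (\<beta> x) \<le> 2 * M0 + integral {0..x} (\<lambda>t. M0 * g t * (cmod (\<alpha> t) + cmod (\<beta> t)))"
          using A Bx by linarith
      qed
      also have "\<dots> \<le> B"
        using Gx[OF x] M0 by (auto simp: B_def intro!: mult_left_mono)
      finally show ?thesis .
    qed
    have uB: "cmod (\<alpha> x) \<le> B" "cmod (\<beta> x) \<le> B" if "x \<in> {0..L}" for x
      using u[OF that] norm_ge_zero[of "\<alpha> x"] norm_ge_zero[of "\<beta> x"] by linarith+
    have small: "cmod (\<alpha> x) \<le> M0 * exp (- (2 * \<tau> * x)) + K1 / sqrt \<tau> \<and> cmod (\<beta> x - 1) \<le> K2 / sqrt \<tau>"
      if \<tau>1: "1 \<le> \<tau>" and x: "x \<in> {0..L}" for x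
    proof -
      have s0: "sqrt \<tau> > 0" "sqrt \<tau> \<ge> 1" using \<tau>1 by auto
      have ker: "exp (- (2 * \<tau> * s)) * (cmod (\<sigma> t) + cmod (r t)) \<le> sqrt \<tau> / 2 * exp (- (4 * \<tau> * s)) + 2 / sqrt \<tau> * g2 t"
        if "s \<ge> 0" for s t
      proof -
        have "cmod l \<ge> \<tau>" using abs_Im_le_cmod[of l] by (simp add: \<tau>_def)
        then have q: "(cmod (\<sigma> t))\<^sup>2 / (2 * cmod l) \<le> (cmod (\<sigma> t))\<^sup>2 / (2 * \<tau>)"
          using \<tau>1 by (intro divide_left_mono mult_pos_pos) auto
        have "exp (- (2 * \<tau> * s)) * (cmod (\<sigma> t) + cmod (r t)) \<le>
            exp (- (2 * \<tau> * s)) * (cmod (\<sigma> t) + cmod (p t) + (cmod (\<sigma> t))\<^sup>2 / (2 * cmod l))"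
          using nr[of t] by (intro mult_left_mono) auto
        also have "\<dots> \<le> sqrt \<tau> / 2 * (exp (- (2 * \<tau> * s)))\<^sup>2 + 2 * ((cmod (\<sigma> t))\<^sup>2 + (cmod (p t))\<^sup>2) / sqrt \<tau>"
          by (rule decay_kernel_le) (use \<tau>1 exple[OF that] q in auto)
        also have "(exp (- (2 * \<tau> * s)))\<^sup>2 = exp (- (4 * \<tau> * s))" by (simp add: exp_double[symmetric])
        finally show ?thesis by (simp add: g2_def)
      qed
      have bound: "k integrable_on {0..x} \<and> integral {0..x} k \<le> \<kappa> / sqrt \<tau>"
        if "x \<in> {0..L}" and e: "e integrable_on {0..x}" "integral {0..x} e \<le> 1 / (4 * \<tau>)"
          and k: "k = (\<lambda>t. sqrt \<tau> / 2 * e t + 2 / sqrt \<tau> * g2 t)" for k e x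
      proof
        note x = that(1)
        show "k integrable_on {0..x}" unfolding k by (intro integrable_add integrable_on_mult_right e g2i x)
        have "integral {0..x} k = sqrt \<tau> / 2 * integral {0..x} e + 2 / sqrt \<tau> * integral {0..x} g2"
          unfolding k
          by (subst integral_add[OF integrable_on_mult_right[OF e(1)] integrable_on_mult_right[OF g2i[OF x]]]) simp
        also have "\<dots> \<le> sqrt \<tau> / 2 * (1 / (4 * \<tau>)) + 2 / sqrt \<tau> * H"
          using s0 e(2) Hx[OF x] by (intro add_mono mult_left_mono) auto
        also have "sqrt \<tau> / 2 * (1 / (4 * \<tau>)) = (1 / 8) / sqrt \<tau>"
          using s0 \<tau>1 by (simp add: field_simps)
        also have "(1 / 8) / sqrt \<tau> + 2 / sqrt \<tau> * H \<le> \<kappa> / sqrt \<tau>"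
          using s0 by (simp add: \<kappa>_def field_simps)
        finally show "integral {0..x} k \<le> \<kappa> / sqrt \<tau>" .
      qed
      have \<alpha>s: "cmod (\<alpha> x) \<le> M0 * exp (- (2 * \<tau> * x)) + K1 / sqrt \<tau>" if x: "x \<in> {0..L}" for x
      proof -
        define k where "k = (\<lambda>t. sqrt \<tau> / 2 * exp (- (4 * \<tau> * (x - t))) + 2 / sqrt \<tau> * g2 t)"
        have k: "k integrable_on {0..x}" "integral {0..x} k \<le> \<kappa> / sqrt \<tau>"
          using bound[OF x _ _ k_def] integral_exp_decay_le(1,2)[of "4 * \<tau>" x] \<tau>1 x by auto
        have "cmod (integral {0..x} (\<lambda>t. (\<sigma> t + r t) * (- (exp (2 * \<Phi> x - 2 * \<Phi> t) * \<beta> t))))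
            \<le> integral {0..x} (\<lambda>t. M0 * B * k t)"
        proof (rule norm_integral_mult_le[OF i1(1) x ck])
          show "(\<lambda>t. M0 * B * k t) integrable_on {0..x}" by (intro integrable_on_mult_right k)
          fix t assume t: "t \<in> {0..x}"
          have "cmod (\<sigma> t + r t) * (cmod (exp (2 * \<Phi> x - 2 * \<Phi> t)) * cmod (\<beta> t))
              \<le> (cmod (\<sigma> t) + cmod (r t)) * (M0 * exp (- (2 * \<tau> * (x - t))) * B)"
            by (intro mult_mono norm_triangle_ineq e3 uB) (use t x B0 M0 in auto)
          also have "\<dots> = M0 * B * (exp (- (2 * \<tau> * (x - t))) * (cmod (\<sigma> t) + cmod (r t)))" by (simp add: mult_ac)
          also have "\<dots> \<le> M0 * B * k t"
            unfolding k_def using B0 M0 t by (intro mult_left_mono ker) auto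
          finally show "cmod (\<sigma> t + r t) * cmod (- (exp (2 * \<Phi> x - 2 * \<Phi> t) * \<beta> t)) \<le> M0 * B * k t"
            by (simp add: norm_mult del: norm_exp_eq_Re)
        qed
        also have "\<dots> = M0 * B * integral {0..x} k" by simp
        also have "\<dots> \<le> M0 * B * (\<kappa> / sqrt \<tau>)" using k(2) M0 B0 by (intro mult_left_mono) auto
        finally have "cmod (integral {0..x} (\<lambda>t. (\<sigma> t + r t) * (- (exp (2 * \<Phi> x - 2 * \<Phi> t) * \<beta> t)))) \<le> K1 / sqrt \<tau>"
          by (simp add: K1_def)
        then show ?thesis unfolding \<alpha>x[OF x] by (intro norm_triangle_mono e2 x)
      qed
      \<comment> \<open>\<alpha> starts with exp(2 \<Phi> t), which decays from the left end; hence
        the kernel in t where the previous one was in x - t.\<close>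
      define k where "k = (\<lambda>t. sqrt \<tau> / 2 * exp (- (4 * \<tau> * t)) + 2 / sqrt \<tau> * g2 t)"
      have k: "k integrable_on {0..x}" "integral {0..x} k \<le> \<kappa> / sqrt \<tau>"
        using bound[OF x _ _ k_def] integral_exp_decay_le(3,4)[of "4 * \<tau>" x] \<tau>1 x by auto
      have "cmod (\<beta> x - 1) \<le> integral {0..x} (\<lambda>t. M0 * k t + K1 / sqrt \<tau> * g t)"
        unfolding \<beta>x[OF x]
      proof (rule norm_integral_mult_le[OF i1(2) x c\<alpha>])
        show "(\<lambda>t. M0 * k t + K1 / sqrt \<tau> * g t) integrable_on {0..x}"
          by (intro integrable_add integrable_on_mult_right k gi x)
        fix t assume t: "t \<in> {0..x}"
        have "cmod (r t - \<sigma> t) * cmod (\<alpha> t) \<le> cmod (r t - \<sigma> t) * (M0 * exp (- (2 * \<tau> * t)) + K1 / sqrt \<tau>)"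
          by (intro mult_left_mono \<alpha>s) (use t x in auto)
        also have "\<dots> = M0 * (exp (- (2 * \<tau> * t)) * cmod (r t - \<sigma> t)) + K1 / sqrt \<tau> * cmod (r t - \<sigma> t)"
          by (simp add: algebra_simps)
        also have "\<dots> \<le> M0 * k t + K1 / sqrt \<tau> * g t"
        proof (intro add_mono mult_left_mono)
          have "exp (- (2 * \<tau> * t)) * cmod (r t - \<sigma> t) \<le> exp (- (2 * \<tau> * t)) * (cmod (\<sigma> t) + cmod (r t))"
            using norm_triangle_ineq4[of "r t" "\<sigma> t"] by (intro mult_left_mono) auto
          also have "\<dots> \<le> k t" unfolding k_def using t by (intro ker) auto
          finally show "exp (- (2 * \<tau> * t)) * cmod (r t - \<sigma> t) \<le> k t" .
        qed (use nrg1 M0 K10 s0 in auto)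
        finally show "cmod (r t - \<sigma> t) * cmod (\<alpha> t) \<le> M0 * k t + K1 / sqrt \<tau> * g t" .
      qed
      also have "\<dots> = M0 * integral {0..x} k + K1 / sqrt \<tau> * integral {0..x} g"
        by (subst integral_add[OF integrable_on_mult_right[OF k(1)] integrable_on_mult_right[OF gi[OF x]]]) simp
      also have "\<dots> \<le> M0 * (\<kappa> / sqrt \<tau>) + K1 / sqrt \<tau> * G"
        using k(2) M0 K10 s0 Gx[OF x] by (intro add_mono mult_left_mono) auto
      also have "\<dots> = K2 / sqrt \<tau>" by (simp add: K2_def add_divide_distrib mult.commute)
      finally show ?thesis using \<alpha>s[OF x] by simp
    qed
    show ?thesis
    proof (intro exI conjI impI)
      show "y1 x + \<i> * l * y x = exp (- \<Phi> x) * \<alpha> x" "y1 x - \<i> * l * y x = exp (- \<Phi> x) * \<beta> x"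
        by (simp_all add: \<alpha>_def \<beta>_def a_def b_def mult.assoc[symmetric] exp_add[symmetric])
      have "cmod (exp (- \<Phi> x)) \<le> exp (G + Im l * x)"
        using Re\<Phi>(1)[OF x] by (simp add: \<tau>_def)
      also have "\<dots> = exp G * exp (Im l * x)" by (rule exp_add)
      also have "\<dots> \<le> M0 * exp (Im l * x)" by (intro mult_right_mono M0) auto
      finally show "cmod (exp (- \<Phi> x)) \<le> M0 * exp (Im l * x)" .
      have "exp (Im l * x) \<le> exp (G + Re (- \<Phi> x))"
        using Re\<Phi>(2)[OF x] by (simp add: \<tau>_def)
      also have "\<dots> = exp G * cmod (exp (- \<Phi> x))" unfolding norm_exp_eq_Re by (rule exp_add)
      also have "\<dots> \<le> M0 * cmod (exp (- \<Phi> x))" by (intro mult_right_mono M0) auto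
      finally show "exp (Im l * x) \<le> M0 * cmod (exp (- \<Phi> x))" .
    qed (use uB[OF x] small[OF _ x] in \<open>auto simp: \<tau>_def\<close>)
  qed
  show thesis
  \<comment> \<open>One constant M has to serve as the upper bound M0 B, as the coefficient M0^2 of
    the decaying term and as the factor M0 in the lower bound.\<close>
  proof (rule that[of "M0 * (B + M0)" "M0 * K1 + K2"])
    show "M0 * (B + M0) > 0" using M0 B0 by (simp add: add_nonneg_pos)
    show "0 \<le> M0 * K1 + K2" using M0 K10 K20 by simp
    fix l y y1 x
    assume "dirichlet_solution \<sigma> p L l y y1" and x: "x \<in> {0..L}"
    note Y = dirichlet_solutionD[OF this(1)]
    have scale: "cmod (E * \<alpha>) \<le> M0 * (B + M0) * exp (Im l * x)" if "cmod E \<le> M0 * exp (Im l * x)" "cmod \<alpha> \<le> B" for E \<alpha>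
    proof -
      have "cmod (E * \<alpha>) \<le> (M0 * exp (Im l * x)) * (B + M0)"
        unfolding norm_mult using that M0 B0 by (intro mult_mono) auto
      then show ?thesis by (simp add: mult_ac)
    qed
    {
      assume l: "1 \<le> cmod l" "0 \<le> Im l"
      show "cmod (y1 x + \<i> * l * y x) \<le> M0 * (B + M0) * exp (Im l * x) \<and>
          cmod (y1 x - \<i> * l * y x) \<le> M0 * (B + M0) * exp (Im l * x)"
        using core[OF Y l x] scale by metis
    next
      assume l: "1 \<le> Im l"
      then have l': "1 \<le> cmod l" "0 \<le> Im l" using abs_Im_le_cmod[of l] by auto
      obtain \<alpha> \<beta> E where *: "y1 x + \<i> * l * y x = E * \<alpha>" "y1 x - \<i> * l * y x = E * \<beta>"
        "cmod E \<le> M0 * exp (Im l * x)" "exp (Im l * x) \<le> M0 * cmod E"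
        "cmod \<alpha> \<le> M0 * exp (- (2 * Im l * x)) + K1 / sqrt (Im l)" "cmod (\<beta> - 1) \<le> K2 / sqrt (Im l)"
        using core[OF Y l' x] l by blast
      have s0: "sqrt (Im l) > 0" using l by simp
      have "cmod (E * \<alpha>) \<le> (M0 * exp (Im l * x)) * (M0 * exp (- (2 * Im l * x)) + K1 / sqrt (Im l))"
        unfolding norm_mult using *(3,5) M0 by (intro mult_mono) auto
      also have "\<dots> = (M0 * M0 * exp (- (2 * Im l * x)) + M0 * K1 / sqrt (Im l)) * exp (Im l * x)"
        by (simp add: algebra_simps)
      also have "\<dots> \<le> (M0 * (B + M0) * exp (- (2 * Im l * x)) + (M0 * K1 + K2) / sqrt (Im l)) * exp (Im l * x)"
        using M0 B0 K20 s0 by (intro mult_right_mono add_mono divide_right_mono) auto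
      finally have 1: "cmod (y1 x + \<i> * l * y x) \<le> (M0 * (B + M0) * exp (- (2 * Im l * x)) + (M0 * K1 + K2) / sqrt (Im l)) * exp (Im l * x)"
        unfolding *(1) .
      have "1 - (M0 * K1 + K2) / sqrt (Im l) \<le> 1 - K2 / sqrt (Im l)"
        using M0 K10 s0 by (simp add: divide_right_mono)
      also have "\<dots> \<le> cmod \<beta>" using *(6) norm_triangle_ineq2[of 1 "1 - \<beta>"] by (simp add: norm_minus_commute)
      finally have "(1 - (M0 * K1 + K2) / sqrt (Im l)) * exp (Im l * x) \<le> cmod \<beta> * exp (Im l * x)"
        by (rule mult_right_mono) simp
      also have "\<dots> \<le> cmod \<beta> * (M0 * cmod E)" using *(4) by (intro mult_left_mono) auto
      also have "\<dots> = M0 * cmod (E * \<beta>)" by (simp add: norm_mult mult_ac)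
      also have "\<dots> \<le> M0 * (B + M0) * cmod (E * \<beta>)"
      proof (rule mult_right_mono)
        have "M0 * 1 \<le> M0 * (B + M0)" using M0 B0 by (intro mult_left_mono) auto
        then show "M0 \<le> M0 * (B + M0)" by simp
      qed simp
      finally have 2: "(1 - (M0 * K1 + K2) / sqrt (Im l)) * exp (Im l * x) \<le> M0 * (B + M0) * cmod (y1 x - \<i> * l * y x)"
        unfolding *(2) .
      show "cmod (y1 x + \<i> * l * y x) \<le> (M0 * (B + M0) * exp (- (2 * Im l * x)) + (M0 * K1 + K2) / sqrt (Im l)) * exp (Im l * x) \<and>
        (1 - (M0 * K1 + K2) / sqrt (Im l)) * exp (Im l * x) \<le> M0 * (B + M0) * cmod (y1 x - \<i> * l * y x)"
        using 1 2 by blast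
    }
  qed
qed

section \<open>Quotients of entire functions\<close>

text \<open>Near z both functions are a nonvanishing holomorphic factor times the same power of w -
  z, so the quotient is that of the two factors; this also dictates its value at a zero of H. The
  points u and v exclude the zero function, for which \<open>zorder\<close> is no
  multiplicity.\<close>

lemma entire_quotient_same_zorder:
  assumes F: "F holomorphic_on UNIV" "F u \<noteq> 0" and H: "H holomorphic_on UNIV" "H v \<noteq> 0"
    and ord: "\<And>z. zorder F z = zorder H z"
  obtains G where "G holomorphic_on UNIV" "\<And>z. F z = G z * H z"
proof -
  have fact: "(if f z = 0 then zorder f z > 0 else zorder f z = 0) \<and>
      (\<exists>r>0. zor_poly f z holomorphic_on cball z r \<and>
        (\<forall>w\<in>cball z r. f w = zor_poly f z w * (w - z) ^ nat (zorder f z) \<and> zor_poly f z w \<noteq> 0))"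
    if "f holomorphic_on UNIV" "f u \<noteq> 0" for f z u
    using zorder_exist_zero[OF that(1) open_UNIV connected_UNIV UNIV_I, of z] that(2) by blast
  define G where "G = (\<lambda>z. if H z \<noteq> 0 then F z / H z else zor_poly F z z / zor_poly H z z)"
  show thesis
  proof (rule that[of G])
    fix z
    show "F z = G z * H z"
    proof (cases "H z = 0")
      case True
      then have "zorder F z > 0" using fact[OF H, of z] ord by simp
      then have "F z = 0" using fact[OF F, of z] by (auto split: if_splits)
      then show ?thesis using True by simp
    qed (simp add: G_def)
  next
    have "G field_differentiable (at z)" for z
    proof -
      obtain r1 where r1: "r1 > 0" "zor_poly F z holomorphic_on cball z r1"
        "\<And>w. w \<in> cball z r1 \<Longrightarrow> F w = zor_poly F z w * (w - z) ^ nat (zorder F z) \<and> zor_poly F z w \<noteq> 0"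
        using fact[OF F, of z] by blast
      obtain r2 where r2: "r2 > 0" "zor_poly H z holomorphic_on cball z r2"
        "\<And>w. w \<in> cball z r2 \<Longrightarrow> H w = zor_poly H z w * (w - z) ^ nat (zorder H z) \<and> zor_poly H z w \<noteq> 0"
        using fact[OF H, of z] by blast
      define r where "r = min r1 r2"
      have r: "r > 0" using r1 r2 by (simp add: r_def)
      have sub: "ball z r \<subseteq> cball z r1" "ball z r \<subseteq> cball z r2" by (auto simp: r_def)
      have "(\<lambda>w. zor_poly F z w / zor_poly H z w) holomorphic_on ball z r"
        using r1(2) r2(2,3) sub by (intro holomorphic_on_divide) (auto intro: holomorphic_on_subset)
      moreover have "zor_poly F z w / zor_poly H z w = G w" if "w \<in> ball z r" for w
      proof -
        have w: "F w = zor_poly F z w * (w - z) ^ nat (zorder H z)" "H w = zor_poly H z w * (w - z) ^ nat (zorder H z)"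
          "zor_poly H z w \<noteq> 0"
          using r1(3)[of w] r2(3)[of w] sub that ord by auto
        show ?thesis
        proof (cases "H w = 0")
          case True
          then have "w = z" using w by auto
          then show ?thesis using True by (simp add: G_def)
        next
          case False
          then have "(w - z) ^ nat (zorder H z) \<noteq> 0" using w by auto
          then show ?thesis using False w by (simp add: G_def)
        qed
      qed
      ultimately have "G holomorphic_on ball z r" by (rule holomorphic_transform)
      then show ?thesis using r holomorphic_on_imp_differentiable_at[of G "ball z r" z] by simp
    qed
    then show "G holomorphic_on UNIV" by (simp add: holomorphic_on_def)
  qed
qed

text \<open>The estimates of solutions hold for |z| \<ge> 1, since the function r of the amplitude
  equations contains 1/\<lambda>; on the unit disc compactness supplies a constant.\<close>

lemma bounded_near_zero:
  assumes F: "F holomorphic_on UNIV" and bd: "\<And>z. cmod z \<ge> 1 \<Longrightarrow> cmod (F z) \<le> C * exp (a * \<bar>Im z\<bar>)"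
    and a: "a \<ge> 0"
  obtains C' where "C' \<ge> 0" "\<And>z. cmod (F z) \<le> C' * exp (a * \<bar>Im z\<bar>)"
proof -
  have "bounded (F ` cball 0 1)"
    by (intro compact_imp_bounded compact_continuous_image holomorphic_on_imp_continuous_on
        holomorphic_on_subset[OF F]) auto
  then obtain B where "\<forall>z\<in>cball 0 1. cmod (F z) \<le> B" by (auto simp: bounded_iff)
  then have B: "cmod (F z) \<le> B" if "cmod z \<le> 1" for z using that by simp
  show thesis
  proof (rule that[of "max (max B C) 0"])
    fix z
    have "1 \<le> exp (a * \<bar>Im z\<bar>)" using a by simp
    then have "max (max B C) 0 * 1 \<le> max (max B C) 0 * exp (a * \<bar>Im z\<bar>)" by (intro mult_left_mono) auto
    moreover have "C * exp (a * \<bar>Im z\<bar>) \<le> max (max B C) 0 * exp (a * \<bar>Im z\<bar>)" by (intro mult_right_mono) auto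
    ultimately show "cmod (F z) \<le> max (max B C) 0 * exp (a * \<bar>Im z\<bar>)"
      using B[of z] bd[of z] by (cases "cmod z \<le> 1") linarith+
  qed simp
qed

text \<open>The two bounds on H have separate tasks: the upper one makes its translates a normal
  family, the lower one prevents a limit of translates from vanishing identically. Once G is
  bounded, Liouville's theorem applies.\<close>

theorem entire_quotient_constant:
  assumes hol: "F holomorphic_on UNIV" "G holomorphic_on UNIV" "H holomorphic_on UNIV"
    and FGH: "\<And>z. F z = G z * H z" and a: "a \<ge> 0" and c: "c > 0"
    and F: "\<And>z. cmod z \<ge> 1 \<Longrightarrow> cmod (F z) \<le> C * exp (a * \<bar>Im z\<bar>)"
    and H: "\<And>z. cmod z \<ge> 1 \<Longrightarrow> cmod (H z) \<le> D * exp (a * \<bar>Im z\<bar>)"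
    and low: "\<And>z. \<bar>Im z\<bar> \<ge> K \<Longrightarrow> c * exp (a * \<bar>Im z\<bar>) \<le> cmod (H z)"
  obtains g where "\<And>z. G z = g"
proof -
  obtain C' where C': "C' \<ge> 0" "\<And>z. cmod (F z) \<le> C' * exp (a * \<bar>Im z\<bar>)"
  proof (rule bounded_near_zero[OF hol(1) _ a])
    show "cmod (F z) \<le> C * exp (a * \<bar>Im z\<bar>)" if "cmod z \<ge> 1" for z by (rule F[OF that])
  qed (rule that)
  obtain D' where D': "D' \<ge> 0" "\<And>z. cmod (H z) \<le> D' * exp (a * \<bar>Im z\<bar>)"
  proof (rule bounded_near_zero[OF hol(3) _ a])
    show "cmod (H z) \<le> D * exp (a * \<bar>Im z\<bar>)" if "cmod z \<ge> 1" for z by (rule H[OF that])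
  qed (rule that)
  define K' where "K' = max K 1"
  have K': "K' \<ge> K" "K' \<ge> 1" by (auto simp: K'_def)
  have out: "cmod (G z) \<le> C' / c" if "\<bar>Im z\<bar> \<ge> K'" for z
  proof -
    have "c * exp (a * \<bar>Im z\<bar>) * cmod (G z) \<le> cmod (H z) * cmod (G z)"
      using low[of z] that K' by (intro mult_right_mono) auto
    also have "\<dots> = cmod (F z)" using FGH[of z] by (simp add: norm_mult mult.commute)
    also have "\<dots> \<le> C' * exp (a * \<bar>Im z\<bar>)" by (rule C')
    finally have "(c * cmod (G z)) * exp (a * \<bar>Im z\<bar>) \<le> C' * exp (a * \<bar>Im z\<bar>)" by (simp add: mult_ac)
    then have "c * cmod (G z) \<le> C'" by simp
    then show ?thesis using c by (simp add: field_simps)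
  qed
  have "\<exists>B. \<forall>z. cmod (G z) \<le> B"
  proof (rule ccontr)
    assume "\<nexists>B. \<forall>z. cmod (G z) \<le> B"
    then have "\<exists>z. cmod (G z) > max (C' / c) (real n)" for n by (meson not_le)
    then obtain z where z: "\<And>n. cmod (G (z n)) > max (C' / c) (real n)" by metis
    have imz: "\<bar>Im (z n)\<bar> < K'" for n
      using z[of n] out[of "z n"] by (cases "\<bar>Im (z n)\<bar> \<ge> K'") auto
    \<comment> \<open>The points where G is large are moved to the imaginary axis. Real translations
      keep Im, hence all bounds.\<close>
    define t where "t = (\<lambda>n. complex_of_real (Re (z n)))"
    define h where "h = (\<lambda>n w. H (w + t n))"
    have Im_t: "Im (w + t n) = Im w" for w n by (simp add: t_def)
    have hb: "cmod (h n w) \<le> D' * exp (a * cmod w)" for n w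
    proof -
      have "cmod (h n w) \<le> D' * exp (a * \<bar>Im w\<bar>)" using D'(2)[of "w + t n"] by (simp only: h_def Im_t)
      also have "\<dots> \<le> D' * exp (a * cmod w)"
        using D' a abs_Im_le_cmod[of w] by (intro mult_left_mono) (auto intro: mult_left_mono)
      finally show ?thesis .
    qed
    have hh: "h n holomorphic_on A" for n A
    proof -
      have "H \<circ> (\<lambda>w. w + t n) holomorphic_on A"
        by (rule holomorphic_on_compose_gen[OF _ hol(3)]) (auto intro!: holomorphic_intros)
      then show ?thesis by (simp add: h_def o_def)
    qed
    obtain h0 r where h0: "h0 holomorphic_on UNIV" and r: "strict_mono (r :: nat \<Rightarrow> nat)"
      and pt: "\<And>x. x \<in> UNIV \<Longrightarrow> ((\<lambda>n. h (r n) x) \<longlongrightarrow> h0 x) sequentially"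
      and un: "\<And>X. \<lbrakk>compact X; X \<subseteq> UNIV\<rbrakk> \<Longrightarrow> uniform_limit X (h \<circ> r) h0 sequentially"
    proof (rule Montel[of UNIV "range h" h])
      fix X :: "complex set" assume "compact X"
      then obtain R where R: "\<And>w. w \<in> X \<Longrightarrow> cmod w \<le> R" using compact_imp_bounded bounded_iff by metis
      show "\<exists>B. \<forall>h\<in>range h. \<forall>z\<in>X. norm (h z) \<le> B"
      proof (intro exI ballI)
        fix f w assume f: "f \<in> range h" and w: "w \<in> X"
        then obtain n where "f = h n" by auto
        then have "norm (f w) \<le> D' * exp (a * cmod w)" using hb by simp
        also have "\<dots> \<le> D' * exp (a * R)"
          using D' a R[OF w] by (intro mult_left_mono) (auto intro: mult_left_mono)
        finally show "norm (f w) \<le> D' * exp (a * R)" .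
      qed
    qed (use hh that in auto)
    \<comment> \<open>The lower bound at height K' survives in the limit, so h0 has only finitely
      many zeros in a disc.\<close>
    have h0K: "h0 (\<i> * of_real K') \<noteq> 0"
    proof -
      have "c \<le> cmod (h n (\<i> * of_real K'))" for n
      proof -
        have im: "\<bar>Im (\<i> * of_real K' + t n)\<bar> = K'" using K' by (simp add: t_def)
        have "c * 1 \<le> c * exp (a * K')" using c a K' by (intro mult_left_mono) auto
        also have "\<dots> \<le> cmod (H (\<i> * of_real K' + t n))"
          using low[of "\<i> * of_real K' + t n"] im K' by simp
        finally show ?thesis by (simp add: h_def)
      qed
      then have "c \<le> cmod (h0 (\<i> * of_real K'))"
        by (intro LIMSEQ_le_const[OF tendsto_norm[OF pt]]) auto
      then show ?thesis using c by auto
    qed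
    have fin: "finite {w \<in> cball 0 (2 * K'). h0 w = 0}"
    proof (cases "h0 constant_on UNIV")
      case True
      then have "h0 w \<noteq> 0" for w using h0K unfolding constant_on_def by auto
      then show ?thesis by simp
    next
      case False
      then show ?thesis by (intro holomorphic_compact_finite_zeros[OF h0]) auto
    qed
    \<comment> \<open>The circle must enclose the moved points, which lie on the imaginary axis
      below height K' in modulus, and must avoid the zeros of h0; finitely many zeros leave such a
      radius.\<close>
    have "infinite ({K'<..<2 * K'} :: real set)" using K' by simp
    moreover have "finite (cmod ` {w \<in> cball 0 (2 * K'). h0 w = 0})" using fin by simp
    ultimately obtain \<rho> where \<rho>: "\<rho> \<in> {K'<..<2 * K'}" "\<rho> \<notin> cmod ` {w \<in> cball 0 (2 * K'). h0 w = 0}"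
      by (meson finite_subset subsetI)
    have nz: "h0 w \<noteq> 0" if "w \<in> sphere 0 \<rho>" for w
      using \<rho> that by (auto simp: image_iff)
    have "\<exists>w0\<in>sphere 0 \<rho>. \<forall>w\<in>sphere 0 \<rho>. cmod (h0 w0) \<le> cmod (h0 w)"
    proof (rule continuous_attains_inf)
      have "complex_of_real \<rho> \<in> sphere 0 \<rho>" using \<rho> K' by simp
      then show "sphere (0 :: complex) \<rho> \<noteq> {}" by blast
      show "continuous_on (sphere 0 \<rho>) (\<lambda>w. cmod (h0 w))"
        by (intro continuous_intros holomorphic_on_imp_continuous_on holomorphic_on_subset[OF h0]) auto
    qed auto
    then obtain w0 where w0: "w0 \<in> sphere 0 \<rho>" "\<And>w. w \<in> sphere 0 \<rho> \<Longrightarrow> cmod (h0 w0) \<le> cmod (h0 w)" by auto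
    define d where "d = cmod (h0 w0) / 2"
    have d: "d > 0" using nz[OF w0(1)] by (simp add: d_def)
    have "eventually (\<lambda>n. \<forall>w\<in>sphere 0 \<rho>. dist ((h \<circ> r) n w) (h0 w) < d) sequentially"
      using un[of "sphere 0 \<rho>"] d unfolding uniform_limit_iff by auto
    then obtain n0 where n0: "\<And>n w. n \<ge> n0 \<Longrightarrow> w \<in> sphere 0 \<rho> \<Longrightarrow> dist (h (r n) w) (h0 w) < d"
      unfolding eventually_sequentially o_def by blast
    \<comment> \<open>Large enough for |h (r n)| \<ge> d on the circle, and for n to reach the bound
      that the maximum principle yields there; |G| at z (r n) exceeds n, a contradiction.\<close>
    define n where "n = max n0 (nat \<lceil>C' * exp (a * \<rho>) / d\<rceil>)"
    have n: "dist (h (r n) w) (h0 w) < d" if "w \<in> sphere 0 \<rho>" for w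
      using n0[of n w] that by (simp add: n_def)
    have n2: "C' * exp (a * \<rho>) / d \<le> real n" unfolding n_def by linarith
    define G1 where "G1 = (\<lambda>w. G (w + t (r n)))"
    have G1h: "G1 holomorphic_on A" for A
    proof -
      have "G \<circ> (\<lambda>w. w + t (r n)) holomorphic_on A"
        by (rule holomorphic_on_compose_gen[OF _ hol(2)]) (auto intro!: holomorphic_intros)
      then show ?thesis by (simp add: G1_def o_def)
    qed
    have sph: "cmod (G1 w) \<le> C' * exp (a * \<rho>) / d" if w: "w \<in> sphere 0 \<rho>" for w
    proof -
      have "2 * d \<le> cmod (h0 w)" using w0(2)[OF w] by (simp add: d_def)
      moreover have "cmod (h0 w) - cmod (h (r n) w) \<le> dist (h (r n) w) (h0 w)"
        by (metis dist_commute dist_norm norm_triangle_ineq2)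
      ultimately have "d \<le> cmod (h (r n) w)" using n[OF w] by linarith
      then have "d * cmod (G1 w) \<le> cmod (h (r n) w) * cmod (G1 w)" by (intro mult_right_mono) auto
      also have "\<dots> = cmod (F (w + t (r n)))" using FGH by (simp add: h_def G1_def norm_mult mult.commute)
      also have "\<dots> \<le> C' * exp (a * \<bar>Im w\<bar>)" using C'(2)[of "w + t (r n)"] by (simp only: Im_t)
      also have "\<dots> \<le> C' * exp (a * \<rho>)"
        using C' a abs_Im_le_cmod[of w] w by (intro mult_left_mono) (auto intro: mult_left_mono)
      finally show ?thesis using d by (simp add: field_simps)
    qed
    have "cmod (G1 (\<i> * of_real (Im (z (r n))))) \<le> C' * exp (a * \<rho>) / d"
    proof (rule maximum_modulus_frontier[of G1 "cball 0 \<rho>"])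
      show "G1 holomorphic_on interior (cball 0 \<rho>)" by (rule G1h)
      show "continuous_on (closure (cball 0 \<rho>)) G1" by (intro holomorphic_on_imp_continuous_on G1h)
      show "cmod (G1 w) \<le> C' * exp (a * \<rho>) / d" if "w \<in> frontier (cball 0 \<rho>)" for w
        using that sph by simp
      show "\<i> * of_real (Im (z (r n))) \<in> cball 0 \<rho>" using imz[of "r n"] \<rho> by (simp add: norm_mult)
    qed auto
    moreover have "\<i> * of_real (Im (z (r n))) + t (r n) = z (r n)"
      by (simp add: t_def complex_eq_iff)
    ultimately have "cmod (G (z (r n))) \<le> C' * exp (a * \<rho>) / d" by (simp add: G1_def)
    moreover have "real (r n) \<ge> real n" using seq_suble[OF r, of n] by simp
    ultimately show False using z[of "r n"] n2 by linarith
  qed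
  then obtain B where "\<And>z. cmod (G z) \<le> B" by auto
  then have "bounded (range G)" by (auto simp: bounded_iff)
  then have "G constant_on UNIV" using Liouville_theorem[OF hol(2)] by blast
  then show thesis using that unfolding constant_on_def by auto
qed

section \<open>The lemma of du Bois-Reymond\<close>

text \<open>Smooth functions form the largest class closed under differentiation, so membership in
  any such class proves smoothness. The induction on the order of the derivative is carried out here
  once for all later uses.\<close>

lemma smoothI_closed:
  assumes "\<phi> \<in> A" "\<And>f. f \<in> A \<Longrightarrow> \<exists>g\<in>A. \<forall>x. (f has_vector_derivative g x) (at x)"
  shows "smooth \<phi>"
proof -
  have vd: "f differentiable (at x) \<and> (\<lambda>t. vector_derivative f (at t)) \<in> A" if f: "f \<in> A" for f x
  proof -
    obtain g where g: "g \<in> A" "\<And>x. (f has_vector_derivative g x) (at x)" using assms(2)[OF f] by auto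
    have "(\<lambda>t. vector_derivative f (at t)) = g" using g(2) by (auto simp: vector_derivative_at)
    then show ?thesis using g by (auto intro: differentiableI_vector)
  qed
  have "((\<lambda>g t. vector_derivative g (at t)) ^^ n) \<phi> \<in> A" for n
    by (induction n) (use assms(1) vd in auto)
  then show ?thesis unfolding smooth_def using vd by blast
qed

lemma smoothD:
  assumes "smooth f"
  shows "smooth (\<lambda>t. vector_derivative f (at t))"
    and "(f has_vector_derivative vector_derivative f (at x)) (at x)"
proof -
  show "smooth (\<lambda>t. vector_derivative f (at t))"
    unfolding smooth_def
  proof (intro allI)
    fix n x
    have "((\<lambda>g t. vector_derivative g (at t)) ^^ Suc n) f differentiable (at x)"
      using assms unfolding smooth_def by blast
    then show "((\<lambda>g t. vector_derivative g (at t)) ^^ n) (\<lambda>t. vector_derivative f (at t)) differentiable (at x)"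
      by (simp only: funpow_Suc_right o_apply)
  qed
  have "((\<lambda>g t. vector_derivative g (at t)) ^^ 0) f differentiable (at x)"
    using assms unfolding smooth_def by blast
  then show "(f has_vector_derivative vector_derivative f (at x)) (at x)"
    by (simp add: vector_derivative_works)
qed

lemma smooth_combination:
  assumes "smooth f" "smooth g" shows "smooth (\<lambda>x. c * f x + d * g x)"
proof (rule smoothI_closed[of _ "{h. \<exists>f g. smooth f \<and> smooth g \<and> h = (\<lambda>x. c * f x + d * g x)}"])
  fix h assume "h \<in> {h. \<exists>f g. smooth f \<and> smooth g \<and> h = (\<lambda>x. c * f x + d * g x)}"
  then obtain f g where h: "smooth f" "smooth g" "h = (\<lambda>x. c * f x + d * g x)" by auto
  show "\<exists>k\<in>{h. \<exists>f g. smooth f \<and> smooth g \<and> h = (\<lambda>x. c * f x + d * g x)}. \<forall>x. (h has_vector_derivative k x) (at x)"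
  proof (intro bexI allI)
    show "(h has_vector_derivative c * vector_derivative f (at x) + d * vector_derivative g (at x)) (at x)" for x
      unfolding h(3)
      by (intro has_vector_derivative_add has_vector_derivative_mult_right smoothD h)
  qed (use h smoothD in blast)
qed (use assms in auto)

lemma smooth_affine:
  assumes "smooth f" shows "smooth (\<lambda>x. c * f (\<alpha> * x + \<beta>))"
proof (rule smoothI_closed[of _ "{h. \<exists>f c. smooth f \<and> h = (\<lambda>x. c * f (\<alpha> * x + \<beta>))}"])
  fix h assume "h \<in> {h. \<exists>f c. smooth f \<and> h = (\<lambda>x. c * f (\<alpha> * x + \<beta>))}"
  then obtain f c where h: "smooth f" "h = (\<lambda>x. c * f (\<alpha> * x + \<beta>))" by auto
  show "\<exists>k\<in>{h. \<exists>f c. smooth f \<and> h = (\<lambda>x. c * f (\<alpha> * x + \<beta>))}. \<forall>x. (h has_vector_derivative k x) (at x)"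
  proof (intro bexI allI)
    fix x
    have "((\<lambda>x. \<alpha> * x + \<beta>) has_vector_derivative \<alpha>) (at x)"
      by (auto intro!: derivative_eq_intros)
    from vector_diff_chain_at[OF this smoothD(2)[OF h(1)]]
    have "((\<lambda>x. f (\<alpha> * x + \<beta>)) has_vector_derivative (\<alpha> *\<^sub>R vector_derivative f (at (\<alpha> * x + \<beta>)))) (at x)"
      by (simp add: o_def)
    from has_vector_derivative_mult_right[OF this, of c]
    show "(h has_vector_derivative (c * of_real \<alpha>) * vector_derivative f (at (\<alpha> * x + \<beta>))) (at x)"
      by (simp add: h(2) scaleR_conv_of_real mult_ac)
  qed (use smoothD(1)[OF h(1)] in blast)
qed (use assms in auto)

lemma smooth_primitive:
  assumes "smooth f" "\<And>x. (F has_vector_derivative f x) (at x)" shows "smooth F"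
proof (rule smoothI_closed[of _ "insert F {f. smooth f}"])
  fix h assume "h \<in> insert F {f. smooth f}"
  then show "\<exists>g\<in>insert F {f. smooth f}. \<forall>x. (h has_vector_derivative g x) (at x)"
    using assms smoothD by auto blast
qed simp

section \<open>A smooth step function\<close>

definition flat :: "nat \<Rightarrow> real \<Rightarrow> real" where
  "flat k x = (if x > 0 then exp (- (1 / x)) / x ^ k else 0)"

lemma flat_tendsto_zero: "(flat k \<longlongrightarrow> 0) (at 0)"
proof -
  have "((\<lambda>x::real. x ^ k / exp x) \<longlongrightarrow> 0) at_top" by (rule tendsto_power_div_exp_0)
  from filterlim_compose[OF this filterlim_inverse_at_top_right]
  have "((\<lambda>x. inverse x ^ k / exp (inverse x)) \<longlongrightarrow> 0) (at_right (0::real))" .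
  moreover have "eventually (\<lambda>x. inverse x ^ k / exp (inverse x) = flat k x) (at_right 0)"
    by (rule eventually_at_right_less[THEN eventually_mono]) (auto simp: flat_def exp_minus field_simps power_inverse)
  ultimately have r: "(flat k \<longlongrightarrow> 0) (at_right 0)" using tendsto_cong by force
  have "eventually (\<lambda>x. flat k x = 0) (at_left 0)"
    by (auto simp: eventually_at_filter flat_def)
  then have l: "(flat k \<longlongrightarrow> 0) (at_left 0)" by (rule tendsto_eventually)
  show ?thesis using l r by (simp add: filterlim_split_at)
qed

text \<open>The powers in the denominator make the family closed under differentiation up to linear
  combinations. At 0 the difference quotient of \<open>flat k\<close> is
  \<open>flat (Suc k)\<close>, which tends to 0.\<close>

lemma flat_has_derivative:
  "(flat k has_real_derivative flat (k + 2) x - real k * flat (k + 1) x) (at x)"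
proof -
  consider "x < 0" | "x > 0" | "x = 0" by linarith
  then show ?thesis
  proof cases
    case 1
    have "(flat k has_real_derivative 0) (at x)"
      by (rule DERIV_cong_ev[THEN iffD1, OF refl _ refl, where f1 = "\<lambda>_. 0"])
        (use 1 in \<open>auto simp: flat_def eventually_nhds intro!: exI[of _ "{..<0}"]\<close>)
    then show ?thesis using 1 by (simp add: flat_def)
  next
    case 2
    have d: "((\<lambda>x. exp (- (1 / x)) / x ^ k) has_real_derivative flat (k + 2) x - real k * flat (k + 1) x) (at x)"
      using 2 by (auto intro!: derivative_eq_intros simp: flat_def)
        (cases k; simp add: field_simps power2_eq_square)
    have ev: "eventually (\<lambda>y. exp (- (1 / y)) / y ^ k = flat k y) (nhds x)"
      unfolding eventually_nhds by (rule exI[of _ "{0<..}"]) (use 2 in \<open>auto simp: flat_def\<close>)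
    show ?thesis by (rule iffD1[OF DERIV_cong_ev[OF refl ev refl] d])
  next
    case 3
    have "((\<lambda>h. (flat k (0 + h) - flat k 0) / h) \<longlongrightarrow> 0) (at 0)"
    proof (rule tendsto_cong[THEN iffD1, OF _ flat_tendsto_zero[of "Suc k"]])
      show "\<forall>\<^sub>F x in at 0. flat (Suc k) x = (flat k (0 + x) - flat k 0) / x"
        by (auto simp: eventually_at_filter flat_def)
    qed
    then show ?thesis using 3 by (simp add: DERIV_def flat_def)
  qed
qed

text \<open>A linear class that contains the bump exp(-1/x) exp(-1/(1 - x)) on (0, 1), the case j =
  k = 0, together with all its derivatives. This is the kind of class \<open>smoothI_closed\<close>
  asks for, and no product rule of higher order is involved.\<close>

inductive bump_span :: "(real \<Rightarrow> complex) \<Rightarrow> bool" where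
  base: "bump_span (\<lambda>x. of_real (flat j x * flat k (1 - x)))"
| lin: "bump_span f \<Longrightarrow> bump_span g \<Longrightarrow> bump_span (\<lambda>x. c * f x + d * g x)"

lemma bump_span_derivative:
  "bump_span f \<Longrightarrow> \<exists>g. bump_span g \<and> (\<forall>x. (f has_vector_derivative g x) (at x))"
proof (induction rule: bump_span.induct)
  case (base j k)
  define b where "b = (\<lambda>j k x. complex_of_real (flat j x * flat k (1 - x)))"
  define g where "g = (\<lambda>x. 1 * (1 * b (j + 2) k x + (- of_nat j) * b (j + 1) k x) +
      1 * ((-1) * b j (k + 2) x + of_nat k * b j (k + 1) x))"
  have "bump_span g" unfolding g_def b_def by (intro bump_span.intros)
  moreover have "((\<lambda>x. complex_of_real (flat j x * flat k (1 - x))) has_vector_derivative g x) (at x)" for x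
  proof -
    have "((\<lambda>x. 1 - x) has_real_derivative -1) (at x)" by (auto intro!: derivative_eq_intros)
    from DERIV_chain2[OF flat_has_derivative this]
    have "((\<lambda>x. flat k (1 - x)) has_real_derivative - (flat (k + 2) (1 - x) - real k * flat (k + 1) (1 - x))) (at x)"
      by simp
    from DERIV_mult[OF flat_has_derivative this]
    have "((\<lambda>x. flat j x * flat k (1 - x)) has_real_derivative
        (flat (j + 2) x - real j * flat (j + 1) x) * flat k (1 - x)
        + - (flat (k + 2) (1 - x) - real k * flat (k + 1) (1 - x)) * flat j x) (at x)" .
    from has_vector_derivative_of_real[OF this] show ?thesis
      by (simp add: g_def b_def algebra_simps)
  qed
  ultimately show ?case by blast
next
  case (lin f g c d)
  then obtain f' g' where "bump_span f'" "\<And>x. (f has_vector_derivative f' x) (at x)"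
    "bump_span g'" "\<And>x. (g has_vector_derivative g' x) (at x)" by blast
  then show ?case
    by (intro exI[of _ "\<lambda>x. c * f' x + d * g' x"] conjI bump_span.lin allI
        has_vector_derivative_add has_vector_derivative_mult_right)
qed

lemma bump_span_smooth: "bump_span f \<Longrightarrow> smooth f"
  by (rule smoothI_closed[of f "{f. bump_span f}"]) (use bump_span_derivative in auto)

text \<open>For x < 0 the interval \<open>{0..x}\<close> is empty and its integral 0, which is still
  a primitive because f vanishes there. Starting the integral at some a further left makes x an
  interior point.\<close>

lemma primitive_from_zero:
  fixes f :: "real \<Rightarrow> real"
  assumes f: "continuous_on UNIV f" and f0: "\<And>x. x \<le> 0 \<Longrightarrow> f x = 0"
  shows "((\<lambda>x. integral {0..x} f) has_vector_derivative f x) (at x)"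
proof -
  define a where "a = min (-1) (x - 1)"
  define b where "b = max 1 (x + 1)"
  have ab: "a < x" "x < b" "a \<le> 0" by (auto simp: a_def b_def)
  have eq: "integral {0..y} f = integral {a..y} f" for y
  proof (cases "y \<le> 0")
    case True
    then have "integral {a..y} f = integral {a..y} (\<lambda>x. 0)" by (intro integral_cong f0) auto
    moreover have "integral {0..y} f = 0"
      using True f0[of 0] by (cases "y = 0") auto
    ultimately show ?thesis by simp
  next
    case False
    have "integral {a..0} f + integral {0..y} f = integral {a..y} f"
      using False ab by (intro Henstock_Kurzweil_Integration.integral_combine
          integrable_continuous_interval continuous_on_subset[OF f]) auto
    moreover have "integral {a..0} f = integral {a..0} (\<lambda>x. 0)" by (intro integral_cong f0) auto
    ultimately show ?thesis by simp
  qed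
  have "((\<lambda>u. integral {a..u} f) has_vector_derivative f x) (at x within {a..b})"
    by (rule integral_has_vector_derivative) (use ab in \<open>auto intro: continuous_on_subset[OF f]\<close>)
  moreover have "at x within {a..b} = at x" using ab by (intro at_within_interior) auto
  ultimately show ?thesis unfolding eq by simp
qed

text \<open>\<theta> is the normalised integral of the bump and \<Theta> a primitive of \<theta>.
  Differences of shifted and scaled copies of \<theta> approximate indicators of intervals; the same
  differences of \<Theta> are their primitives, from which test functions are assembled.\<close>

lemma smooth_step_exists:
  obtains \<theta> \<Theta> :: "real \<Rightarrow> real" where "smooth (\<lambda>x. of_real (\<Theta> x))" "\<And>x. (\<Theta> has_vector_derivative \<theta> x) (at x)"
    "\<And>x. x \<le> 0 \<Longrightarrow> \<theta> x = 0" "\<And>x. x \<ge> 1 \<Longrightarrow> \<theta> x = 1" "\<And>x. 0 \<le> \<theta> x \<and> \<theta> x \<le> 1" "\<And>x. x \<le> 0 \<Longrightarrow> \<Theta> x = 0"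
    "continuous_on UNIV \<theta>"
proof -
  define b where "b = (\<lambda>x. flat 0 x * flat 0 (1 - x))"
  have b0: "b x = 0" if "x \<le> 0 \<or> x \<ge> 1" for x using that by (auto simp: b_def flat_def)
  have bpos: "b x \<ge> 0" for x by (auto simp: b_def flat_def)
  have cflat: "continuous_on A (flat 0)" for A
    using flat_has_derivative by (intro DERIV_continuous_on) (auto intro: has_field_derivative_at_within)
  have cb: "continuous_on A b" for A
    unfolding b_def by (intro continuous_intros continuous_on_compose2[OF cflat[of UNIV]]) auto
  have bi: "b integrable_on {s..t}" for s t by (intro integrable_continuous_interval cb)
  define I where "I = integral {0..1} b"
  have I: "I > 0"
  proof (rule ccontr)
    assume "\<not> I > 0"
    moreover have "I \<ge> 0" unfolding I_def by (rule integral_nonneg[OF bi bpos])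
    ultimately have "(b has_integral 0) (cbox 0 1)"
      using integrable_integral[OF bi[of 0 1]] by (simp add: I_def)
    then have "b (1/2) = 0" using has_integral_0_cbox_imp_0[of 0 1 b "1/2"] cb bpos by auto
    then show False by (simp add: b_def flat_def)
  qed
  define \<theta> where "\<theta> = (\<lambda>x. integral {0..x} b / I)"
  have d\<theta>: "(\<theta> has_vector_derivative b x / I) (at x)" for x
    using has_vector_derivative_mult_right[OF primitive_from_zero[OF cb, of x], of "1 / I"] b0
    by (simp add: \<theta>_def)
  have \<theta>0: "\<theta> x = 0" if "x \<le> 0" for x
    using that by (cases "x = 0") (auto simp: \<theta>_def)
  have \<theta>1: "\<theta> x = 1" if "x \<ge> 1" for x
  proof -
    have "integral {0..1} b + integral {1..x} b = integral {0..x} b"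
      using that by (intro Henstock_Kurzweil_Integration.integral_combine bi) auto
    moreover have "integral {1..x} b = integral {1..x} (\<lambda>x. 0)" by (intro integral_cong b0) auto
    ultimately show ?thesis using I by (simp add: \<theta>_def I_def)
  qed
  have \<theta>01: "0 \<le> \<theta> x \<and> \<theta> x \<le> 1" for x
  proof
    show "0 \<le> \<theta> x" unfolding \<theta>_def using I by (intro divide_nonneg_pos integral_nonneg bi bpos) auto
    show "\<theta> x \<le> 1"
    proof (cases "x \<le> 1")
      case True
      have "integral {0..x} b \<le> I" unfolding I_def by (rule integral_subset_le) (use True bi bpos in auto)
      then show ?thesis using I by (simp add: \<theta>_def)
    qed (simp add: \<theta>1)
  qed
  have c\<theta>: "continuous_on UNIV \<theta>"
    using d\<theta> by (intro continuous_at_imp_continuous_on) (auto intro: has_vector_derivative_continuous)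
  define \<Theta> where "\<Theta> = (\<lambda>x. integral {0..x} \<theta>)"
  have d\<Theta>: "(\<Theta> has_vector_derivative \<theta> x) (at x)" for x
    unfolding \<Theta>_def by (rule primitive_from_zero[OF c\<theta> \<theta>0])
  have \<Theta>0: "\<Theta> x = 0" if "x \<le> 0" for x
    using that by (cases "x = 0") (auto simp: \<Theta>_def)
  have sb: "smooth (\<lambda>x. complex_of_real (b x))"
    unfolding b_def by (intro bump_span_smooth bump_span.base)
  have "smooth (\<lambda>x. complex_of_real (b x / I))"
    using smooth_combination[OF sb sb, of "1 / of_real I" 0] by simp
  then have "smooth (\<lambda>x. complex_of_real (\<theta> x))"
    by (rule smooth_primitive)
      (intro has_vector_derivative_of_real d\<theta>[folded has_real_derivative_iff_has_vector_derivative])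
  then have "smooth (\<lambda>x. complex_of_real (\<Theta> x))"
    by (rule smooth_primitive)
      (intro has_vector_derivative_of_real d\<Theta>[folded has_real_derivative_iff_has_vector_derivative])
  then show thesis by (rule that[OF _ d\<Theta> \<theta>0 \<theta>1 \<theta>01 \<Theta>0 c\<theta>])
qed

section \<open>Test functions and distributional derivatives\<close>

lemma test_functions_mono: "a \<le> c \<Longrightarrow> d \<le> b \<Longrightarrow> test_functions c d \<subseteq> test_functions a b"
  unfolding test_functions_def by auto

text \<open>A point outside (a, b) lies in the open complement of the closed support, where \<phi>
  is locally zero; hence the derivative vanishes there as well.\<close>

lemma test_functionD:
  assumes "\<phi> \<in> test_functions a b"
  shows "(\<phi> has_vector_derivative vector_derivative \<phi> (at x)) (at x)"
    and "continuous_on A (\<lambda>x. vector_derivative \<phi> (at x))"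
    and "x \<notin> {a<..<b} \<Longrightarrow> \<phi> x = 0" and "x \<notin> {a<..<b} \<Longrightarrow> vector_derivative \<phi> (at x) = 0"
proof -
  have sm: "smooth \<phi>" and sub: "closure {x. \<phi> x \<noteq> 0} \<subseteq> {a<..<b}"
    using assms by (auto simp: test_functions_def)
  show "(\<phi> has_vector_derivative vector_derivative \<phi> (at x)) (at x)" by (rule smoothD(2)[OF sm])
  show "continuous_on A (\<lambda>x. vector_derivative \<phi> (at x))"
    using smoothD(2)[OF smoothD(1)[OF sm]]
    by (intro continuous_at_imp_continuous_on) (auto intro: has_vector_derivative_continuous)
  show "\<phi> x = 0" if "x \<notin> {a<..<b}"
    using that sub closure_subset[of "{x. \<phi> x \<noteq> 0}"] by auto
  show "vector_derivative \<phi> (at x) = 0" if x: "x \<notin> {a<..<b}"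
  proof (rule vector_derivative_at)
    show "(\<phi> has_vector_derivative 0) (at x)"
    proof (rule has_vector_derivative_transform_within_open[of "\<lambda>_. 0" _ _ "- closure {x. \<phi> x \<noteq> 0}"])
      show "0 = \<phi> y" if "y \<in> - closure {x. \<phi> x \<noteq> 0}" for y
        using that closure_subset[of "{x. \<phi> x \<noteq> 0}"] by auto
    qed (use x sub in auto)
  qed
qed

lemma lebesgue_on_integral_eq:
  fixes f :: "real \<Rightarrow> complex"
  assumes "f absolutely_integrable_on {a..b}"
  shows "integral\<^sup>L (lebesgue_on {a<..<b}) f = integral {a..b} f"
proof -
  have "f absolutely_integrable_on {a<..<b}" using assms by (simp add: absolutely_integrable_on_open_ivl)
  then have "integrable (lebesgue_on {a<..<b}) f" by (rule absolutely_integrable_imp_integrable) auto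
  then have "integral\<^sup>L (lebesgue_on {a<..<b}) f = integral {a<..<b} f"
    by (rule lebesgue_integral_eq_integral) auto
  then show ?thesis by (simp add: integral_open_interval_real)
qed

lemma distribution_deriv_eq_integral:
  assumes \<sigma>: "\<sigma> \<in> L2 a b" and \<phi>: "\<phi> \<in> test_functions a b"
  shows "distribution_deriv a b \<sigma> \<phi> = - integral {a..b} (\<lambda>x. \<sigma> x * vector_derivative \<phi> (at x))"
  unfolding distribution_deriv_def
  by (subst lebesgue_on_integral_eq)
    (use \<sigma> in \<open>auto intro!: absolutely_integrable_mult_continuous test_functionD[OF \<phi>] simp: L2_iff\<close>)

text \<open>\<phi> vanishes at both ends, so its derivative integrates to zero against a
  constant.\<close>

lemma distribution_deriv_add_const:
  assumes \<sigma>: "\<sigma> \<in> L2 a b" and \<phi>: "\<phi> \<in> test_functions a b" and ab: "a \<le> b"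
  shows "distribution_deriv a b (\<lambda>x. \<sigma> x + k) \<phi> = distribution_deriv a b \<sigma> \<phi>"
proof -
  let ?d = "\<lambda>x. vector_derivative \<phi> (at x)"
  have "(?d has_integral \<phi> b - \<phi> a) {a..b}"
    using test_functionD(1)[OF \<phi>] ab
    by (intro fundamental_theorem_of_calculus) (auto intro: has_vector_derivative_at_within)
  then have I: "((\<lambda>x. k * ?d x) has_integral 0) {a..b}"
    using has_integral_mult_right[of ?d 0 "{a..b}" k] test_functionD(3)[OF \<phi>] by simp
  have i: "(\<lambda>x. \<sigma> x * ?d x) integrable_on {a..b}"
    using absolutely_integrable_mult_continuous[where f=\<sigma> and a=a and b=b and g="?d"] \<sigma> test_functionD(2)[OF \<phi>]
    by (simp add: L2_iff absolutely_integrable_on_def)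
  have "integral {a..b} (\<lambda>x. (\<sigma> x + k) * ?d x) = integral {a..b} (\<lambda>x. \<sigma> x * ?d x + k * ?d x)"
    by (simp add: distrib_right)
  also have "\<dots> = integral {a..b} (\<lambda>x. \<sigma> x * ?d x) + integral {a..b} (\<lambda>x. k * ?d x)"
    using I by (intro integral_add i) blast
  finally show ?thesis
    using integral_unique[OF I] L2_add_const[OF \<sigma>] \<sigma> \<phi> by (simp add: distribution_deriv_eq_integral)
qed

text \<open>Derivatives of test functions have mean zero, and they can approximate (t0 - s0) times
  the indicator of (s, t] minus (t - s) times that of (s0, t0]. In the limit g has the same mean k
  on all intervals inside (a, b). Then the primitive of g - k is constant, and differentiating it
  almost everywhere gives g = k.\<close>

theorem du_Bois_Reymond:
  fixes g :: "real \<Rightarrow> complex"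
  assumes g: "g absolutely_integrable_on {a..b}" and ab: "a < b"
    and orth: "\<And>\<phi>. \<phi> \<in> test_functions a b \<Longrightarrow> integral {a..b} (\<lambda>x. g x * vector_derivative \<phi> (at x)) = 0"
  obtains k where "AE x in lebesgue_on {a<..<b}. g x = k"
proof -
  obtain \<theta> \<Theta> :: "real \<Rightarrow> real" where sm: "smooth (\<lambda>x. of_real (\<Theta> x))"
    and d\<Theta>: "\<And>x. (\<Theta> has_vector_derivative \<theta> x) (at x)"
    and \<theta>0: "\<And>x. x \<le> 0 \<Longrightarrow> \<theta> x = 0" and \<theta>1: "\<And>x. x \<ge> 1 \<Longrightarrow> \<theta> x = 1"
    and \<theta>01: "\<And>x. 0 \<le> \<theta> x \<and> \<theta> x \<le> 1" and \<Theta>0: "\<And>x. x \<le> 0 \<Longrightarrow> \<Theta> x = 0"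
    and c\<theta>: "continuous_on UNIV \<theta>"
    by (rule smooth_step_exists) (rule that)
  have gi: "g integrable_on {s..t}" if "a \<le> s" "t \<le> b" for s t
  proof -
    have "g integrable_on {a..b}" using g by (simp add: absolutely_integrable_on_def)
    then show ?thesis by (rule integrable_on_subinterval) (use that in auto)
  qed
  have \<Theta>lin: "\<Theta> x - \<Theta> y = x - y" if "x \<ge> 1" "y \<ge> 1" for x y
  proof -
    have *: "\<Theta> x - \<Theta> y = x - y" if "1 \<le> y" "y \<le> x" for x y
    proof -
      have "(\<theta> has_integral \<Theta> x - \<Theta> y) {y..x}"
        using d\<Theta> that by (intro fundamental_theorem_of_calculus) (auto intro: has_vector_derivative_at_within)
      then have "((\<lambda>x. 1) has_integral \<Theta> x - \<Theta> y) {y..x}"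
        by (rule has_integral_eq[rotated]) (use that \<theta>1 in auto)
      moreover have "((\<lambda>x. 1::real) has_integral (x - y)) {y..x}"
        using has_integral_const_real[of "1::real" y x] that by simp
      ultimately show ?thesis by (rule has_integral_unique)
    qed
    show ?thesis using *[of x y] *[of y x] that by (cases "y \<le> x") auto
  qed
  \<comment> \<open>\<open>w n s t\<close> tends to the indicator of (s, t], and
    \<open>\<Psi> n s t\<close> is its primitive that is 0 to the left of s and equals t - s to the
    right of t + 1/n.\<close>
  define w where "w = (\<lambda>n s t x. \<theta> (real n * (x - s)) - \<theta> (real n * (x - t)))"
  define \<Psi> where "\<Psi> = (\<lambda>n s t x. (\<Theta> (real n * (x - s)) - \<Theta> (real n * (x - t))) / real n)"
  have d\<Psi>: "(\<Psi> n s t has_vector_derivative w n s t x) (at x)" if "n > 0" for n s t x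
  proof -
    have *: "((\<lambda>x. \<Theta> (real n * (x - s))) has_vector_derivative real n * \<theta> (real n * (x - s))) (at x)" for s
    proof -
      have "((\<lambda>x. real n * (x - s)) has_vector_derivative real n) (at x)"
        by (auto intro!: derivative_eq_intros simp flip: has_real_derivative_iff_has_vector_derivative)
      from vector_diff_chain_at[OF this d\<Theta>] show ?thesis by (simp add: o_def)
    qed
    show ?thesis
      using has_vector_derivative_mult_right[OF has_vector_derivative_diff[OF *[of s] *[of t]], of "1 / real n"] that
      unfolding \<Psi>_def w_def by (simp add: diff_divide_distrib)
  qed
  have sm\<Psi>: "smooth (\<lambda>x. complex_of_real (\<Psi> n s t x))" for n s t
  proof -
    have 1: "smooth (\<lambda>x. 1 * complex_of_real (\<Theta> (real n * x + - (real n * s))))" for s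
      using smooth_affine[OF sm] by blast
    show ?thesis
      using smooth_combination[OF 1[of s] 1[of t], of "1 / of_nat n" "- (1 / of_nat n)"]
      by (simp add: \<Psi>_def diff_divide_distrib right_diff_distrib)
  qed
  have wlim: "(\<lambda>n. w n s t x) \<longlonglongrightarrow> (if s < x \<and> x \<le> t then 1 else 0)" if "s < t" for s t x
  proof -
    have *: "(\<lambda>n. \<theta> (real n * (x - s))) \<longlonglongrightarrow> (if s < x then 1 else 0)" for s
    proof (cases "s < x")
      case True
      have "eventually (\<lambda>n. real n \<ge> 1 / (x - s)) sequentially"
        using eventually_ge_at_top[of "nat \<lceil>1 / (x - s)\<rceil>"] by eventually_elim linarith
      then have "eventually (\<lambda>n. \<theta> (real n * (x - s)) = 1) sequentially"
        by eventually_elim (use True in \<open>auto intro!: \<theta>1 simp: field_simps\<close>)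
      then show ?thesis using True by (auto intro: tendsto_eventually)
    next
      case False
      then have "\<theta> (real n * (x - s)) = 0" for n by (intro \<theta>0 mult_nonneg_nonpos) auto
      then show ?thesis using False by simp
    qed
    show ?thesis unfolding w_def using tendsto_diff[OF *[of s] *[of t]] that by (auto split: if_splits)
  qed
  have wb: "\<bar>w n s t x\<bar> \<le> 1" for n s t x
    using \<theta>01[of "real n * (x - s)"] \<theta>01[of "real n * (x - t)"] by (auto simp: w_def)
  have cw: "continuous_on A (w n s t)" for n s t A
    unfolding w_def by (intro continuous_intros continuous_on_compose2[OF c\<theta>]) auto
  have igw: "(\<lambda>x. g x * of_real (w n s t x)) integrable_on {a..b}" for n s t
    using absolutely_integrable_mult_continuous[OF g, of "\<lambda>x. of_real (w n s t x)"] cw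
    by (auto simp: absolutely_integrable_on_def intro!: continuous_intros)
  have limI: "(\<lambda>n. integral {a..b} (\<lambda>x. g x * of_real (w n s t x))) \<longlonglongrightarrow> integral {s..t} g"
    if st: "a < s" "s < t" "t < b" for s t
  proof -
    define h where "h = (\<lambda>x. g x * of_real (if s < x \<and> x \<le> t then 1 else 0))"
    have "(\<lambda>n. integral {a..b} (\<lambda>x. g x * of_real (w n s t x))) \<longlonglongrightarrow> integral {a..b} h"
    proof (rule dominated_convergence(2)[OF igw])
      show "(\<lambda>x. cmod (g x)) integrable_on {a..b}" using g by (simp add: absolutely_integrable_on_def)
      show "norm (g x * of_real (w n s t x)) \<le> cmod (g x)" for n x
        using wb[of n s t x] by (simp add: norm_mult mult_left_le)
      show "(\<lambda>n. g x * of_real (w n s t x)) \<longlonglongrightarrow> h x" for x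
        unfolding h_def by (intro tendsto_mult tendsto_const tendsto_of_real wlim st)
    qed
    also have "integral {a..b} h = integral {a..b} (\<lambda>x. if x \<in> {s..t} then g x else 0)"
      by (rule integral_spike[of "{s}"]) (auto simp: h_def)
    also have "\<dots> = integral {s..t} g"
    proof -
      have "{s..t} \<inter> {a..b} = {s..t}" using st by auto
      then show ?thesis by (simp only: integral_restrict_Int)
    qed
    finally show ?thesis .
  qed
  have ratio: "of_real (t0 - s0) * integral {s..t} g = of_real (t - s) * integral {s0..t0} g"
    if st: "a < s" "s < t" "t < b" and st0: "a < s0" "s0 < t0" "t0 < b" for s t s0 t0
  proof -
    define m where "m = max t t0"
    have m: "m < b" "t \<le> m" "t0 \<le> m" using st st0 by (auto simp: m_def)
    \<comment> \<open>Ensures 1/n < b - m, so that the transition layers behind t and t0 end before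
      b.\<close>
    define N where "N = nat \<lceil>2 / (b - m)\<rceil> + 1"
    have zero: "of_real (t0 - s0) * integral {a..b} (\<lambda>x. g x * of_real (w n s t x)) -
        of_real (t - s) * integral {a..b} (\<lambda>x. g x * of_real (w n s0 t0 x)) = 0" if n: "n \<ge> N" for n
    proof -
      have n0: "n > 0" using n by (simp add: N_def)
      have "real n \<ge> 2 / (b - m)" using n unfolding N_def by linarith
      then have inv: "1 / real n < b - m" using m n0 by (simp add: field_simps)
      \<comment> \<open>The weights make the two constants to the right of m + 1/n cancel, as (t0 -
        s0)(t - s) = (t - s)(t0 - s0); so the support is compact in (a, b).\<close>
      define \<phi> where "\<phi> = (\<lambda>x. of_real (t0 - s0) * complex_of_real (\<Psi> n s t x) + - of_real (t - s) * of_real (\<Psi> n s0 t0 x))"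
      have d\<phi>: "(\<phi> has_vector_derivative (of_real (t0 - s0) * of_real (w n s t x) + - of_real (t - s) * of_real (w n s0 t0 x))) (at x)" for x
        unfolding \<phi>_def
        by (intro has_vector_derivative_add has_vector_derivative_mult_right has_vector_derivative_of_real
            d\<Psi>[folded has_real_derivative_iff_has_vector_derivative] n0)
      have \<Psi>lo: "\<Psi> n s t x = 0" if "x \<le> s" "s < t" for s t x
        using that n0 \<Theta>0[of "real n * (x - s)"] \<Theta>0[of "real n * (x - t)"]
        by (simp add: \<Psi>_def mult_nonneg_nonpos)
      have \<Psi>hi: "\<Psi> n s t x = t - s" if "x \<ge> t + 1 / real n" "s < t" for s t x
      proof -
        have "real n * (x - t) \<ge> 1" using that(1) n0 by (simp add: field_simps)
        moreover have "real n * (x - s) \<ge> real n * (x - t)" using that n0 by (intro mult_left_mono) auto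
        ultimately have "\<Theta> (real n * (x - s)) - \<Theta> (real n * (x - t)) = real n * (x - s) - real n * (x - t)"
          by (intro \<Theta>lin) auto
        then show ?thesis using n0 by (simp add: \<Psi>_def field_simps)
      qed
      have "\<phi> \<in> test_functions a b"
        unfolding test_functions_def
      proof (intro CollectI conjI)
        show "smooth \<phi>" unfolding \<phi>_def by (intro smooth_combination sm\<Psi>)
        have "{x. \<phi> x \<noteq> 0} \<subseteq> {min s s0..m + 1 / real n}"
        proof (rule subsetI, rule ccontr)
          fix x assume x: "x \<in> {x. \<phi> x \<noteq> 0}" "x \<notin> {min s s0..m + 1 / real n}"
          then consider "x < min s s0" | "x > m + 1 / real n" by fastforce
          then have "\<phi> x = 0"
          proof cases
            case 1
            then show ?thesis using \<Psi>lo[of x s t] \<Psi>lo[of x s0 t0] st st0 by (simp add: \<phi>_def)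
          next
            case 2
            then have "\<Psi> n s t x = t - s" "\<Psi> n s0 t0 x = t0 - s0" using \<Psi>hi m st st0 by auto
            then show ?thesis unfolding \<phi>_def by (simp only:) (simp add: algebra_simps)
          qed
          then show False using x by simp
        qed
        then have "closure {x. \<phi> x \<noteq> 0} \<subseteq> {min s s0..m + 1 / real n}" by (rule closure_minimal) simp
        also have "\<dots> \<subseteq> {a<..<b}" using st st0 inv by auto
        finally show "closure {x. \<phi> x \<noteq> 0} \<subseteq> {a<..<b}" .
      qed
      from orth[OF this] have "integral {a..b} (\<lambda>x. of_real (t0 - s0) * (g x * of_real (w n s t x)) -
          of_real (t - s) * (g x * of_real (w n s0 t0 x))) = 0"
        by (simp add: vector_derivative_at[OF d\<phi>] algebra_simps)
      then show ?thesis
        by (subst (asm) integral_diff) (auto intro!: integrable_on_mult_right igw)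
    qed
    have "(\<lambda>n. of_real (t0 - s0) * integral {a..b} (\<lambda>x. g x * of_real (w n s t x)) -
        of_real (t - s) * integral {a..b} (\<lambda>x. g x * of_real (w n s0 t0 x)))
        \<longlonglongrightarrow> of_real (t0 - s0) * integral {s..t} g - of_real (t - s) * integral {s0..t0} g"
      by (intro tendsto_diff tendsto_mult tendsto_const limI st st0)
    moreover have "eventually (\<lambda>n. of_real (t0 - s0) * integral {a..b} (\<lambda>x. g x * of_real (w n s t x)) -
        of_real (t - s) * integral {a..b} (\<lambda>x. g x * of_real (w n s0 t0 x)) = 0) sequentially"
      using eventually_ge_at_top[of N] by eventually_elim (rule zero)
    then have "(\<lambda>n. of_real (t0 - s0) * integral {a..b} (\<lambda>x. g x * of_real (w n s t x)) -
        of_real (t - s) * integral {a..b} (\<lambda>x. g x * of_real (w n s0 t0 x))) \<longlonglongrightarrow> 0"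
      by (rule tendsto_eventually)
    ultimately have "of_real (t0 - s0) * integral {s..t} g - of_real (t - s) * integral {s0..t0} g = 0"
      by (rule LIMSEQ_unique)
    then show ?thesis by simp
  qed
  \<comment> \<open>A fixed reference interval strictly inside (a, b), whose mean becomes k.\<close>
  define s0 where "s0 = (2 * a + b) / 3"
  define t0 where "t0 = (a + 2 * b) / 3"
  have st0: "a < s0" "s0 < t0" "t0 < b" using ab by (auto simp: s0_def t0_def)
  define k where "k = integral {s0..t0} g / of_real (t0 - s0)"
  have mean: "integral {s..t} g = of_real (t - s) * k" if "a < s" "s < t" "t < b" for s t
    using ratio[OF that st0] st0 by (simp add: k_def field_simps)
  have gk: "(\<lambda>x. g x - k) absolutely_integrable_on {a..b}"
    using g absolutely_integrable_continuous_real[of a b "\<lambda>_. k"] by (intro set_integral_diff) auto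
  define F where "F = (\<lambda>x. integral {a..x} (\<lambda>x. g x - k))"
  have dF: "has_AC_derivative F (\<lambda>x. g x - k) a b"
    unfolding F_def by (rule indefinite_integral_has_AC_derivative[OF gk])
  have F: "F t = F s" if st: "a < s" "s < t" "t < b" for s t
  proof -
    have gki: "(\<lambda>x. g x - k) integrable_on {u..v}" if "a \<le> u" "v \<le> b" for u v
      by (intro integrable_diff gi that) auto
    have "F s + integral {s..t} (\<lambda>x. g x - k) = F t"
      unfolding F_def using st by (intro Henstock_Kurzweil_Integration.integral_combine gki) auto
    moreover have "integral {s..t} (\<lambda>x. g x - k) = integral {s..t} g - integral {s..t} (\<lambda>x. k)"
      using st by (intro integral_diff gi) auto
    ultimately show ?thesis using mean[OF st] st by (simp add: scaleR_conv_of_real)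
  qed
  obtain m where m: "a < m" "m < b" using dense[OF ab] by blast
  have Fm: "F x = F m" if "x \<in> {a<..<b}" for x
  proof -
    have x: "a < x" "x < b" using that by auto
    consider "x < m" | "x = m" | "m < x" by linarith
    then show ?thesis
    proof cases
      case 1
      show ?thesis using F[OF x(1) 1 m(2)] by (rule sym)
    next
      case 3
      show ?thesis by (rule F[OF m(1) 3 x(2)])
    qed simp
  qed
  have "AE x in lebesgue_on {a<..<b}. (F has_vector_derivative g x - k) (at x)"
    using dF by (simp add: has_AC_derivative_def)
  with AE_space have "AE x in lebesgue_on {a<..<b}. g x = k"
  proof eventually_elim
    case (elim x)
    then have x: "x \<in> {a<..<b}" by simp
    have "(F has_vector_derivative 0) (at x)"
      by (rule has_vector_derivative_transform_within_open[of "\<lambda>_. F m" _ _ "{a<..<b}"])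
        (use x Fm in auto)
    then have "g x - k = 0" using vector_derivative_unique_at elim(2) by blast
    then show ?case by simp
  qed
  then show thesis by (rule that)
qed

section \<open>Uniqueness\<close>

text \<open>With the amplitudes a, b = y1 \<plusminus> \<i>\<lambda> y one has 2 \<i>\<lambda> y = a
  - b. At x = L > 0 the amplitude b is of the size exp(Im \<lambda> L), while a is smaller by a
  factor O(1/sqrt (Im \<lambda>)); this bounds \<lambda> y from both sides.\<close>

lemma S_bounds_upper_half:
  assumes \<sigma>: "\<sigma> \<in> L2 0 L" and p: "p \<in> L2 0 L" and L: "L > 0"
  obtains C c Q where "C \<ge> 0" "c > 0"
    "\<And>l y y1 x. \<lbrakk>dirichlet_solution \<sigma> p L l y y1; 1 \<le> cmod l; 0 \<le> Im l; x \<in> {0..L}\<rbrakk> \<Longrightarrow>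
      cmod (l * y x) \<le> C * exp (Im l * x)"
    "\<And>l y y1. \<lbrakk>dirichlet_solution \<sigma> p L l y y1; Q \<le> Im l\<rbrakk> \<Longrightarrow>
      c * exp (Im l * L) \<le> cmod (l * y L)"
    "\<And>e. e > 0 \<Longrightarrow> \<exists>X. \<forall>l y y1. dirichlet_solution \<sigma> p L l y y1 \<longrightarrow> X \<le> Im l \<longrightarrow>
      cmod (y1 L + \<i> * l * y L) \<le> e * exp (Im l * L)"
proof -
  obtain M K where M: "M > 0" "K \<ge> 0"
    "\<And>l y y1 x. \<lbrakk>dirichlet_solution \<sigma> p L l y y1; 1 \<le> cmod l; 0 \<le> Im l; x \<in> {0..L}\<rbrakk> \<Longrightarrow>
      cmod (y1 x + \<i> * l * y x) \<le> M * exp (Im l * x) \<and> cmod (y1 x - \<i> * l * y x) \<le> M * exp (Im l * x)"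
    "\<And>l y y1 x. \<lbrakk>dirichlet_solution \<sigma> p L l y y1; 1 \<le> Im l; x \<in> {0..L}\<rbrakk> \<Longrightarrow>
      cmod (y1 x + \<i> * l * y x) \<le> (M * exp (- (2 * Im l * x)) + K / sqrt (Im l)) * exp (Im l * x) \<and>
      (1 - K / sqrt (Im l)) * exp (Im l * x) \<le> M * cmod (y1 x - \<i> * l * y x)"
    by (rule amplitude_estimates[OF \<sigma> p less_imp_le[OF L]]) (rule that)
  have tw: "2 * cmod (l * y) = cmod ((y1 + \<i> * l * y) - (y1 - \<i> * l * y))" for l y y1 :: complex
  proof -
    have "(y1 + \<i> * l * y) - (y1 - \<i> * l * y) = 2 * \<i> * (l * y)" by simp
    then show ?thesis by (simp only: norm_mult) simp
  qed
  \<comment> \<open>For \<tau> \<ge> 1 one has exp(-2 \<tau> L) \<le> 1/(2 L sqrt \<tau>), so N/sqrt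
    \<tau> covers the decaying term along with K/sqrt \<tau>.\<close>
  define N where "N = M / (2 * L) + K"
  have N: "N \<ge> K" "N \<ge> 0" using M L by (auto simp: N_def)
  have decay: "M * exp (- (2 * \<tau> * L)) + K / sqrt \<tau> \<le> N / sqrt \<tau>" if \<tau>: "\<tau> \<ge> 1" for \<tau>
  proof -
    have "sqrt \<tau> \<le> \<tau>" using \<tau> by (simp add: real_le_lsqrt power2_eq_square)
    then have "2 * L * sqrt \<tau> \<le> 2 * \<tau> * L" using L by simp
    also have "\<dots> \<le> exp (2 * \<tau> * L)" using exp_ge_add_one_self[of "2 * \<tau> * L"] by linarith
    finally have "exp (- (2 * \<tau> * L)) \<le> 1 / (2 * L * sqrt \<tau>)"
      using L \<tau> by (simp add: exp_minus field_simps)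
    then have "M * exp (- (2 * \<tau> * L)) \<le> M * (1 / (2 * L * sqrt \<tau>))" using M by (intro mult_left_mono) auto
    then show ?thesis by (simp add: N_def add_divide_distrib)
  qed
  have small: "N / sqrt \<tau> \<le> e" if "\<tau> \<ge> (N / e)\<^sup>2" "e > 0" "\<tau> \<ge> 1" for \<tau> e
  proof -
    have "N / e \<le> sqrt \<tau>" using that N by (intro real_le_rsqrt) auto
    then show ?thesis using that by (simp add: field_simps)
  qed
  \<comment> \<open>Write E for exp(Im l L). With |a| \<le> E/(4 M) and |b| \<ge> E/(2 M), twice |l
    y| is at least E/(4 M); hence the constant 1/(8 M).\<close>
  define e0 where "e0 = min (1 / 2) (1 / (4 * M))"
  have e0: "e0 > 0" "e0 \<le> 1/2" "e0 \<le> 1 / (4 * M)" using M by (auto simp: e0_def)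
  show thesis
  proof (rule that[of M "1 / (8 * M)" "max 1 ((N / e0)\<^sup>2)"])
    fix l y y1 x
    assume *: "dirichlet_solution \<sigma> p L l y y1" "1 \<le> cmod l" "0 \<le> Im l" "x \<in> {0..L}"
    show "cmod (l * y x) \<le> M * exp (Im l * x)"
      using M(3)[OF *] tw[of l "y x" "y1 x"] norm_triangle_ineq4[of "y1 x + \<i> * l * y x" "y1 x - \<i> * l * y x"]
      by linarith
  next
    fix l y y1
    assume *: "dirichlet_solution \<sigma> p L l y y1" "max 1 ((N / e0)\<^sup>2) \<le> Im l"
    have l: "1 \<le> Im l" "(N / e0)\<^sup>2 \<le> Im l" using *(2) by auto
    define E where "E = exp (Im l * L)"
    have E: "E > 0" by (simp add: E_def)
    have Ns: "N / sqrt (Im l) \<le> e0" by (rule small[OF l(2) e0(1) l(1)])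
    have LL: "L \<in> {0..L}" using L by simp
    note m = M(4)[OF *(1) l(1) LL, folded E_def]
    have "cmod (y1 L + \<i> * l * y L) \<le> (N / sqrt (Im l)) * E"
      using m decay[OF l(1)] E by (intro order_trans[OF conjunct1[OF m]] mult_right_mono) auto
    also have "\<dots> \<le> 1 / (4 * M) * E" using Ns e0 E by (intro mult_right_mono) auto
    finally have a: "cmod (y1 L + \<i> * l * y L) \<le> 1 / (4 * M) * E" .
    have "K / sqrt (Im l) \<le> N / sqrt (Im l)" using N l by (intro divide_right_mono) auto
    then have "1 / 2 \<le> 1 - K / sqrt (Im l)" using Ns e0 by linarith
    then have "1 / 2 * E \<le> (1 - K / sqrt (Im l)) * E" using E by (intro mult_right_mono) auto
    then have "1 / 2 * E \<le> M * cmod (y1 L - \<i> * l * y L)" using m by linarith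
    then have b: "2 * (1 / (4 * M) * E) \<le> cmod (y1 L - \<i> * l * y L)" using M by (simp add: field_simps)
    have "cmod (y1 L - \<i> * l * y L) - cmod (y1 L + \<i> * l * y L) \<le> 2 * cmod (l * y L)"
      unfolding tw[of l "y L" "y1 L"] by (metis norm_minus_commute norm_triangle_ineq2)
    then have "1 / (4 * M) * E \<le> 2 * cmod (l * y L)" using a b by linarith
    then show "1 / (8 * M) * exp (Im l * L) \<le> cmod (l * y L)" by (simp add: E_def)
  next
    fix e :: real assume e: "e > 0"
    show "\<exists>X. \<forall>l y y1. dirichlet_solution \<sigma> p L l y y1 \<longrightarrow> X \<le> Im l \<longrightarrow>
      cmod (y1 L + \<i> * l * y L) \<le> e * exp (Im l * L)"
    proof (intro exI[of _ "max 1 ((N / e)\<^sup>2)"] allI impI)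
      fix l y y1
      assume *: "dirichlet_solution \<sigma> p L l y y1" "max 1 ((N / e)\<^sup>2) \<le> Im l"
      have l: "1 \<le> Im l" "(N / e)\<^sup>2 \<le> Im l" using *(2) by auto
      have LL: "L \<in> {0..L}" using L by simp
      have "M * exp (- (2 * Im l * L)) + K / sqrt (Im l) \<le> e"
        using decay[OF l(1)] small[OF l(2) e l(1)] by linarith
      then have "(M * exp (- (2 * Im l * L)) + K / sqrt (Im l)) * exp (Im l * L) \<le> e * exp (Im l * L)"
        by (intro mult_right_mono) auto
      then show "cmod (y1 L + \<i> * l * y L) \<le> e * exp (Im l * L)"
        using M(4)[OF *(1) l(1) LL] by linarith
    qed
  qed (use M in auto)
qed

text \<open>The lower half plane reduces to the upper one: the equation is invariant under
  \<open>(\<lambda>, p) \<mapsto> (- \<lambda>, - p)\<close>.\<close>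

theorem S_bounds:
  assumes \<sigma>: "\<sigma> \<in> L2 0 L" and p: "p \<in> L2 0 L" and L: "L > 0"
  obtains C c Q where "C \<ge> 0" "c > 0"
    "\<And>l y y1 x. \<lbrakk>dirichlet_solution \<sigma> p L l y y1; 1 \<le> cmod l; x \<in> {0..L}\<rbrakk> \<Longrightarrow>
      cmod (l * y x) \<le> C * exp (\<bar>Im l\<bar> * x)"
    "\<And>l y y1. \<lbrakk>dirichlet_solution \<sigma> p L l y y1; Q \<le> \<bar>Im l\<bar>\<rbrakk> \<Longrightarrow>
      c * exp (\<bar>Im l\<bar> * L) \<le> cmod (l * y L)"
    "\<And>e. e > 0 \<Longrightarrow> \<exists>X. \<forall>l y y1. dirichlet_solution \<sigma> p L l y y1 \<longrightarrow> X \<le> Im l \<longrightarrow>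
      cmod (y1 L + \<i> * l * y L) \<le> e * exp (Im l * L)"
proof -
  obtain C c Q where 1: "C \<ge> 0" "c > 0"
    "\<And>l y y1 x. \<lbrakk>dirichlet_solution \<sigma> p L l y y1; 1 \<le> cmod l; 0 \<le> Im l; x \<in> {0..L}\<rbrakk> \<Longrightarrow>
      cmod (l * y x) \<le> C * exp (Im l * x)"
    "\<And>l y y1. \<lbrakk>dirichlet_solution \<sigma> p L l y y1; Q \<le> Im l\<rbrakk> \<Longrightarrow>
      c * exp (Im l * L) \<le> cmod (l * y L)"
    "\<And>e. e > 0 \<Longrightarrow> \<exists>X. \<forall>l y y1. dirichlet_solution \<sigma> p L l y y1 \<longrightarrow> X \<le> Im l \<longrightarrow>
      cmod (y1 L + \<i> * l * y L) \<le> e * exp (Im l * L)"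
    by (rule S_bounds_upper_half[OF \<sigma> p L]) (rule that)
  obtain C' c' Q' where 2: "C' \<ge> 0" "c' > 0"
    "\<And>l y y1 x. \<lbrakk>dirichlet_solution \<sigma> (\<lambda>x. - p x) L l y y1; 1 \<le> cmod l; 0 \<le> Im l; x \<in> {0..L}\<rbrakk> \<Longrightarrow>
      cmod (l * y x) \<le> C' * exp (Im l * x)"
    "\<And>l y y1. \<lbrakk>dirichlet_solution \<sigma> (\<lambda>x. - p x) L l y y1; Q' \<le> Im l\<rbrakk> \<Longrightarrow>
      c' * exp (Im l * L) \<le> cmod (l * y L)"
    by (rule S_bounds_upper_half[OF \<sigma> L2_minus[OF p] L]) (rule that)
  show thesis
  proof (rule that[of "max C C'" "min c c'" "max (max Q Q') 1"])
    fix l y y1 x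
    assume *: "dirichlet_solution \<sigma> p L l y y1" "1 \<le> cmod l" "x \<in> {0..L}"
    have "cmod (l * y x) \<le> C * exp (\<bar>Im l\<bar> * x) \<or> cmod (l * y x) \<le> C' * exp (\<bar>Im l\<bar> * x)"
      using 1(3)[OF *(1,2) _ *(3)] 2(3)[OF dirichlet_solution_uminus[OF *(1)] _ _ *(3)] *(2)
      by (cases "Im l \<ge> 0") auto
    moreover have "C * exp (\<bar>Im l\<bar> * x) \<le> max C C' * exp (\<bar>Im l\<bar> * x)"
      "C' * exp (\<bar>Im l\<bar> * x) \<le> max C C' * exp (\<bar>Im l\<bar> * x)" by (intro mult_right_mono; simp)+
    ultimately show "cmod (l * y x) \<le> max C C' * exp (\<bar>Im l\<bar> * x)" by linarith
  next
    fix l y y1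
    assume *: "dirichlet_solution \<sigma> p L l y y1" "max (max Q Q') 1 \<le> \<bar>Im l\<bar>"
    have "c * exp (\<bar>Im l\<bar> * L) \<le> cmod (l * y L) \<or> c' * exp (\<bar>Im l\<bar> * L) \<le> cmod (l * y L)"
      using 1(4)[OF *(1)] 2(4)[OF dirichlet_solution_uminus[OF *(1)]] *(2)
      by (cases "Im l \<ge> 0") auto
    moreover have "min c c' * exp (\<bar>Im l\<bar> * L) \<le> c * exp (\<bar>Im l\<bar> * L)"
      "min c c' * exp (\<bar>Im l\<bar> * L) \<le> c' * exp (\<bar>Im l\<bar> * L)" by (intro mult_right_mono; simp)+
    ultimately show "min c c' * exp (\<bar>Im l\<bar> * L) \<le> cmod (l * y L)" by linarith
  qed (use 1 2 in auto)
qed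

text \<open>Let \<open>T\<close>, \<open>T'\<close> have the columns \<open>w, v\<close> and \<open>w', v'\<close>. Up to sign, \<open>w v' - v w'\<close> is the upper right entry of
  \<open>T T'\<^sup>-\<^sup>1\<close>, and \<open>P11\<close>, \<open>P22\<close>, \<open>P21\<close> below are the others.\<close>

lemma transfer_matrix_deriv:
  assumes w: "solves \<sigma> p l 0 L w w1" and v: "solves \<sigma> p l 0 L v v1"
    and w': "solves \<sigma>' p' l 0 L w' w1'" and v': "solves \<sigma>' p' l 0 L v' v1'" and L: "L > 0"
    and init: "v L = 0" "v1 L = -1" "w L = 1" "w1 L = 0" "v' L = 0" "v1' L = -1" "w' L = 1" "w1' L = 0"
    and E: "\<And>x. x \<in> {0..L} \<Longrightarrow> w x * v' x = v x * w' x"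
  shows "AE x in lebesgue_on {0<..<L}. w1 x * v1' x - v1 x * w1' x = \<sigma> x - \<sigma>' x"
    and "has_AC_derivative (\<lambda>x. w1 x * v1' x - v1 x * w1' x) (\<lambda>x. - 2 * l * (p x - p' x)) 0 L"
proof -
  define P11 where "P11 = (\<lambda>x. w x * v1' x - v x * w1' x)"
  define P22 where "P22 = (\<lambda>x. v1 x * w' x - w1 x * v' x)"
  define P21 where "P21 = (\<lambda>x. w1 x * v1' x - v1 x * w1' x)"
  note D = solvesD[OF w] solvesD[OF v] solvesD[OF w'] solvesD[OF v']
  have 0: "0 \<in> {0..L}" "L \<in> {0..L}" using L by auto
  have E': "w x * v' x = v x * w' x" if "x \<in> {0<..<L}" for x using E[of x] that by simp
  \<comment> \<open>Primes mark the second problem. Differentiating w v' - v w' = 0 leaves P11 -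
    P22: the terms with \<sigma> and \<sigma>' carry the factor w v' - v w' itself.\<close>
  have "has_AC_derivative (\<lambda>x. 0) (\<lambda>x. P11 x - P22 x) 0 L"
  proof (rule has_AC_derivative_cong[OF has_AC_derivative_diff[OF
          has_AC_derivative_mult[OF D(1) D(7)] has_AC_derivative_mult[OF D(3) D(5)]]])
    show "w x * v' x - v x * w' x = 0" if "x \<in> {0..L}" for x using E[OF that] by simp
    fix x assume "x \<in> {0<..<L}"
    from E'[OF this] show "w x * (\<sigma>' x * v' x + v1' x) + (\<sigma> x * w x + w1 x) * v' x
        - (v x * (\<sigma>' x * w' x + w1' x) + (\<sigma> x * v x + v1 x) * w' x) = P11 x - P22 x"
      unfolding P11_def P22_def by algebra
  qed
  from has_AC_derivative_unique_AE[OF this has_AC_derivative_const]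
  have "AE x in lebesgue_on {0<..<L}. P11 x = P22 x" by eventually_elim simp
  have cont: "continuous_on {0..L} w" "continuous_on {0..L} v" "continuous_on {0..L} w1" "continuous_on {0..L} v1"
    "continuous_on {0..L} w'" "continuous_on {0..L} v'" "continuous_on {0..L} w1'" "continuous_on {0..L} v1'"
    using D by (auto intro: has_AC_derivative_continuous_on)
  have cP: "continuous_on {0..L} P11" "continuous_on {0..L} P22"
    unfolding P11_def P22_def by (intro continuous_intros cont)+
  have eq: "P11 x = P22 x" if "x \<in> {0..L}" for x
    by (rule continuous_AE_eq[OF cP \<open>AE x in lebesgue_on {0<..<L}. P11 x = P22 x\<close> that L])
  \<comment> \<open>The determinant of the matrix product: both Wronskians are -1 by the data at L,
    and the product of the off-diagonal entries vanishes.\<close>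
  have sq: "P11 x * P11 x = 1" if x: "x \<in> {0..L}" for x
  proof -
    have "w x * v1 x - w1 x * v x = -1" using solves_wronskian_const[OF w v x 0(2)] init by simp
    moreover have "w' x * v1' x - w1' x * v' x = -1" using solves_wronskian_const[OF w' v' x 0(2)] init by simp
    ultimately have "(w x * v1 x - w1 x * v x) * (w' x * v1' x - w1' x * v' x) = 1" by simp
    moreover have "P11 x * P22 x + (w x * v' x - v x * w' x) * P21 x
        = (w x * v1 x - w1 x * v x) * (w' x * v1' x - w1' x * v' x)"
      by (simp add: P11_def P22_def P21_def algebra_simps)
    ultimately show ?thesis using E[OF x] eq[OF x] by simp
  qed
  \<comment> \<open>Only 1 and -1 are possible values, so continuity transports the value at L to
    the whole interval.\<close>
  have "P11 constant_on {0..L}"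
  proof (rule continuous_finite_range_constant[OF _ cP(1)])
    have "P11 x = 1 \<or> P11 x = -1" if "x \<in> {0..L}" for x
      using sq[OF that] by (simp add: square_eq_1_iff)
    then have "P11 ` {0..L} \<subseteq> {1, -1}" by blast
    then show "finite (P11 ` {0..L})" by (rule finite_subset) simp
  qed simp
  moreover have "P11 L = -1" using init by (simp add: P11_def)
  ultimately have P11: "P11 x = -1" if "x \<in> {0..L}" for x
    using that 0(2) unfolding constant_on_def by metis
  have P22: "P22 x = -1" if "x \<in> {0..L}" for x using eq[OF that] P11[OF that] by simp
  \<comment> \<open>The derivative of the constant P11 is -(\<sigma> - \<sigma>') + P21, which
    determines P21.\<close>
  have "has_AC_derivative (\<lambda>x. -1) (\<lambda>x. - (\<sigma> x - \<sigma>' x) + P21 x) 0 L"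
  proof (rule has_AC_derivative_cong[OF has_AC_derivative_diff[OF
          has_AC_derivative_mult[OF D(1) D(8)] has_AC_derivative_mult[OF D(3) D(6)]]])
    show "w x * v1' x - v x * w1' x = -1" if "x \<in> {0..L}" for x using P11[OF that] by (simp add: P11_def)
    fix x assume x: "x \<in> {0<..<L}"
    then have "w x * v1' x - v x * w1' x = -1" using P11[of x] by (simp add: P11_def)
    with E'[OF x]
    show "w x * (- \<sigma>' x * v1' x - (\<sigma>' x)\<^sup>2 * v' x + (2 * l * p' x - l\<^sup>2) * v' x) + (\<sigma> x * w x + w1 x) * v1' x
        - (v x * (- \<sigma>' x * w1' x - (\<sigma>' x)\<^sup>2 * w' x + (2 * l * p' x - l\<^sup>2) * w' x) + (\<sigma> x * v x + v1 x) * w1' x)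
        = - (\<sigma> x - \<sigma>' x) + P21 x"
      unfolding P21_def by algebra
  qed
  from has_AC_derivative_unique_AE[OF this has_AC_derivative_const]
  have P21: "AE x in lebesgue_on {0<..<L}. P21 x = \<sigma> x - \<sigma>' x" by eventually_elim (simp add: algebra_simps)
  then show "AE x in lebesgue_on {0<..<L}. w1 x * v1' x - v1 x * w1' x = \<sigma> x - \<sigma>' x" by (simp add: P21_def)
  \<comment> \<open>Once P21 = \<sigma> - \<sigma>' is inserted, the first term cancels the squares
    of \<sigma> and \<sigma>', l^2 drops out, and only the p-terms remain.\<close>
  have "has_AC_derivative P21 (\<lambda>x. - (\<sigma> x + \<sigma>' x) * P21 x
      - ((- (\<sigma> x)\<^sup>2 + (2 * l * p x - l\<^sup>2)) - (- (\<sigma>' x)\<^sup>2 + (2 * l * p' x - l\<^sup>2)))) 0 L"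
  proof (rule has_AC_derivative_cong[OF has_AC_derivative_diff[OF
          has_AC_derivative_mult[OF D(2) D(8)] has_AC_derivative_mult[OF D(4) D(6)]]])
    fix x assume x: "x \<in> {0<..<L}"
    then have "w x * v1' x - v x * w1' x = -1" "v1 x * w' x - w1 x * v' x = -1"
      using P11[of x] P22[of x] by (simp_all add: P11_def P22_def)
    then show "w1 x * (- \<sigma>' x * v1' x - (\<sigma>' x)\<^sup>2 * v' x + (2 * l * p' x - l\<^sup>2) * v' x)
          + (- \<sigma> x * w1 x - (\<sigma> x)\<^sup>2 * w x + (2 * l * p x - l\<^sup>2) * w x) * v1' x
        - (v1 x * (- \<sigma>' x * w1' x - (\<sigma>' x)\<^sup>2 * w' x + (2 * l * p' x - l\<^sup>2) * w' x)
          + (- \<sigma> x * v1 x - (\<sigma> x)\<^sup>2 * v x + (2 * l * p x - l\<^sup>2) * v x) * w1' x)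
        = - (\<sigma> x + \<sigma>' x) * P21 x
      - ((- (\<sigma> x)\<^sup>2 + (2 * l * p x - l\<^sup>2)) - (- (\<sigma>' x)\<^sup>2 + (2 * l * p' x - l\<^sup>2)))"
      unfolding P21_def by algebra
  qed (simp add: P21_def)
  then have "has_AC_derivative P21 (\<lambda>x. - 2 * l * (p x - p' x)) 0 L"
    by (rule has_AC_derivative_cong_AE)
      (use P21 in eventually_elim, simp only:, simp add: algebra_simps power2_eq_square)
  then show "has_AC_derivative (\<lambda>x. w1 x * v1' x - v1 x * w1' x) (\<lambda>x. - 2 * l * (p x - p' x)) 0 L"
    by (simp add: P21_def)
qed

text \<open>Let v, w and v', w' carry data at L, and let e = w v' - v w'. Expanding S and S' in
  them, proportional data at L give S v' - c v S' = S(L) e. On the left, growth over [0, x] and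
  growth over [x, L] multiply to exp(L |Im l|) whatever x is, and this matches the size of
  S(L).\<close>

theorem cauchy_data_determine_coefficients:
  assumes L2: "\<sigma> \<in> L2 0 L" "p \<in> L2 0 L" "\<sigma>' \<in> L2 0 L" "p' \<in> L2 0 L" and L: "L > 0"
    and S: "\<And>l. dirichlet_solution \<sigma> p L l (S l) (S1 l)"
    and S': "\<And>l. dirichlet_solution \<sigma>' p' L l (S' l) (S1' l)"
    and hol: "\<And>x. x \<in> {0..L} \<Longrightarrow> (\<lambda>l. S l x) holomorphic_on UNIV" "\<And>x. x \<in> {0..L} \<Longrightarrow> (\<lambda>l. S' l x) holomorphic_on UNIV"
    and data: "\<And>l. S l L = c * S' l L" "\<And>l. S1 l L = c * S1' l L"
  shows "AE x in lebesgue_on {0<..<L}. \<sigma> x = \<sigma>' x" "AE x in lebesgue_on {0<..<L}. p x = p' x"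
proof -
  have L0: "0 \<le> L" and LL: "L \<in> {0..L}" using L by auto
  have refl2: "(\<lambda>x. - \<sigma> (L - x)) \<in> L2 0 L" "(\<lambda>x. p (L - x)) \<in> L2 0 L"
    "(\<lambda>x. - \<sigma>' (L - x)) \<in> L2 0 L" "(\<lambda>x. p' (L - x)) \<in> L2 0 L"
    using L2_reflect[OF L2(1), of L] L2_reflect[OF L2(2), of L] L2_reflect[OF L2(3), of L] L2_reflect[OF L2(4), of L]
    by (auto intro: L2_minus)
  have unreflect: "solves \<sigma> p l 0 L (\<lambda>x. y (L - x)) (\<lambda>x. - y1 (L - x))"
    if "solves (\<lambda>x. - \<sigma> (L - x)) (\<lambda>x. p (L - x)) l 0 L y y1" for \<sigma> p l y y1
    using solves_reflect[OF that, of L] by simp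
  obtain V V1 where V: "\<And>l. dirichlet_solution (\<lambda>x. - \<sigma> (L - x)) (\<lambda>x. p (L - x)) L l (V l) (V1 l)"
    "\<And>x. x \<in> {0..L} \<Longrightarrow> (\<lambda>l. V l x) holomorphic_on UNIV"
    by (rule dirichlet_solution_exists[OF refl2(1,2) L0]) (rule that)
  obtain W W1 where W: "\<And>l. solves (\<lambda>x. - \<sigma> (L - x)) (\<lambda>x. p (L - x)) l 0 L (W l) (W1 l)" "\<And>l. W l 0 = 1" "\<And>l. W1 l 0 = 0"
    "\<And>x. x \<in> {0..L} \<Longrightarrow> (\<lambda>l. W l x) holomorphic_on UNIV"
    using solves_exists[OF refl2(1,2) L0, of 1 0] by metis
  obtain V' V1' where V': "\<And>l. dirichlet_solution (\<lambda>x. - \<sigma>' (L - x)) (\<lambda>x. p' (L - x)) L l (V' l) (V1' l)"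
    "\<And>x. x \<in> {0..L} \<Longrightarrow> (\<lambda>l. V' l x) holomorphic_on UNIV"
    by (rule dirichlet_solution_exists[OF refl2(3,4) L0]) (rule that)
  obtain W' W1' where W': "\<And>l. solves (\<lambda>x. - \<sigma>' (L - x)) (\<lambda>x. p' (L - x)) l 0 L (W' l) (W1' l)" "\<And>l. W' l 0 = 1" "\<And>l. W1' l 0 = 0"
    "\<And>x. x \<in> {0..L} \<Longrightarrow> (\<lambda>l. W' l x) holomorphic_on UNIV"
    using solves_exists[OF refl2(3,4) L0, of 1 0] by metis
  define v where "v = (\<lambda>l x. V l (L - x))"
  define v1 where "v1 = (\<lambda>l x. - V1 l (L - x))"
  define w where "w = (\<lambda>l x. W l (L - x))"
  define w1 where "w1 = (\<lambda>l x. - W1 l (L - x))"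
  define v' where "v' = (\<lambda>l x. V' l (L - x))"
  define v1' where "v1' = (\<lambda>l x. - V1' l (L - x))"
  define w' where "w' = (\<lambda>l x. W' l (L - x))"
  define w1' where "w1' = (\<lambda>l x. - W1' l (L - x))"
  note defs = v_def v1_def w_def w1_def v'_def v1'_def w'_def w1'_def
  have sol: "solves \<sigma> p l 0 L (v l) (v1 l)" "solves \<sigma> p l 0 L (w l) (w1 l)"
    "solves \<sigma>' p' l 0 L (v' l) (v1' l)" "solves \<sigma>' p' l 0 L (w' l) (w1' l)" for l
    unfolding defs by (rule unreflect[OF dirichlet_solutionD(1)[OF V(1)]] unreflect[OF W(1)] unreflect[OF dirichlet_solutionD(1)[OF V'(1)]] unreflect[OF W'(1)])+
  have init: "v l L = 0" "v1 l L = -1" "w l L = 1" "w1 l L = 0" "v' l L = 0" "v1' l L = -1" "w' l L = 1" "w1' l L = 0" for l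
    unfolding defs by (simp_all add: W W' dirichlet_solutionD(2,3)[OF V(1)] dirichlet_solutionD(2,3)[OF V'(1)])
  \<comment> \<open>Cramer's rule: y is recovered from its data at L through its Wronskians with V0
    and W0, whose own Wronskian is -1.\<close>
  have expand: "y x = y L * W0 x - y1 L * V0 x"
    if "\<sigma>0 \<in> L2 0 L" "p0 \<in> L2 0 L" "solves \<sigma>0 p0 l 0 L y y1" "solves \<sigma>0 p0 l 0 L V0 V01" "solves \<sigma>0 p0 l 0 L W0 W01"
      "V0 L = 0" "V01 L = -1" "W0 L = 1" "W01 L = 0" "x \<in> {0..L}" for \<sigma>0 p0 l y y1 V0 V01 W0 W01 x
  proof -
    have 1: "y x * V01 x - y1 x * V0 x = - y L" "y x * W01 x - y1 x * W0 x = - y1 L"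
      "W0 x * V01 x - W01 x * V0 x = -1"
      using solves_wronskian_const[OF that(3,4,10) LL] solves_wronskian_const[OF that(3,5,10) LL]
        solves_wronskian_const[OF that(5,4,10) LL] that by simp_all
    have "y x * (W0 x * V01 x - W01 x * V0 x) = (y x * V01 x - y1 x * V0 x) * W0 x - (y x * W01 x - y1 x * W0 x) * V0 x"
      by (simp add: algebra_simps)
    then have "- y x = - y L * W0 x - (- y1 L) * V0 x" unfolding 1 by simp
    then show ?thesis by (simp add: algebra_simps)
  qed
  obtain C1 c1 Q1 where b1: "C1 \<ge> 0" "c1 > 0"
    "\<And>l y y1 x. \<lbrakk>dirichlet_solution \<sigma> p L l y y1; 1 \<le> cmod l; x \<in> {0..L}\<rbrakk> \<Longrightarrow>
      cmod (l * y x) \<le> C1 * exp (\<bar>Im l\<bar> * x)"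
    "\<And>l y y1. \<lbrakk>dirichlet_solution \<sigma> p L l y y1; Q1 \<le> \<bar>Im l\<bar>\<rbrakk> \<Longrightarrow>
      c1 * exp (\<bar>Im l\<bar> * L) \<le> cmod (l * y L)"
    by (rule S_bounds[OF L2(1,2) L]) (rule that)
  obtain C2 where b2: "C2 \<ge> 0"
    "\<And>l y y1 x. \<lbrakk>dirichlet_solution \<sigma>' p' L l y y1; 1 \<le> cmod l; x \<in> {0..L}\<rbrakk> \<Longrightarrow>
      cmod (l * y x) \<le> C2 * exp (\<bar>Im l\<bar> * x)"
    by (rule S_bounds[OF L2(3,4) L]) (rule that)
  obtain C3 where b3: "C3 \<ge> 0"
    "\<And>l y y1 x. \<lbrakk>dirichlet_solution (\<lambda>x. - \<sigma> (L - x)) (\<lambda>x. p (L - x)) L l y y1; 1 \<le> cmod l; x \<in> {0..L}\<rbrakk> \<Longrightarrow>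
      cmod (l * y x) \<le> C3 * exp (\<bar>Im l\<bar> * x)"
    by (rule S_bounds[OF refl2(1,2) L]) (rule that)
  obtain C4 where b4: "C4 \<ge> 0"
    "\<And>l y y1 x. \<lbrakk>dirichlet_solution (\<lambda>x. - \<sigma>' (L - x)) (\<lambda>x. p' (L - x)) L l y y1; 1 \<le> cmod l; x \<in> {0..L}\<rbrakk> \<Longrightarrow>
      cmod (l * y x) \<le> C4 * exp (\<bar>Im l\<bar> * x)"
    by (rule S_bounds[OF refl2(3,4) L]) (rule that)
  have E: "w l x * v' l x = v l x * w' l x" if x: "x \<in> {0..L}" for l x
  proof -
    have Lx: "L - x \<in> {0..L}" using x by auto
    define e where "e = (\<lambda>l. w l x * v' l x - v l x * w' l x)"
    have hole: "e holomorphic_on UNIV"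
      unfolding e_def defs by (intro holomorphic_intros V(2) W V'(2) W' Lx)
    have D: "S l x * v' l x - c * v l x * S' l x = S l L * e l" for l
    proof -
      have 1: "S l x = S l L * w l x - S1 l L * v l x"
        by (rule expand[OF L2(1,2) dirichlet_solutionD(1)[OF S] sol(1,2) init(1,2,3,4) x])
      have 2: "S' l x = S' l L * w' l x - S1' l L * v' l x"
        by (rule expand[OF L2(3,4) dirichlet_solutionD(1)[OF S'] sol(3,4) init(5,6,7,8) x])
      show ?thesis unfolding 1 2 data e_def by (simp add: algebra_simps)
    qed
    \<comment> \<open>Each solution comes with its factor l: two in the numerator, one in l S(L),
      and the third is left with e.\<close>
    obtain k where k: "\<And>l. l * e l = k"
    proof (rule entire_quotient_constant[of "\<lambda>l. l\<^sup>2 * (S l x * v' l x - c * v l x * S' l x)" "\<lambda>l. l * e l" "\<lambda>l. l * S l L" L c1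
          "C1 * C4 + cmod c * (C3 * C2)" C1 Q1])
      show "(\<lambda>l. l\<^sup>2 * (S l x * v' l x - c * v l x * S' l x)) holomorphic_on UNIV"
        unfolding defs by (intro holomorphic_intros hol V(2) V'(2) x Lx)
      show "(\<lambda>l. l * e l) holomorphic_on UNIV" by (intro holomorphic_intros hole)
      show "(\<lambda>l. l * S l L) holomorphic_on UNIV" by (intro holomorphic_intros hol LL)
      show "l\<^sup>2 * (S l x * v' l x - c * v l x * S' l x) = l * e l * (l * S l L)" for l
        unfolding D by (simp add: power2_eq_square)
      show "cmod (l * S l L) \<le> C1 * exp (L * \<bar>Im l\<bar>)" if "1 \<le> cmod l" for l
        using b1(3)[OF S that LL] by (simp add: mult.commute)
      show "c1 * exp (L * \<bar>Im l\<bar>) \<le> cmod (l * S l L)" if "Q1 \<le> \<bar>Im l\<bar>" for l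
        using b1(4)[OF S that] by (simp add: mult.commute)
      fix l :: complex assume l: "1 \<le> cmod l"
      have ee: "exp (\<bar>Im l\<bar> * x) * exp (\<bar>Im l\<bar> * (L - x)) = exp (L * \<bar>Im l\<bar>)"
        by (simp add: exp_add[symmetric] algebra_simps)
      have "l\<^sup>2 * (S l x * v' l x - c * v l x * S' l x) = (l * S l x) * (l * v' l x) - c * ((l * v l x) * (l * S' l x))"
        by (simp add: power2_eq_square algebra_simps)
      also have "cmod \<dots> \<le> cmod ((l * S l x) * (l * v' l x)) + cmod (c * ((l * v l x) * (l * S' l x)))"
        by (rule norm_triangle_ineq4)
      also have "\<dots> = cmod (l * S l x) * cmod (l * v' l x) + cmod c * (cmod (l * v l x) * cmod (l * S' l x))"
        by (simp add: norm_mult)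
      also have "\<dots> \<le> (C1 * exp (\<bar>Im l\<bar> * x)) * (C4 * exp (\<bar>Im l\<bar> * (L - x)))
          + cmod c * ((C3 * exp (\<bar>Im l\<bar> * (L - x))) * (C2 * exp (\<bar>Im l\<bar> * x)))"
        unfolding v_def v'_def using b1(1) b2(1) b3(1) b4(1)
        by (intro add_mono mult_mono mult_left_mono b1(3)[OF S l x] b2(2)[OF S' l x]
            b3(2)[OF V(1) l Lx] b4(2)[OF V'(1) l Lx]) auto
      also have "\<dots> = (C1 * C4 + cmod c * (C3 * C2)) * (exp (\<bar>Im l\<bar> * x) * exp (\<bar>Im l\<bar> * (L - x)))"
        by (simp add: algebra_simps)
      finally show "cmod (l\<^sup>2 * (S l x * v' l x - c * v l x * S' l x)) \<le> (C1 * C4 + cmod c * (C3 * C2)) * exp (L * \<bar>Im l\<bar>)"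
        unfolding ee .
    qed (use L0 b1(2) that in auto)
    have "k = 0" using k[of 0] by simp
    then have e0: "e l = 0" if "l \<noteq> 0" for l using k[of l] that by simp
    \<comment> \<open>The factor l hides the value of e at 0; continuity restores it.\<close>
    have "isCont e 0"
      using holomorphic_on_imp_continuous_on[OF hole] continuous_on_eq_continuous_at[OF open_UNIV] by blast
    then have "(e \<longlongrightarrow> e 0) (at 0)" by (simp add: isCont_def)
    moreover have "(e \<longlongrightarrow> 0) (at 0)"
      by (rule tendsto_eventually) (auto simp: eventually_at_filter e0)
    ultimately have "e 0 = 0" using tendsto_unique[OF at_neq_bot] by blast
    then have "e l = 0" using e0 by (cases "l = 0") auto
    then show ?thesis by (simp add: e_def)
  qed
  have T1: "AE x in lebesgue_on {0<..<L}. w1 l x * v1' l x - v1 l x * w1' l x = \<sigma> x - \<sigma>' x"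
    and T2: "has_AC_derivative (\<lambda>x. w1 l x * v1' l x - v1 l x * w1' l x) (\<lambda>x. - 2 * l * (p x - p' x)) 0 L" for l
    by (rule transfer_matrix_deriv[OF sol(2) sol(1) sol(4) sol(3) L init], rule E, assumption)+
  \<comment> \<open>At l = 0 the p-term is absent, so P21 is constant; it is zero at L, which gives
    \<sigma> = \<sigma>'. At l = 1 the function P21 = \<sigma> - \<sigma>' is therefore zero, and so
    is its derivative -2 (p - p').\<close>
  have P0: "has_AC_derivative (\<lambda>x. w1 0 x * v1' 0 x - v1 0 x * w1' 0 x) (\<lambda>x. 0) 0 L"
    by (rule has_AC_derivative_cong[OF T2[of 0]]) auto
  have z: "w1 0 x * v1' 0 x - v1 0 x * w1' 0 x = 0" if x: "x \<in> {0..L}" for x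
    using has_AC_derivative_zero_const[OF P0 _ x LL] init by simp
  show s: "AE x in lebesgue_on {0<..<L}. \<sigma> x = \<sigma>' x"
    using T1[of 0] AE_space
  proof eventually_elim
    case (elim x)
    then show ?case using z[of x] by simp
  qed
  have ae1: "AE x in lebesgue_on {0<..<L}. w1 1 x * v1' 1 x - v1 1 x * w1' 1 x = 0"
    using s T1[of 1] by eventually_elim simp
  have z1: "w1 1 x * v1' 1 x - v1 1 x * w1' 1 x = 0" if x: "x \<in> {0..L}" for x
    by (rule continuous_AE_eq[OF has_AC_derivative_continuous_on[OF T2] continuous_on_const ae1 x L])
  have "has_AC_derivative (\<lambda>x. 0) (\<lambda>x. - 2 * 1 * (p x - p' x)) 0 L"
    by (rule has_AC_derivative_cong[OF T2[of 1]]) (use z1 in auto)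
  from has_AC_derivative_unique_AE[OF this has_AC_derivative_const]
  show "AE x in lebesgue_on {0<..<L}. p x = p' x" by eventually_elim simp
qed

section \<open>From equal zeros to equal coefficients on the left half\<close>

lemma L2_eq_left_half:
  assumes L2: "\<sigma> \<in> L2 0 (2 * pi)" "p \<in> L2 0 (2 * pi)" "\<sigma>' \<in> L2 0 (2 * pi)" "p' \<in> L2 0 (2 * pi)"
    and \<sigma>eq: "AE x in lebesgue_on {pi<..<2 * pi}. \<sigma> x = \<sigma>' x"
    and peq: "AE x in lebesgue_on {pi<..<2 * pi}. p x = p' x"
    and ord: "\<And>z. zorder (S_sol \<sigma> p (2 * pi)) z = zorder (S_sol \<sigma>' p' (2 * pi)) z"
  shows "AE x in lebesgue_on {0<..<pi}. \<sigma> x = \<sigma>' x" "AE x in lebesgue_on {0<..<pi}. p x = p' x"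
proof -
  have pi2: "0 \<le> 2 * pi" "0 \<le> pi" "pi > 0" "2 * pi > 0" by simp_all
  obtain S S1 where S: "\<And>l. dirichlet_solution \<sigma> p (2 * pi) l (S l) (S1 l)"
    "\<And>x. x \<in> {0..2 * pi} \<Longrightarrow> (\<lambda>l. S l x) holomorphic_on UNIV" "\<And>x. x \<in> {0..2 * pi} \<Longrightarrow> (\<lambda>l. S1 l x) holomorphic_on UNIV"
    by (rule dirichlet_solution_exists[OF L2(1,2) pi2(1)]) (rule that)
  obtain S' S1' where S': "\<And>l. dirichlet_solution \<sigma>' p' (2 * pi) l (S' l) (S1' l)"
    "\<And>x. x \<in> {0..2 * pi} \<Longrightarrow> (\<lambda>l. S' l x) holomorphic_on UNIV" "\<And>x. x \<in> {0..2 * pi} \<Longrightarrow> (\<lambda>l. S1' l x) holomorphic_on UNIV"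
    by (rule dirichlet_solution_exists[OF L2(3,4) pi2(1)]) (rule that)
  define \<sigma>r where "\<sigma>r = (\<lambda>x. - \<sigma> (2 * pi - x))"
  define pr where "pr = (\<lambda>x. p (2 * pi - x))"
  have Lr: "\<sigma>r \<in> L2 0 pi" "pr \<in> L2 0 pi"
  proof -
    have "\<sigma>r \<in> L2 0 (2 * pi)" "pr \<in> L2 0 (2 * pi)"
      using L2_reflect[OF L2(1), of "2 * pi"] L2_reflect[OF L2(2), of "2 * pi"]
      by (auto simp: \<sigma>r_def pr_def intro: L2_minus)
    then show "\<sigma>r \<in> L2 0 pi" "pr \<in> L2 0 pi" by (auto intro: L2_subinterval)
  qed
  \<comment> \<open>\<psi> in reflected form: \<psi>(x) is \<open>Z l (2 * pi - x)\<close> with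
    quasi-derivative \<open>- Z1 l (2 * pi - x)\<close>. On (\<pi>, 2\<pi>) it solves both problems,
    and its data at \<pi> are Z(\<pi>) and -Z1(\<pi>).\<close>
  obtain Z Z1 where Z: "\<And>l. dirichlet_solution \<sigma>r pr pi l (Z l) (Z1 l)"
    "\<And>x. x \<in> {0..pi} \<Longrightarrow> (\<lambda>l. Z l x) holomorphic_on UNIV"
    by (rule dirichlet_solution_exists[OF Lr pi2(2)]) (rule that)
  note Sd = dirichlet_solutionD[OF S(1)] and Sd' = dirichlet_solutionD[OF S'(1)] and Zd = dirichlet_solutionD[OF Z(1)]
  \<comment> \<open>Completes Z to a fundamental system with Wronskian 1. It serves to write the
    multiplier \<open>G0\<close> as an explicit entire function, without dividing by Z.\<close>
  obtain C C1 where C: "\<And>l. solves \<sigma>r pr l 0 pi (C l) (C1 l)" "\<And>l. C l 0 = 1" "\<And>l. C1 l 0 = 0"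
    "\<And>x. x \<in> {0..pi} \<Longrightarrow> (\<lambda>l. C l x) holomorphic_on UNIV" "\<And>x. x \<in> {0..pi} \<Longrightarrow> (\<lambda>l. C1 l x) holomorphic_on UNIV"
    by (rule solves_exists[OF Lr pi2(2), of 1 0]) (rule that)
  have CZ: "C l pi * Z1 l pi - C1 l pi * Z l pi = 1" for l
    using solves_wronskian_const[OF C(1) Zd(1), of pi 0 l] C Zd by simp
  have right: "solves \<sigma> p l pi (2 * pi) (\<lambda>x. Z l (2 * pi - x)) (\<lambda>x. - Z1 l (2 * pi - x))" for l
    using solves_reflect[OF Zd(1), where k = "2 * pi"] by (simp add: \<sigma>r_def pr_def)
  have right': "solves \<sigma>' p' l pi (2 * pi) (\<lambda>x. Z l (2 * pi - x)) (\<lambda>x. - Z1 l (2 * pi - x))" for l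
    by (rule solves_cong_AE[OF right \<sigma>eq peq])
  have S2pi: "y (2 * pi) = y pi * Z1 l pi + y1 pi * Z l pi"
    if "solves \<sigma>0 p0 l 0 (2 * pi) y y1" "solves \<sigma>0 p0 l pi (2 * pi) (\<lambda>x. Z l (2 * pi - x)) (\<lambda>x. - Z1 l (2 * pi - x))"
    for \<sigma>0 p0 l y y1
    using solves_wronskian_const[OF solves_subinterval[OF that(1)] that(2), of "2 * pi" pi] Zd
    by (simp add: algebra_simps)
  have D: "S l (2 * pi) = S l pi * Z1 l pi + S1 l pi * Z l pi" for l
    by (rule S2pi[OF Sd(1) right])
  have D': "S' l (2 * pi) = S' l pi * Z1 l pi + S1' l pi * Z l pi" for l
    by (rule S2pi[OF Sd'(1) right'])
  have sol: "S_sol \<sigma> p (2 * pi) = (\<lambda>l. S l (2 * pi))" "S_sol \<sigma>' p' (2 * pi) = (\<lambda>l. S' l (2 * pi))"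
    using S_sol_eq[OF L2(1,2) Sd, of "2 * pi"] S_sol_eq[OF L2(3,4) Sd', of "2 * pi"] by auto
  obtain A c Q where b: "A \<ge> 0" "c > 0"
    "\<And>l y y1 x. \<lbrakk>dirichlet_solution \<sigma> p (2 * pi) l y y1; 1 \<le> cmod l; x \<in> {0..2 * pi}\<rbrakk> \<Longrightarrow>
      cmod (l * y x) \<le> A * exp (\<bar>Im l\<bar> * x)"
    "\<And>l y y1. \<lbrakk>dirichlet_solution \<sigma> p (2 * pi) l y y1; Q \<le> \<bar>Im l\<bar>\<rbrakk> \<Longrightarrow>
      c * exp (\<bar>Im l\<bar> * (2 * pi)) \<le> cmod (l * y (2 * pi))"
    by (rule S_bounds[OF L2(1,2) pi2(4)]) (rule that)
  obtain A' c' Q' where b': "A' \<ge> 0" "c' > 0"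
    "\<And>l y y1 x. \<lbrakk>dirichlet_solution \<sigma>' p' (2 * pi) l y y1; 1 \<le> cmod l; x \<in> {0..2 * pi}\<rbrakk> \<Longrightarrow>
      cmod (l * y x) \<le> A' * exp (\<bar>Im l\<bar> * x)"
    "\<And>l y y1. \<lbrakk>dirichlet_solution \<sigma>' p' (2 * pi) l y y1; Q' \<le> \<bar>Im l\<bar>\<rbrakk> \<Longrightarrow>
      c' * exp (\<bar>Im l\<bar> * (2 * pi)) \<le> cmod (l * y (2 * pi))"
    by (rule S_bounds[OF L2(3,4) pi2(4)]) (rule that)
  \<comment> \<open>High up on the imaginary axis the lower bound excludes a zero, so the
    characteristic function is not identically zero and its orders are genuine
    multiplicities.\<close>
  have nz: "S (\<i> * of_real \<bar>Q\<bar>) (2 * pi) \<noteq> 0"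
  proof -
    have "0 < c * exp (\<bar>Q\<bar> * (2 * pi))" using b(2) by simp
    also have "\<dots> \<le> cmod (\<i> * of_real \<bar>Q\<bar> * S (\<i> * of_real \<bar>Q\<bar>) (2 * pi))"
      using b(4)[OF S(1), of "\<i> * of_real \<bar>Q\<bar>"] by simp
    finally show ?thesis by auto
  qed
  have nz': "S' (\<i> * of_real \<bar>Q'\<bar>) (2 * pi) \<noteq> 0"
  proof -
    have "0 < c' * exp (\<bar>Q'\<bar> * (2 * pi))" using b'(2) by simp
    also have "\<dots> \<le> cmod (\<i> * of_real \<bar>Q'\<bar> * S' (\<i> * of_real \<bar>Q'\<bar>) (2 * pi))"
      using b'(4)[OF S'(1), of "\<i> * of_real \<bar>Q'\<bar>"] by simp
    finally show ?thesis by auto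
  qed
  have in2: "2 * pi \<in> {0..2 * pi}" "pi \<in> {0..2 * pi}" "pi \<in> {0..pi}" by auto
  obtain G where G: "G holomorphic_on UNIV" "\<And>l. S l (2 * pi) = G l * S' l (2 * pi)"
    using entire_quotient_same_zorder[OF S(2)[OF in2(1)] nz S'(2)[OF in2(1)] nz' ord[unfolded sol]] by blast
  obtain \<epsilon> where \<epsilon>: "\<And>l. G l = \<epsilon>"
  proof (rule entire_quotient_constant[of "\<lambda>l. l * S l (2 * pi)" G "\<lambda>l. l * S' l (2 * pi)" "2 * pi" c' A A' Q'])
    show "(\<lambda>l. l * S l (2 * pi)) holomorphic_on UNIV" "(\<lambda>l. l * S' l (2 * pi)) holomorphic_on UNIV"
      by (intro holomorphic_intros S(2,3) S'(2,3) in2)+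
    show "l * S l (2 * pi) = G l * (l * S' l (2 * pi))" for l by (simp add: G(2))
    show "cmod (l * S l (2 * pi)) \<le> A * exp (2 * pi * \<bar>Im l\<bar>)" if "1 \<le> cmod l" for l
      using b(3)[OF S(1) that in2(1)] by (simp add: mult.commute)
    show "cmod (l * S' l (2 * pi)) \<le> A' * exp (2 * pi * \<bar>Im l\<bar>)" if "1 \<le> cmod l" for l
      using b'(3)[OF S'(1) that in2(1)] by (simp add: mult.commute)
    show "c' * exp (2 * pi * \<bar>Im l\<bar>) \<le> cmod (l * S' l (2 * pi))" if "Q' \<le> \<bar>Im l\<bar>" for l
      using b'(4)[OF S'(1) that] by (simp add: mult.commute)
  qed (use G b' that in auto)
  define d where "d = (\<lambda>l. S l pi - \<epsilon> * S' l pi)"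
  define d1 where "d1 = (\<lambda>l. S1 l pi - \<epsilon> * S1' l pi)"
  have dZ: "d l * Z1 l pi = - (d1 l * Z l pi)" for l
  proof -
    have "S l (2 * pi) = \<epsilon> * S' l (2 * pi)" using G(2) \<epsilon> by simp
    then show ?thesis unfolding D D' d_def d1_def by (simp add: algebra_simps add_eq_0_iff2)
  qed
  \<comment> \<open>By \<open>dZ\<close> the vector (d, d1) is parallel to (Z, -Z1) at \<pi>. The
    factor is obtained by Cramer's rule from \<open>CZ\<close>, and it is entire by its
    form.\<close>
  define G0 where "G0 = (\<lambda>l. - C l pi * d1 l - C1 l pi * d l)"
  have G0: "d l = G0 l * Z l pi" "d1 l = - G0 l * Z1 l pi" for l
  proof -
    have "d l = (d l * Z1 l pi) * C l pi - d l * C1 l pi * Z l pi"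
      using arg_cong[OF CZ[of l], of "\<lambda>z. d l * z"] by (simp add: algebra_simps)
    then show "d l = G0 l * Z l pi" unfolding dZ by (simp add: G0_def algebra_simps)
    have "d1 l = d1 l * C l pi * Z1 l pi + C1 l pi * (- (d1 l * Z l pi))"
      using arg_cong[OF CZ[of l], of "\<lambda>z. d1 l * z"] by (simp add: algebra_simps)
    then show "d1 l = - G0 l * Z1 l pi" unfolding dZ[symmetric] by (simp add: G0_def algebra_simps)
  qed
  have Lh: "\<sigma> \<in> L2 0 pi" "p \<in> L2 0 pi" "\<sigma>' \<in> L2 0 pi" "p' \<in> L2 0 pi"
    using L2 by (auto intro: L2_subinterval)
  have Sh: "dirichlet_solution \<sigma> p pi l (S l) (S1 l)" "dirichlet_solution \<sigma>' p' pi l (S' l) (S1' l)" for l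
    using solves_subinterval[OF Sd(1), of 0 pi] solves_subinterval[OF Sd'(1), of 0 pi] Sd(2,3) Sd'(2,3)
    by (auto simp: dirichlet_solution_def)
  obtain Az cz Qz where z: "Az \<ge> 0" "cz > 0"
    "\<And>l y y1 x. \<lbrakk>dirichlet_solution \<sigma>r pr pi l y y1; 1 \<le> cmod l; x \<in> {0..pi}\<rbrakk> \<Longrightarrow>
      cmod (l * y x) \<le> Az * exp (\<bar>Im l\<bar> * x)"
    "\<And>l y y1. \<lbrakk>dirichlet_solution \<sigma>r pr pi l y y1; Qz \<le> \<bar>Im l\<bar>\<rbrakk> \<Longrightarrow>
      cz * exp (\<bar>Im l\<bar> * pi) \<le> cmod (l * y pi)"
    "\<And>e. e > 0 \<Longrightarrow> \<exists>X. \<forall>l y y1. dirichlet_solution \<sigma>r pr pi l y y1 \<longrightarrow> X \<le> Im l \<longrightarrow>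
      cmod (y1 pi + \<i> * l * y pi) \<le> e * exp (Im l * pi)"
    by (rule S_bounds[OF Lr pi2(3)]) (rule that)
  have asym: "\<exists>X. \<forall>l y y1. dirichlet_solution \<sigma>0 p0 pi l y y1 \<longrightarrow> X \<le> Im l \<longrightarrow>
      cmod (y1 pi + \<i> * l * y pi) \<le> e * exp (Im l * pi)"
    if "\<sigma>0 \<in> L2 0 pi" "p0 \<in> L2 0 pi" "e > 0" for \<sigma>0 p0 e
  proof (rule S_bounds[OF that(1,2) pi2(3)])
    assume "\<And>e. e > 0 \<Longrightarrow> \<exists>X. \<forall>l y y1. dirichlet_solution \<sigma>0 p0 pi l y y1 \<longrightarrow> X \<le> Im l \<longrightarrow>
      cmod (y1 pi + \<i> * l * y pi) \<le> e * exp (Im l * pi)"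
    from this[OF that(3)] show ?thesis .
  qed
  \<comment> \<open>l d and l Z at \<pi> both come from intervals of length \<pi>, so they share the
    growth exp(\<pi> |Im l|).\<close>
  obtain k where k: "\<And>l. G0 l = k"
  proof (rule entire_quotient_constant[of "\<lambda>l. l * d l" G0 "\<lambda>l. l * Z l pi" pi cz "A + cmod \<epsilon> * A'" Az Qz])
    show "(\<lambda>l. l * d l) holomorphic_on UNIV" unfolding d_def by (intro holomorphic_intros S(2,3) S'(2,3) in2)
    show "G0 holomorphic_on UNIV" unfolding G0_def d_def d1_def by (intro holomorphic_intros S(2,3) S'(2,3) C(4,5) in2)
    show "(\<lambda>l. l * Z l pi) holomorphic_on UNIV" by (intro holomorphic_intros Z(2) in2)
    show "l * d l = G0 l * (l * Z l pi)" for l by (simp add: G0(1))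
    show "cmod (l * d l) \<le> (A + cmod \<epsilon> * A') * exp (pi * \<bar>Im l\<bar>)" if l: "1 \<le> cmod l" for l
    proof -
      have "l * d l = l * S l pi - \<epsilon> * (l * S' l pi)" by (simp add: d_def algebra_simps)
      also have "cmod \<dots> \<le> cmod (l * S l pi) + cmod (\<epsilon> * (l * S' l pi))" by (rule norm_triangle_ineq4)
      also have "\<dots> \<le> A * exp (\<bar>Im l\<bar> * pi) + cmod \<epsilon> * (A' * exp (\<bar>Im l\<bar> * pi))"
        unfolding norm_mult[of \<epsilon>]
        by (intro add_mono mult_left_mono b(3)[OF S(1) l in2(2)] b'(3)[OF S'(1) l in2(2)]) auto
      finally show ?thesis by (simp add: algebra_simps)
    qed
    show "cmod (l * Z l pi) \<le> Az * exp (pi * \<bar>Im l\<bar>)" if "1 \<le> cmod l" for l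
      using z(3)[OF Z(1) that in2(3)] by (simp add: mult.commute)
    show "cz * exp (pi * \<bar>Im l\<bar>) \<le> cmod (l * Z l pi)" if "Qz \<le> \<bar>Im l\<bar>" for l
      using z(4)[OF Z(1) that] by (simp add: mult.commute)
  qed (use z that in auto)
  have "k = 0"
  proof (rule ccontr)
    assume k0: "k \<noteq> 0"
    \<comment> \<open>Makes (1 + |\<epsilon>| + |k|) e equal to |k| cz, half of the lower bound 2
      |k| cz it has to contradict.\<close>
    define e where "e = cmod k * cz / (1 + cmod \<epsilon> + cmod k)"
    have den: "1 + cmod \<epsilon> + cmod k > 0" using norm_ge_zero[of \<epsilon>] norm_ge_zero[of k] by linarith
    have e: "e > 0" using k0 z(2) den by (simp add: e_def)
    obtain X1 where X1: "\<And>l. X1 \<le> Im l \<Longrightarrow> cmod (S1 l pi + \<i> * l * S l pi) \<le> e * exp (Im l * pi)"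
      using asym[OF Lh(1,2) e] Sh(1) by blast
    obtain X2 where X2: "\<And>l. X2 \<le> Im l \<Longrightarrow> cmod (S1' l pi + \<i> * l * S' l pi) \<le> e * exp (Im l * pi)"
      using asym[OF Lh(3,4) e] Sh(2) by blast
    obtain X3 where X3: "\<And>l. X3 \<le> Im l \<Longrightarrow> cmod (Z1 l pi + \<i> * l * Z l pi) \<le> e * exp (Im l * pi)"
      using z(5)[OF e] Z(1) by blast
    define l where "l = \<i> * of_real (max (max (max X1 X2) (max X3 Qz)) 0)"
    have l: "X1 \<le> Im l" "X2 \<le> Im l" "X3 \<le> Im l" "Qz \<le> \<bar>Im l\<bar>" "\<bar>Im l\<bar> = Im l" by (auto simp: l_def)
    define E where "E = exp (Im l * pi)"
    have E: "E > 0" by (simp add: E_def)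
    \<comment> \<open>d1 + \<i> l d is small because S and S' start on the left, and Z1 + \<i> l Z
      is small because the reflected solution does. Owing to the sign in d1 = -k Z1 they add up to 2
      \<i> k l Z, which is not small.\<close>
    have "2 * \<i> * k * (l * Z l pi) = (d1 l + \<i> * l * d l) + k * (Z1 l pi + \<i> * l * Z l pi)"
      unfolding G0 k by (simp add: algebra_simps)
    also have "d1 l + \<i> * l * d l = (S1 l pi + \<i> * l * S l pi) - \<epsilon> * (S1' l pi + \<i> * l * S' l pi)"
      by (simp add: d_def d1_def algebra_simps)
    finally have "cmod (2 * \<i> * k * (l * Z l pi)) \<le>
        cmod (S1 l pi + \<i> * l * S l pi) + cmod (\<epsilon> * (S1' l pi + \<i> * l * S' l pi)) + cmod (k * (Z1 l pi + \<i> * l * Z l pi))"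
      by (simp only:) (rule order_trans[OF norm_triangle_ineq add_right_mono[OF norm_triangle_ineq4]])
    also have "\<dots> \<le> e * E + cmod \<epsilon> * (e * E) + cmod k * (e * E)"
      unfolding norm_mult[of \<epsilon>] norm_mult[of k] E_def
      by (intro add_mono mult_left_mono X1 X2 X3 l) auto
    also have "\<dots> = (1 + cmod \<epsilon> + cmod k) * e * E" by (simp add: algebra_simps)
    also have "\<dots> = cmod k * cz * E" using den by (simp add: e_def)
    finally have "2 * cmod k * cmod (l * Z l pi) \<le> cmod k * cz * E" by (simp add: norm_mult)
    moreover have "2 * cmod k * (cz * E) \<le> 2 * cmod k * cmod (l * Z l pi)"
      using z(4)[OF Z(1) l(4)] l(5) unfolding E_def by (intro mult_left_mono) auto
    ultimately have "cmod k * cz * E \<le> 0" by (simp add: mult_ac)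
    moreover have "cmod k * cz * E > 0" using k0 z(2) E by simp
    ultimately show False by linarith
  qed
  then have data: "S l pi = \<epsilon> * S' l pi" "S1 l pi = \<epsilon> * S1' l pi" for l
    using G0[of l] k by (simp_all add: d_def d1_def)
  have hol: "(\<lambda>l. S l x) holomorphic_on UNIV" "(\<lambda>l. S' l x) holomorphic_on UNIV" if "x \<in> {0..pi}" for x
    using S(2)[of x] S'(2)[of x] that by auto
  show "AE x in lebesgue_on {0<..<pi}. \<sigma> x = \<sigma>' x"
    by (rule cauchy_data_determine_coefficients(1)[OF Lh pi2(3) Sh hol data])
  show "AE x in lebesgue_on {0<..<pi}. p x = p' x"
    by (rule cauchy_data_determine_coefficients(2)[OF Lh pi2(3) Sh hol data])
qed

section \<open>Aligning the antiderivatives on the right half\<close>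

lemma S_sol_add_const:
  assumes \<sigma>: "\<sigma> \<in> L2 0 (2 * pi)" and p: "p \<in> L2 0 (2 * pi)"
  shows "S_sol (\<lambda>x. \<sigma> x + k) p (2 * pi) = S_sol \<sigma> p (2 * pi)"
proof
  fix l
  obtain S S1 where "\<And>l. dirichlet_solution \<sigma> p (2 * pi) l (S l) (S1 l)"
    by (rule dirichlet_solution_exists[OF \<sigma> p]) auto
  note S = dirichlet_solutionD[OF this]
  have "S_sol \<sigma> p (2 * pi) l = S l (2 * pi)" by (rule S_sol_eq[OF \<sigma> p S]) auto
  moreover have "S_sol (\<lambda>x. \<sigma> x + k) p (2 * pi) l = S l (2 * pi)"
    by (rule S_sol_eq[OF L2_add_const[OF \<sigma>] p solves_add_const[OF S(1)]]) (auto simp: S)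
  ultimately show "S_sol (\<lambda>x. \<sigma> x + k) p (2 * pi) l = S_sol \<sigma> p (2 * pi) l" by simp
qed

text \<open>A test function on (\<pi>, 2\<pi>) is one on (0, 2\<pi>), where both functionals are
  expressed by their antiderivatives. As its derivative vanishes on the left half, the integrals
  reduce to (\<pi>, 2\<pi>), and du Bois-Reymond applies to \<sigma> - \<sigma>' there.\<close>

lemma distribution_eq_imp_diff_const:
  assumes \<sigma>: "\<sigma> \<in> L2 0 (2 * pi)" "\<sigma>' \<in> L2 0 (2 * pi)"
    and q: "distribution_eq 0 (2 * pi) q (distribution_deriv 0 (2 * pi) \<sigma>)"
    and q': "distribution_eq 0 (2 * pi) q' (distribution_deriv 0 (2 * pi) \<sigma>')"
    and eq: "distribution_eq pi (2 * pi) q q'"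
  obtains k where "AE x in lebesgue_on {pi<..<2 * pi}. \<sigma> x = \<sigma>' x + k"
proof -
  have i: "\<sigma> absolutely_integrable_on {0..2 * pi}" "\<sigma>' absolutely_integrable_on {0..2 * pi}"
    using \<sigma> by (auto simp: L2_iff)
  have sub: "{pi..2 * pi} \<subseteq> {0..2 * pi}" by auto
  have g: "(\<lambda>x. \<sigma> x - \<sigma>' x) absolutely_integrable_on {0..2 * pi}" by (intro set_integral_diff i)
  then have g': "(\<lambda>x. \<sigma> x - \<sigma>' x) absolutely_integrable_on {pi..2 * pi}"
    by (rule set_integrable_subset) (use sub in auto)
  obtain k where "AE x in lebesgue_on {pi<..<2 * pi}. \<sigma> x - \<sigma>' x = k"
  proof (rule du_Bois_Reymond[OF g'])
    fix \<phi> assume \<phi>: "\<phi> \<in> test_functions pi (2 * pi)"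
    then have \<phi>0: "\<phi> \<in> test_functions 0 (2 * pi)" using test_functions_mono[of 0 pi "2 * pi" "2 * pi"] by auto
    let ?d = "\<lambda>x. vector_derivative \<phi> (at x)"
    have ii: "(\<lambda>x. \<sigma> x * ?d x) integrable_on {0..2 * pi}" "(\<lambda>x. \<sigma>' x * ?d x) integrable_on {0..2 * pi}"
      using absolutely_integrable_mult_continuous[OF i(1) test_functionD(2)[OF \<phi>0]]
        absolutely_integrable_mult_continuous[OF i(2) test_functionD(2)[OF \<phi>0]]
      by (auto simp: absolutely_integrable_on_def)
    have "distribution_deriv 0 (2 * pi) \<sigma> \<phi> = distribution_deriv 0 (2 * pi) \<sigma>' \<phi>"
      using q q' eq \<phi> \<phi>0 unfolding distribution_eq_def by metis
    then have "integral {0..2 * pi} (\<lambda>x. \<sigma> x * ?d x) = integral {0..2 * pi} (\<lambda>x. \<sigma>' x * ?d x)"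
      using \<sigma> \<phi>0 by (simp add: distribution_deriv_eq_integral)
    then have "integral {0..2 * pi} (\<lambda>x. \<sigma> x * ?d x - \<sigma>' x * ?d x) = 0"
      by (subst integral_diff[OF ii]) simp
    moreover have "integral {0..2 * pi} (\<lambda>x. \<sigma> x * ?d x - \<sigma>' x * ?d x)
        = integral {0..2 * pi} (\<lambda>x. if x \<in> {pi..2 * pi} then (\<sigma> x - \<sigma>' x) * ?d x else 0)"
      by (rule integral_cong) (use test_functionD(4)[OF \<phi>] in \<open>auto simp: algebra_simps\<close>)
    moreover have "{pi..2 * pi} \<inter> {0..2 * pi} = {pi..2 * pi}" by auto
    ultimately show "integral {pi..2 * pi} (\<lambda>x. (\<sigma> x - \<sigma>' x) * ?d x) = 0"
      by (simp only: integral_restrict_Int Int_commute)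
  qed (use that in auto)
  then have "AE x in lebesgue_on {pi<..<2 * pi}. \<sigma> x = \<sigma>' x + k"
    by eventually_elim (simp add: algebra_simps)
  then show thesis by (rule that)
qed

lemma AE_lebesgue_on_glue:
  assumes "AE x in lebesgue_on {a<..<b::real}. P x" "AE x in lebesgue_on {b<..<c}. P x"
  shows "AE x in lebesgue_on {a<..<c}. P x"
proof -
  have "negligible ({x \<in> {a<..<b}. \<not> P x} \<union> {x \<in> {b<..<c}. \<not> P x} \<union> {b})"
    using assms unfolding AE_lebesgue_on_negligible by (intro negligible_Un) auto
  then show ?thesis unfolding AE_lebesgue_on_negligible by (rule negligible_subset) auto
qed

theorem theorem3:
  fixes p p' :: "real \<Rightarrow> complex" and q q' :: distribution
    and \<mu> \<mu>' :: "int \<Rightarrow> complex"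
  assumes "p \<in> L2 0 (2 * pi)" and "p' \<in> L2 0 (2 * pi)"
    and "q \<in> W2_neg1 0 (2 * pi)" and "q' \<in> W2_neg1 0 (2 * pi)"
    and "dirichlet_eigenvalues q p \<mu>" and "dirichlet_eigenvalues q' p' \<mu>'"
    and "distribution_eq pi (2 * pi) q q'" and "L2_eq pi (2 * pi) p p'"
    and "same_multiset \<mu> \<mu>'"
  shows "distribution_eq 0 (2 * pi) q q' \<and> L2_eq 0 (2 * pi) p p'"
proof -
  obtain \<sigma> where \<sigma>: "\<sigma> \<in> L2 0 (2 * pi)" "distribution_eq 0 (2 * pi) q (distribution_deriv 0 (2 * pi) \<sigma>)"
    "enumerates_zeros (S_sol \<sigma> p (2 * pi)) \<mu>"
    using assms(5) unfolding dirichlet_eigenvalues_def by blast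
  obtain \<sigma>' where \<sigma>': "\<sigma>' \<in> L2 0 (2 * pi)" "distribution_eq 0 (2 * pi) q' (distribution_deriv 0 (2 * pi) \<sigma>')"
    "enumerates_zeros (S_sol \<sigma>' p' (2 * pi)) \<mu>'"
    using assms(6) unfolding dirichlet_eigenvalues_def by blast
  obtain k where k: "AE x in lebesgue_on {pi<..<2 * pi}. \<sigma> x = \<sigma>' x + k"
    by (rule distribution_eq_imp_diff_const[OF \<sigma>(1) \<sigma>'(1) \<sigma>(2) \<sigma>'(2) assms(7)])
  \<comment> \<open>Replacing \<sigma>' by \<sigma>' + k changes neither the distribution nor the
    characteristic function, and makes the two systems agree almost everywhere on (\<pi>,
    2\<pi>).\<close>
  define \<tau> where "\<tau> = (\<lambda>x. \<sigma>' x + k)"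
  have \<tau>: "\<tau> \<in> L2 0 (2 * pi)" unfolding \<tau>_def by (rule L2_add_const[OF \<sigma>'(1)])
  have \<sigma>\<tau>: "AE x in lebesgue_on {pi<..<2 * pi}. \<sigma> x = \<tau> x" using k by (simp add: \<tau>_def)
  have pp: "AE x in lebesgue_on {pi<..<2 * pi}. p x = p' x" using assms(8) by (simp add: L2_eq_def)
  \<comment> \<open>At every z the order is the number of indices with value z, so equal multisets
    mean equal orders everywhere.\<close>
  have ord: "zorder (S_sol \<sigma> p (2 * pi)) z = zorder (S_sol \<tau> p' (2 * pi)) z" for z
    using \<sigma>(3) \<sigma>'(3) assms(9)
    unfolding enumerates_zeros_def same_multiset_def \<tau>_def S_sol_add_const[OF \<sigma>'(1) assms(2)] by metis
  note left = L2_eq_left_half[OF \<sigma>(1) assms(1) \<tau> assms(2) \<sigma>\<tau> pp ord]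
  have "AE x in lebesgue_on {0<..<2 * pi}. \<sigma> x = \<tau> x"
    by (rule AE_lebesgue_on_glue[OF left(1) \<sigma>\<tau>])
  then have deriv: "distribution_deriv 0 (2 * pi) \<sigma> \<phi> = distribution_deriv 0 (2 * pi) \<tau> \<phi>"
    if "\<phi> \<in> test_functions 0 (2 * pi)" for \<phi>
  proof -
    have m: "\<sigma> \<in> borel_measurable (lebesgue_on {0<..<2 * pi})" "\<tau> \<in> borel_measurable (lebesgue_on {0<..<2 * pi})"
      using \<sigma>(1) \<tau> by (auto simp: L2_def)
    have md: "(\<lambda>x. vector_derivative \<phi> (at x)) \<in> borel_measurable (lebesgue_on {0<..<2 * pi})"
      by (intro continuous_imp_measurable_on_sets_lebesgue test_functionD[OF that]) auto
    have "(LINT x|lebesgue_on {0<..<2 * pi}. \<sigma> x * vector_derivative \<phi> (at x))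
        = (LINT x|lebesgue_on {0<..<2 * pi}. \<tau> x * vector_derivative \<phi> (at x))"
      by (rule integral_cong_AE) (use m md \<open>AE x in lebesgue_on {0<..<2 * pi}. \<sigma> x = \<tau> x\<close> in auto)
    then show ?thesis by (simp add: distribution_deriv_def)
  qed
  have "q \<phi> = q' \<phi>" if \<phi>: "\<phi> \<in> test_functions 0 (2 * pi)" for \<phi>
  proof -
    have "q \<phi> = distribution_deriv 0 (2 * pi) \<tau> \<phi>"
      using \<sigma>(2) \<phi> deriv[OF \<phi>] by (simp add: distribution_eq_def)
    also have "\<dots> = distribution_deriv 0 (2 * pi) \<sigma>' \<phi>"
      unfolding \<tau>_def by (rule distribution_deriv_add_const[OF \<sigma>'(1) \<phi>]) simp
    also have "\<dots> = q' \<phi>" using \<sigma>'(2) \<phi> by (simp add: distribution_eq_def)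
    finally show ?thesis .
  qed
  moreover have "L2_eq 0 (2 * pi) p p'"
    unfolding L2_eq_def by (rule AE_lebesgue_on_glue[OF left(2) pp])
  ultimately show ?thesis by (simp add: distribution_eq_def)
qed

end
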